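(* Let $L=(L_t)_{t\in[0,T)}$ be a continuous martingale with $L_t\in L_2$ for $t\in[0,T)$ and $L_0\equiv0$, such that its quadratic variation has a representation $$[L]_b(\omega)=\int_0^bD(u,\omega)\,du<\infty\quad\text{for }(b,\omega)\in[0,T)\times\Omega,$$ where $D:[0,T)\times\Omega\to[0,\infty)$ is progressively measurable. Then for $\theta\in(0,1]$ one has $$\lim_{n\to\infty}\left\|\frac{2\theta n}{T}[L;\tau_n^\theta]_b-\big[\mathcal I^{\frac{1-\theta}{2}}L\big]_b\right\|_{L_1}=0\quad\text{for } b\in[0,T).$$
   Context: Fix $T\in(0,\infty)$ and a complete probability space $(\Omega,\mathcal F,\mathbb P)$ with a right-continuous filtration $(\mathcal F_t)_{t\in[0,T]}$ such that $\mathcal F_0$ is generated by the $\mathbb P$-null sets and $\mathcal F=\mathcal F_T$. $[M]=([M]_t)_{t\in[0,T)}$ denotes the quadratic variation (square bracket) process of a martingale $M$. $\mathcal I_t^\alpha L:=\frac{\alpha}{T^\alpha}\int_0^T(T-u)^{\alpha-1}L_{u\wedge t}\,du$ for $\alpha>0$, $\mathcal I_t^0L:=L_t$, $t\in[0,T)$ (path-wise); $\mathcal I^\alpha L=(\mathcal I_t^\alpha L)_{t\in[0,T)}$, which is again a martingale. For a time-net $\tau=\{t_i\}_{i=0}^n$ with $0=t_0<\dots<t_n=T$ and $b\in[0,T)$, $[L;\tau]_b:=\int_0^b\big|L_u-\sum_{i=1}^nL_{t_{i-1}}\mathbf 1_{(t_{i-1},t_i]}(u)\big|^2du$. The nets are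 $\tau_n^\theta=\{t_{i,n}^\theta\}_{i=0}^n$ with $t_{i,n}^\theta:=T-T(1-\frac in)^{1/\theta}$. *)

theory Defs
  imports "HOL-Probability.Probability"
begin

text \<open>
  Time-indexed families are total functions on \<open>real\<close>. Filtrations are used on \<open>{0..T}\<close> only and
  processes on \<open>{0..<T}\<close> only; no condition is imposed on, and no use is made of, other times.
\<close>

locale stochastic_basis = prob_space P + complete_measure P
  for P :: "'a measure" +
  fixes F :: "real \<Rightarrow> 'a measure" and T :: real
  assumes T_pos: "0 < T"
    and subalg: "t \<in> {0..T} \<Longrightarrow> subalgebra P (F t)"
    and increasing: "0 \<le> s \<Longrightarrow> s \<le> t \<Longrightarrow> t \<le> T \<Longrightarrow> sets (F s) \<subseteq> sets (F t)"
    and right_continuous: "t \<in> {0..<T} \<Longrightarrow> sets (F t) = (\<Inter>s\<in>{t<..T}. sets (F s))"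
    and initial: "sets (F 0) = sigma_sets (space P) (null_sets P)"
    and final: "sets (F T) = sets P"

definition adapted_process ::
  "(real \<Rightarrow> 'a measure) \<Rightarrow> real \<Rightarrow> (real \<Rightarrow> 'a \<Rightarrow> real) \<Rightarrow> bool" where
  "adapted_process F T X \<longleftrightarrow> (\<forall>t\<in>{0..<T}. X t \<in> borel_measurable (F t))"

definition progressively_measurable ::
  "(real \<Rightarrow> 'a measure) \<Rightarrow> real \<Rightarrow> (real \<Rightarrow> 'a \<Rightarrow> real) \<Rightarrow> bool" where
  "progressively_measurable F T X \<longleftrightarrow>
     (\<forall>t\<in>{0..<T}. (\<lambda>(u, \<omega>). X u \<omega>)
        \<in> borel_measurable (restrict_space borel {0..t} \<Otimes>\<^sub>M F t))"

definition martingale_process ::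
  "'a measure \<Rightarrow> (real \<Rightarrow> 'a measure) \<Rightarrow> real \<Rightarrow> (real \<Rightarrow> 'a \<Rightarrow> real) \<Rightarrow> bool" where
  "martingale_process P F T M \<longleftrightarrow>
     adapted_process F T M \<and>
     (\<forall>t\<in>{0..<T}. integrable P (M t)) \<and>
     (\<forall>s t. 0 \<le> s \<and> s \<le> t \<and> t < T \<longrightarrow>
        (AE \<omega> in P. real_cond_exp P (F s) (M t) \<omega> = M s \<omega>))"

definition is_partition :: "real \<Rightarrow> nat \<Rightarrow> (nat \<Rightarrow> real) \<Rightarrow> bool" where
  "is_partition t n p \<longleftrightarrow> p 0 = 0 \<and> p n = t \<and> (\<forall>i<n. p i \<le> p (Suc i))"

text \<open>
  \<open>Q\<close> is (a version of) the quadratic variation \<open>[M]\<close> of the continuous martingale \<open>M\<close>: for every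
  \<open>t\<close>, the sums of squared increments over partitions of \<open>{0..t}\<close> converge to \<open>Q t\<close> in probability
  as the mesh tends to zero. The bracket is determined up to indistinguishability only; hence a
  predicate, and path properties are required almost surely. The normalisation is
  \<open>[M]\<^sub>0 = 0\<close>, which for \<open>M\<^sub>0 = 0\<close> agrees with the convention \<open>[M]\<^sub>0 = M\<^sub>0\<^sup>2\<close>.
\<close>

definition quadratic_variation ::
  "'a measure \<Rightarrow> (real \<Rightarrow> 'a measure) \<Rightarrow> real \<Rightarrow> (real \<Rightarrow> 'a \<Rightarrow> real) \<Rightarrow>
    (real \<Rightarrow> 'a \<Rightarrow> real) \<Rightarrow> bool" where
  "quadratic_variation P F T M Q \<longleftrightarrow>
     adapted_process F T Q \<and>
     (AE \<omega> in P. Q 0 \<omega> = 0 \<and> mono_on {0..<T} (\<lambda>t. Q t \<omega>) \<and> continuous_on {0..<T} (\<lambda>t. Q t \<omega>)) \<and>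
     (\<forall>t\<in>{0..<T}. \<forall>\<epsilon>>0. \<forall>\<eta>>0. \<exists>\<delta>>0. \<forall>n p.
        is_partition t n p \<and> (\<forall>i<n. p (Suc i) - p i < \<delta>) \<longrightarrow>
        measure P {\<omega> \<in> space P. \<bar>(\<Sum>i<n. (M (p (Suc i)) \<omega> - M (p i) \<omega>)\<^sup>2) - Q t \<omega>\<bar> > \<epsilon>} < \<eta>)"

text \<open>The Riemann--Liouville type operator \<open>\<I>\<^sup>\<alpha>\<close>; for \<open>t < T\<close> only values of \<open>L\<close> on \<open>{0..t}\<close> enter.\<close>

definition RL_operator ::
  "real \<Rightarrow> real \<Rightarrow> (real \<Rightarrow> 'a \<Rightarrow> real) \<Rightarrow> real \<Rightarrow> 'a \<Rightarrow> real" where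
  "RL_operator T \<alpha> L t \<omega> =
     (if \<alpha> = 0 then L t \<omega>
      else \<alpha> / T powr \<alpha> * (LBINT u:{0..T}. (T - u) powr (\<alpha> - 1) * L (min u t) \<omega>))"

text \<open>\<open>[L; \<tau>]\<^sub>b\<close> for the net \<open>\<tau> 0 < \<dots> < \<tau> n\<close>.\<close>

definition net_error ::
  "(real \<Rightarrow> 'a \<Rightarrow> real) \<Rightarrow> nat \<Rightarrow> (nat \<Rightarrow> real) \<Rightarrow> real \<Rightarrow> 'a \<Rightarrow> real" where
  "net_error L n \<tau> b \<omega> =
     (LBINT u:{0..b}. \<bar>L u \<omega> - (\<Sum>i=1..n. L (\<tau> (i - 1)) \<omega> * indicator {\<tau> (i - 1)<..\<tau> i} u)\<bar>\<^sup>2)"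

definition theta_net :: "real \<Rightarrow> real \<Rightarrow> nat \<Rightarrow> nat \<Rightarrow> real" where
  "theta_net T \<theta> n i = T - T * (1 - real i / real n) powr (1 / \<theta>)"

text \<open>The \<open>L\<^sub>1\<close> norm with values in \<open>[0, \<infinity>]\<close>, so that it is \<open>\<infinity>\<close> for non-integrable functions.\<close>

definition L1_norm :: "'a measure \<Rightarrow> ('a \<Rightarrow> real) \<Rightarrow> ennreal" where
  "L1_norm P X = (\<integral>\<^sup>+ \<omega>. ennreal \<bar>X \<omega>\<bar> \<partial>P)"

end

theory Submission
  imports Defs
begin

text \<open>
  No stochastic integral is used. Write \<open>Q\<close> for the bracket of \<open>L\<close>. A truncation argument shows
  that the sums of squares along partitions are uniformly integrable, so they converge to \<open>Q\<close> in
  \<open>L\<^sub>1\<close>. As in the Saks--Henstock lemma this remains true, with a uniform error, if only some of the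
  intervals of a fine partition are summed, and hence, by convexity, for weighted sums with weights
  in \<open>{0..1}\<close>. After the substitution \<open>u = t\<^sub>i + x (t\<^sub>i\<^sub>+\<^sub>1 - t\<^sub>i)\<close> the scaled error
  \<open>[L; \<tau>]\<^sub>b\<close> is an average over \<open>x\<close> of such weighted sums, where the weights are values of
  \<open>((T - u) / T)\<^sup>1\<^sup>-\<^sup>\<theta>\<close> by the mean value theorem, so the martingale part vanishes in the limit and
  what remains is a deterministic limit on the paths of \<open>Q\<close>. The bracket of \<open>\<I>\<^sup>\<alpha> L\<close> is
  identified by comparing its increments with \<open>((T - t) / T)\<^sup>\<alpha>\<close> times those of \<open>L\<close>.
\<close>

subsection \<open>Truncation\<close>

text \<open>The obstacle is that the bracket is only a limit in probability and \<open>L t\<close>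
  is only in L_2: squared increments have no second moment that would give uniform integrability,
  and even equality of the means of \<open>Q t\<close> and \<open>(L t)\<^sup>2\<close> has to be
  derived. Replacing the square by a function of linear growth restores a second moment. The
  constants fit together as follows. The net is the image of the uniform grid under f x = T - T (1 -
  x) powr (1 / \<theta>), and \<theta> / T times the derivative of f, written in terms of u = f x,
  is ((T - u) / T) powr (1 - \<theta>). Thus \<theta> n / T times an interval length is such a
  value, and the remaining factor 2 of 2 \<theta> n / T compensates the average 1/2 of a linear
  function that grows from 0 to 1. On the other side the transform is formally the integral of ((T -
  u) / T) powr \<alpha> against L, so its bracket has the density ((T - u) / T) powr (2 \<alpha>)
  times D, and 2 \<alpha> = 1 - \<theta>. Taking b < T keeps the kernel (T - u) powr (\<alpha> - 1)
  bounded, and \<theta> \<le> 1 keeps the weights below 1 and the mesh of order 1 / n.\<close>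

lemma integrable_mult_of_squares:
  fixes f g :: "'a \<Rightarrow> real"
  assumes [measurable]: "f \<in> borel_measurable M" "g \<in> borel_measurable M"
    and "integrable M (\<lambda>x. (f x)\<^sup>2)" "integrable M (\<lambda>x. (g x)\<^sup>2)"
  shows "integrable M (\<lambda>x. f x * g x)"
proof (rule Bochner_Integration.integrable_bound)
  show "integrable M (\<lambda>x. (f x)\<^sup>2 + (g x)\<^sup>2)" using assms by simp
  have "\<bar>a * b\<bar> \<le> a\<^sup>2 + b\<^sup>2" for a b :: real
    using sum_squares_bound[of "\<bar>a\<bar>" "\<bar>b\<bar>"] abs_ge_zero[of "a * b"]
    unfolding power2_abs abs_mult by linarith
  then show "AE x in M. norm (f x * g x) \<le> norm ((f x)\<^sup>2 + (g x)\<^sup>2)" by auto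
qed measurable

lemma integrable_diff_square:
  fixes f g :: "'a \<Rightarrow> real"
  assumes "f \<in> borel_measurable M" "g \<in> borel_measurable M"
    and "integrable M (\<lambda>x. (f x)\<^sup>2)" "integrable M (\<lambda>x. (g x)\<^sup>2)"
  shows "integrable M (\<lambda>x. (f x - g x)\<^sup>2)"
  unfolding power2_diff using assms integrable_mult_of_squares[OF assms]
  by (simp add: mult.assoc)

lemma integrable_bounded_mult:
  fixes f g :: "'a \<Rightarrow> real"
  assumes [measurable]: "f \<in> borel_measurable M" and "integrable M g" and "\<And>x. \<bar>f x\<bar> \<le> B"
  shows "integrable M (\<lambda>x. f x * g x)"
proof (rule Bochner_Integration.integrable_bound)
  show "integrable M (\<lambda>x. B * g x)" using assms by simp
  have "\<bar>f x * g x\<bar> \<le> \<bar>B * g x\<bar>" for x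
    using assms(3)[of x] by (auto simp: abs_mult intro!: mult_right_mono)
  then show "AE x in M. norm (f x * g x) \<le> norm (B * g x)" by auto
  show "(\<lambda>x. f x * g x) \<in> borel_measurable M" using assms by measurable
qed

definition trunc :: "real \<Rightarrow> real \<Rightarrow> real" where
  "trunc K x = max (- K) (min K x)"

text \<open>The Huber function: for nonnegative \<open>K\<close> the subtracted term is the squared
  distance of \<open>x\<close> from the interval between \<open>- K\<close> and \<open>K\<close>.
  Its linear growth makes \<open>huber K (L t)\<close> square integrable when \<open>L t\<close>
  is.\<close>

definition huber :: "real \<Rightarrow> real \<Rightarrow> real" where
  "huber K x = x\<^sup>2 - (x - trunc K x)\<^sup>2"

lemma trunc_measurable [measurable]: "trunc K \<in> borel_measurable borel"
  unfolding trunc_def by measurable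

lemma huber_measurable [measurable]: "huber K \<in> borel_measurable borel"
  unfolding huber_def by measurable

lemma abs_trunc: "0 \<le> K \<Longrightarrow> \<bar>trunc K x\<bar> \<le> K"
  by (auto simp: trunc_def)

lemma trunc_square: "0 \<le> K \<Longrightarrow> (trunc K x)\<^sup>2 \<le> K\<^sup>2"
  using abs_trunc[of K x] by (simp flip: abs_le_square_iff)

lemma huber_zero [simp]: "0 \<le> K \<Longrightarrow> huber K 0 = 0"
  by (simp add: huber_def trunc_def)

lemma huber_le: "huber K x \<le> x\<^sup>2"
  by (simp add: huber_def)

lemma huber_eq: "\<bar>x\<bar> \<le> K \<Longrightarrow> huber K x = x\<^sup>2"
  by (auto simp: huber_def trunc_def)

lemma huber_alt:
  assumes "0 \<le> K"
  shows "huber K x = (if \<bar>x\<bar> \<le> K then x\<^sup>2 else 2 * K * \<bar>x\<bar> - K\<^sup>2)"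
  using assms by (auto simp: huber_def trunc_def power2_eq_square algebra_simps abs_if max_def min_def)

lemma huber_nonneg:
  assumes "0 \<le> K" shows "0 \<le> huber K x"
proof -
  have "0 \<le> K * (2 * \<bar>x\<bar> - K)" if "K < \<bar>x\<bar>" using that assms by (intro mult_nonneg_nonneg) auto
  then show ?thesis using huber_alt[OF assms, of x] by (auto simp: power2_eq_square algebra_simps)
qed

lemma huber_linear_bound:
  assumes "0 \<le> K" shows "huber K x \<le> 2 * K * \<bar>x\<bar>"
proof -
  have "\<bar>x\<bar> * \<bar>x\<bar> \<le> K * \<bar>x\<bar>" if "\<bar>x\<bar> \<le> K" using that by (intro mult_right_mono) auto
  moreover have "0 \<le> K * \<bar>x\<bar>" using assms by auto
  ultimately have "\<bar>x\<bar> * \<bar>x\<bar> \<le> 2 * K * \<bar>x\<bar>" if "\<bar>x\<bar> \<le> K" using that by linarith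
  then show ?thesis using huber_alt[OF assms, of x] by (auto simp: power2_eq_square)
qed

text \<open>The derivative \<open>2 * trunc K\<close> of \<open>huber K\<close> is \<open>2\<close>-Lipschitz.\<close>

lemma huber_taylor:
  assumes "0 \<le> K"
  shows "huber K b \<le> huber K a + 2 * trunc K a * (b - a) + (b - a)\<^sup>2"
proof -
  \<comment> \<open>Expanding \<open>huber\<close> cancels \<open>b\<^sup>2\<close> and leaves
    exactly this inequality. If \<open>a\<close> is not truncated, the left side is 0. If
    \<open>a\<close> and \<open>b\<close> lie beyond the same end, their truncations agree.
    Otherwise that end separates \<open>a\<close> from \<open>b\<close>, and the left side is at
    most 0.\<close>
  have "(b - trunc K a)\<^sup>2 - (a - b)\<^sup>2 \<le> (b - trunc K b)\<^sup>2"
  proof -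
    consider "\<bar>a\<bar> \<le> K" | "a > K" "b > K" | "a > K" "b \<le> K" | "a < - K" "b < - K" | "a < - K" "b \<ge> - K"
      by linarith
    then show ?thesis
    proof cases
      case 1 then show ?thesis by (auto simp: trunc_def power2_commute)
    next
      case 2 then show ?thesis using assms by (auto simp: trunc_def)
    next
      case 3
      then have "trunc K a = K" using assms by (auto simp: trunc_def)
      moreover have "(b - K)\<^sup>2 \<le> (a - b)\<^sup>2" using 3 by (intro abs_le_square_iff[THEN iffD1]) auto
      ultimately show ?thesis by (smt (verit) zero_le_power2)
    next
      case 4 then show ?thesis using assms by (auto simp: trunc_def)
    next
      case 5
      then have "trunc K a = - K" using assms by (auto simp: trunc_def)
      moreover have "(b + K)\<^sup>2 \<le> (a - b)\<^sup>2" using 5 by (intro abs_le_square_iff[THEN iffD1]) auto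
      ultimately show ?thesis by (smt (verit) zero_le_power2)
    qed
  qed
  then show ?thesis by (simp add: huber_def power2_eq_square algebra_simps)
qed

text \<open>Uniform integrability in quantitative form: above \<open>R\<close> the value
  \<open>x\<close> is at most \<open>x\<^sup>2 / R\<close>. A second moment bound for
  \<open>x\<close> therefore allows the dominating \<open>s\<close> to be cut off at
  \<open>R\<close> with a loss of order 1 / \<open>R\<close>.\<close>

lemma le_min_add_square:
  fixes x s R :: real
  assumes "x \<le> s" "0 < R"
  shows "x \<le> min s R + x\<^sup>2 / R"
proof (cases "x \<le> R")
  case True then show ?thesis using assms by (simp add: min_def add_increasing2)
next
  case False
  then have "x * R \<le> x\<^sup>2" using assms by (auto simp: power2_eq_square)
  then have "x \<le> x\<^sup>2 / R" using assms by (simp add: pos_le_divide_eq)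
  moreover have "0 \<le> min s R" using False assms by auto
  ultimately show ?thesis by linarith
qed

abbreviation mesh_below :: "real \<Rightarrow> nat \<Rightarrow> (nat \<Rightarrow> real) \<Rightarrow> bool" where
  "mesh_below \<delta> n p \<equiv> \<forall>i<n. p (Suc i) - p i < \<delta>"

lemma partition_bounds:
  assumes "is_partition t n p" "i \<le> n"
  shows "0 \<le> p i" "p i \<le> t"
proof -
  have step: "\<And>i. i < n \<Longrightarrow> p i \<le> p (Suc i)" and ends: "p 0 = 0" "p n = t"
    using assms(1) by (auto simp: is_partition_def)
  show "0 \<le> p i" using assms(2)
  proof (induction i)
    case (Suc i) then show ?case using step[of i] by simp
  qed (use ends in simp)
  show "p i \<le> t" using assms(2)
  proof (induction rule: inc_induct)
    case (step i) then show ?case using \<open>\<And>i. i < n \<Longrightarrow> p i \<le> p (Suc i)\<close>[of i] by simp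
  qed (use ends in simp)
qed

subsection \<open>Square-integrable martingales with an absolutely continuous bracket\<close>

locale bracketed_martingale = stochastic_basis P F T
  for P :: "'a measure" and F :: "real \<Rightarrow> 'a measure" and T :: real +
  fixes L D :: "real \<Rightarrow> 'a \<Rightarrow> real"
  assumes L_martingale: "martingale_process P F T L"
    and L_continuous: "\<And>w. w \<in> space P \<Longrightarrow> continuous_on {0..<T} (\<lambda>t. L t w)"
    and L_square_integrable: "\<And>t. t \<in> {0..<T} \<Longrightarrow> integrable P (\<lambda>w. (L t w)\<^sup>2)"
    and L_zero: "\<And>w. w \<in> space P \<Longrightarrow> L 0 w = 0"
    and D_progressive: "progressively_measurable F T D"
    and D_nonneg: "\<And>u w. u \<in> {0..<T} \<Longrightarrow> w \<in> space P \<Longrightarrow> 0 \<le> D u w"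
    and D_integrable: "\<And>b w. b \<in> {0..<T} \<Longrightarrow> w \<in> space P \<Longrightarrow>
          set_integrable lborel {0..b} (\<lambda>u. D u w)"
    and L_bracket: "quadratic_variation P F T L (\<lambda>b w. LBINT u:{0..b}. D u w)"
begin

definition Q :: "real \<Rightarrow> 'a \<Rightarrow> real" where
  "Q b w = (LBINT u:{0..b}. D u w)"

lemma L_bracket': "quadratic_variation P F T L Q"
  using L_bracket by (simp add: Q_def[abs_def])

lemma Q_eq_integral:
  assumes "b \<in> {0..<T}" "w \<in> space P"
  shows "Q b w = integral {0..b} (\<lambda>u. D u w)" "(\<lambda>u. D u w) integrable_on {0..b}"
  using set_borel_integral_eq_integral[OF D_integrable[OF assms]] by (auto simp: Q_def)

lemma Q_diff:
  assumes "0 \<le> s" "s \<le> t" "t < T" "w \<in> space P"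
  shows "Q t w - Q s w = integral {s..t} (\<lambda>u. D u w)"
  using assms Henstock_Kurzweil_Integration.integral_combine[of 0 s t "\<lambda>u. D u w"]
  by (simp add: Q_eq_integral)

lemma Q_zero: "w \<in> space P \<Longrightarrow> Q 0 w = 0"
  using T_pos by (simp add: Q_eq_integral)

lemma Q_mono:
  assumes "0 \<le> s" "s \<le> t" "t < T" "w \<in> space P"
  shows "Q s w \<le> Q t w"
proof -
  have "(\<lambda>u. D u w) integrable_on {s..t}"
    using Q_eq_integral(2)[of t w] assms by (auto intro: integrable_subinterval_real)
  then have "0 \<le> integral {s..t} (\<lambda>u. D u w)"
    using assms by (intro Henstock_Kurzweil_Integration.integral_nonneg) (auto intro: D_nonneg)
  then show ?thesis using Q_diff[OF assms] by simp
qed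

lemma Q_nonneg: "0 \<le> t \<Longrightarrow> t < T \<Longrightarrow> w \<in> space P \<Longrightarrow> 0 \<le> Q t w"
  using Q_mono[of 0 t w] Q_zero[of w] by simp

lemma Q_continuous:
  assumes "t < T" "w \<in> space P"
  shows "continuous_on {0..t} (\<lambda>u. Q u w)"
proof (cases "0 \<le> t")
  case True
  have "continuous_on {0..t} (\<lambda>x. integral {0..x} (\<lambda>u. D u w))"
    using Q_eq_integral(2)[of t w] True assms by (intro indefinite_integral_continuous_1) auto
  then show ?thesis
    by (rule continuous_on_eq) (use assms in \<open>auto simp: Q_eq_integral\<close>)
qed auto

lemma subalgebra_filtration:
  assumes "0 \<le> s" "s \<le> t" "t \<le> T"
  shows "subalgebra (F t) (F s)"
  using subalg[of s] subalg[of t] increasing[OF assms] assms by (auto simp: subalgebra_def)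

lemma L_measurable_F:
  assumes "0 \<le> s" "s \<le> t" "t < T"
  shows "L s \<in> borel_measurable (F t)"
proof -
  have "L s \<in> borel_measurable (F s)"
    using L_martingale assms by (auto simp: martingale_process_def adapted_process_def)
  then show ?thesis using subalgebra_filtration[of s t] assms
    by (intro measurable_from_subalg[of "F t" "F s"]) auto
qed

lemma measurable_F_imp_P:
  "0 \<le> t \<Longrightarrow> t \<le> T \<Longrightarrow> f \<in> borel_measurable (F t) \<Longrightarrow> f \<in> borel_measurable P"
  using measurable_from_subalg[OF subalg] by auto

lemma L_measurable: "0 \<le> s \<Longrightarrow> s < T \<Longrightarrow> L s \<in> borel_measurable P"
  using L_measurable_F[of s s] measurable_F_imp_P[of s] by auto

lemma Q_measurable: "0 \<le> s \<Longrightarrow> s < T \<Longrightarrow> Q s \<in> borel_measurable P"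
  using L_bracket' measurable_F_imp_P[of s "Q s"]
  by (simp add: quadratic_variation_def adapted_process_def)

lemma L_diff_square_integrable:
  assumes "0 \<le> s" "s < T" "0 \<le> t" "t < T"
  shows "integrable P (\<lambda>w. (L t w - L s w)\<^sup>2)"
  using assms by (intro integrable_diff_square L_measurable L_square_integrable) auto

text \<open>Square integrability of \<open>Z\<close> is enough, without boundedness: the products
  with \<open>L t\<close> and \<open>L s\<close> are then integrable, and \<open>Z\<close> can be
  moved into the conditional expectation. It is needed for products of a martingale transform with a
  truncated value.\<close>

lemma martingale_orthogonal:
  assumes st: "0 \<le> s" "s \<le> t" "t < T"
    and Z: "Z \<in> borel_measurable (F s)" "integrable P (\<lambda>w. (Z w)\<^sup>2)"
  shows "integrable P (\<lambda>w. Z w * (L t w - L s w))" "(\<integral>w. Z w * (L t w - L s w) \<partial>P) = 0"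
proof -
  interpret fs: finite_measure_subalgebra P "F s"
    by unfold_locales (use subalg[of s] st in auto)
  have [measurable]: "Z \<in> borel_measurable P"
    using measurable_F_imp_P[of s Z] Z st by auto
  have [measurable]: "L t \<in> borel_measurable P" "L s \<in> borel_measurable P"
    using st L_measurable by auto
  have it: "integrable P (\<lambda>w. Z w * L t w)" and js: "integrable P (\<lambda>w. Z w * L s w)"
    using st Z by (auto intro!: integrable_mult_of_squares L_square_integrable)
  have ae: "AE w in P. real_cond_exp P (F s) (L t) w = L s w"
    using L_martingale st by (auto simp: martingale_process_def)
  have "(\<integral>w. Z w * L t w \<partial>P) = (\<integral>w. Z w * real_cond_exp P (F s) (L t) w \<partial>P)"
    using fs.real_cond_exp_intg(2)[OF it Z(1)] by simp
  also have "\<dots> = (\<integral>w. Z w * L s w \<partial>P)"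
    using ae by (intro integral_cong_AE) (auto simp: borel_measurable_cond_exp2)
  finally show "(\<integral>w. Z w * (L t w - L s w) \<partial>P) = 0"
    using it js by (simp add: algebra_simps)
  show "integrable P (\<lambda>w. Z w * (L t w - L s w))"
    using it js by (simp add: algebra_simps)
qed

lemma L_increment_square:
  assumes "0 \<le> s" "s \<le> t" "t < T"
  shows "(\<integral>w. (L t w - L s w)\<^sup>2 \<partial>P) = (\<integral>w. (L t w)\<^sup>2 \<partial>P) - (\<integral>w. (L s w)\<^sup>2 \<partial>P)"
proof -
  note o = martingale_orthogonal[OF assms L_measurable_F[of s s], simplified]
  have "(\<integral>w. (L t w)\<^sup>2 \<partial>P) =
      (\<integral>w. ((L t w - L s w)\<^sup>2 + 2 * (L s w * (L t w - L s w))) + (L s w)\<^sup>2 \<partial>P)"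
    by (intro Bochner_Integration.integral_cong) (auto simp: power2_eq_square algebra_simps)
  also have "\<dots> = (\<integral>w. (L t w - L s w)\<^sup>2 \<partial>P) + (\<integral>w. (L s w)\<^sup>2 \<partial>P)"
    using assms o L_square_integrable[of s] L_diff_square_integrable[of s t]
    by simp
  finally show ?thesis by simp
qed

lemma squared_increments_expectation:
  assumes p: "is_partition t n p" "t < T" and "k \<le> n"
  shows "(\<integral>w. (\<Sum>i<k. (L (p (Suc i)) w - L (p i) w)\<^sup>2) \<partial>P) = (\<integral>w. (L (p k) w)\<^sup>2 \<partial>P)"
proof -
  have b: "0 \<le> p i" "p i < T" if "i \<le> n" for i using partition_bounds[OF p(1) that] p(2) by auto
  have m: "p i \<le> p (Suc i)" if "i < n" for i using p(1) that by (auto simp: is_partition_def)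
  have "(\<integral>w. (\<Sum>i<k. (L (p (Suc i)) w - L (p i) w)\<^sup>2) \<partial>P)
      = (\<Sum>i<k. \<integral>w. (L (p (Suc i)) w - L (p i) w)\<^sup>2 \<partial>P)"
    using b \<open>k \<le> n\<close> by (intro Bochner_Integration.integral_sum L_diff_square_integrable) auto
  also have "\<dots> = (\<Sum>i<k. (\<integral>w. (L (p (Suc i)) w)\<^sup>2 \<partial>P) - (\<integral>w. (L (p i) w)\<^sup>2 \<partial>P))"
    using b m \<open>k \<le> n\<close> by (intro sum.cong refl L_increment_square) auto
  also have "\<dots> = (\<integral>w. (L (p k) w)\<^sup>2 \<partial>P) - (\<integral>w. (L (p 0) w)\<^sup>2 \<partial>P)"
    by (rule sum_lessThan_telescope)
  also have "(\<integral>w. (L (p 0) w)\<^sup>2 \<partial>P) = (\<integral>w. 0 \<partial>P)"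
    using p(1) L_zero by (intro Bochner_Integration.integral_cong) (auto simp: is_partition_def)
  finally show ?thesis by simp
qed

text \<open>A discrete stochastic integral of the truncated martingale against the martingale.
  Evaluating the integrand at left end points makes it a martingale in \<open>k\<close>.\<close>

definition transform :: "real \<Rightarrow> (nat \<Rightarrow> real) \<Rightarrow> nat \<Rightarrow> 'a \<Rightarrow> real" where
  "transform K p k w = (\<Sum>i<k. trunc K (L (p i) w) * (L (p (Suc i)) w - L (p i) w))"

text \<open>One induction carries all four claims, because orthogonality of the next increment
  requires measurability and square integrability of the transform so far. The cross term vanishes,
  the integrand is bounded by \<open>K\<close>, and the second moments of the increments of
  \<open>L\<close> telescope.\<close>

lemma transform_moments:
  assumes p: "is_partition t n p" "t < T" and K: "0 \<le> K" and "k \<le> n"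
  shows "transform K p k \<in> borel_measurable (F (p k)) \<and> integrable P (\<lambda>w. (transform K p k w)\<^sup>2)
    \<and> (\<integral>w. transform K p k w \<partial>P) = 0
    \<and> (\<integral>w. (transform K p k w)\<^sup>2 \<partial>P) \<le> K\<^sup>2 * (\<integral>w. (L (p k) w)\<^sup>2 \<partial>P)"
  using \<open>k \<le> n\<close>
proof (induction k)
  case 0
  then show ?case by (simp add: transform_def)
next
  case (Suc k)
  have b: "0 \<le> p i" "p i < T" if "i \<le> n" for i using partition_bounds[OF p(1) that] p(2) by auto
  have m: "p k \<le> p (Suc k)" using p(1) Suc by (auto simp: is_partition_def)
  define V where "V = transform K p k"
  define c where "c w = trunc K (L (p k) w)" for w
  define X where "X w = L (p (Suc k)) w - L (p k) w" for w
  have cX: "transform K p (Suc k) = (\<lambda>w. V w + c w * X w)"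
    by (auto simp: transform_def V_def c_def X_def)
  have bk: "0 \<le> p k" "p k < T" "0 \<le> p (Suc k)" "p (Suc k) < T" using b Suc by auto
  have V: "V \<in> borel_measurable (F (p k))" "integrable P (\<lambda>w. (V w)\<^sup>2)" "(\<integral>w. V w \<partial>P) = 0"
    "(\<integral>w. (V w)\<^sup>2 \<partial>P) \<le> K\<^sup>2 * (\<integral>w. (L (p k) w)\<^sup>2 \<partial>P)"
    using Suc by (auto simp: V_def)
  have cF: "c \<in> borel_measurable (F (p k))"
    unfolding c_def using L_measurable_F[of "p k" "p k"] bk by measurable
  have sub: "subalgebra (F (p (Suc k))) (F (p k))"
    using subalgebra_filtration bk m by auto
  have XF: "X \<in> borel_measurable (F (p (Suc k)))"
    unfolding X_def using L_measurable_F bk m by (intro borel_measurable_diff) auto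
  have meas: "(\<lambda>w. V w + c w * X w) \<in> borel_measurable (F (p (Suc k)))"
    using measurable_from_subalg[OF sub V(1)] measurable_from_subalg[OF sub cF] XF by measurable
  have P: "V \<in> borel_measurable P" "c \<in> borel_measurable P" "X \<in> borel_measurable P"
    by (auto intro: measurable_F_imp_P[OF _ _ V(1)] measurable_F_imp_P[OF _ _ cF]
        measurable_F_imp_P[OF _ _ XF] less_imp_le bk)
  have csq: "(c w)\<^sup>2 \<le> K\<^sup>2" for w using trunc_square[OF K] by (simp add: c_def)
  have X2: "integrable P (\<lambda>w. (X w)\<^sup>2)" unfolding X_def
    using L_diff_square_integrable bk by auto
  have c2: "integrable P (\<lambda>w. (c w)\<^sup>2 * (X w)\<^sup>2)"
    using csq P X2 by (intro integrable_bounded_mult[where B="K\<^sup>2"]) auto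
  have cbdd: "integrable P (\<lambda>w. (c w)\<^sup>2)"
    using P csq by (intro integrable_const_bound[where B="K\<^sup>2"]) auto
  have Vc2: "integrable P (\<lambda>w. (V w * c w)\<^sup>2)"
    unfolding power_mult_distrib mult.commute[of "(V _)\<^sup>2"]
    using csq P V by (intro integrable_bounded_mult[where B="K\<^sup>2"]) auto
  have VcX: "integrable P (\<lambda>w. V w * c w * X w)" "(\<integral>w. V w * c w * X w \<partial>P) = 0"
    using martingale_orthogonal[OF bk(1) m bk(4), of "\<lambda>w. V w * c w"] V cF Vc2 by (auto simp: X_def)
  have cXi: "integrable P (\<lambda>w. c w * X w)" "(\<integral>w. c w * X w \<partial>P) = 0"
    using martingale_orthogonal[OF bk(1) m bk(4) cF cbdd] by (auto simp: X_def)
  have Vi: "integrable P V" using square_integrable_imp_integrable[OF P(1) V(2)] .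
  have sq: "(\<lambda>w. (V w + c w * X w)\<^sup>2)
      = (\<lambda>w. (V w)\<^sup>2 + 2 * (V w * c w * X w) + (c w)\<^sup>2 * (X w)\<^sup>2)"
    by (auto simp: power2_eq_square algebra_simps)
  have "(\<integral>w. (V w + c w * X w)\<^sup>2 \<partial>P) = (\<integral>w. (V w)\<^sup>2 \<partial>P) + (\<integral>w. (c w)\<^sup>2 * (X w)\<^sup>2 \<partial>P)"
    unfolding sq using V VcX c2 by simp
  also have "(\<integral>w. (c w)\<^sup>2 * (X w)\<^sup>2 \<partial>P) \<le> (\<integral>w. K\<^sup>2 * (X w)\<^sup>2 \<partial>P)"
    using c2 X2 csq by (intro integral_mono mult_right_mono) auto
  also have "\<dots> = K\<^sup>2 * ((\<integral>w. (L (p (Suc k)) w)\<^sup>2 \<partial>P) - (\<integral>w. (L (p k) w)\<^sup>2 \<partial>P))"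
    using L_increment_square[OF bk(1) m bk(4)] by (simp add: X_def)
  finally have "(\<integral>w. (V w + c w * X w)\<^sup>2 \<partial>P) \<le> K\<^sup>2 * (\<integral>w. (L (p (Suc k)) w)\<^sup>2 \<partial>P)"
    using V(4) by (simp add: algebra_simps)
  moreover have "integrable P (\<lambda>w. (V w + c w * X w)\<^sup>2)" unfolding sq using V VcX c2 by simp
  moreover have "(\<integral>w. V w + c w * X w \<partial>P) = 0" using Vi cXi V by simp
  ultimately show ?case unfolding cX using meas by auto
qed

text \<open>The Ito formula for \<open>huber K\<close> as a pathwise inequality in discrete time:
  \<open>huber_taylor\<close> is summed over the intervals, and the initial term vanishes since
  \<open>L\<close> starts at 0.\<close>

lemma huber_transform_le:
  assumes p: "is_partition t n p" and "0 \<le> K" "w \<in> space P" "k \<le> n"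
  shows "huber K (L (p k) w) - 2 * transform K p k w \<le> (\<Sum>i<k. (L (p (Suc i)) w - L (p i) w)\<^sup>2)"
  using \<open>k \<le> n\<close>
proof (induction k)
  case 0
  then show ?case using assms L_zero[of w] by (simp add: transform_def is_partition_def)
next
  case (Suc k)
  then show ?case
    using huber_taylor[OF \<open>0 \<le> K\<close>, of "L (p (Suc k)) w" "L (p k) w"]
    by (simp add: transform_def algebra_simps)
qed

end

subsection \<open>Convergence of the sums of squares in \<open>L\<^sub>1\<close>\<close>

text \<open>The distance is capped at 1, so that convergence in probability becomes L_1 convergence
  without any moment condition on \<open>X\<close>; an L_1 convergent sequence has an almost surely
  convergent subsequence.\<close>

lemma (in prob_space) convergence_in_probability_AE_subseq:
  fixes X :: "nat \<Rightarrow> 'a \<Rightarrow> real"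
  assumes [measurable]: "\<And>n. X n \<in> borel_measurable M" "Y \<in> borel_measurable M"
    and conv: "\<And>\<epsilon>. 0 < \<epsilon> \<Longrightarrow> (\<lambda>n. prob {w \<in> space M. \<bar>X n w - Y w\<bar> > \<epsilon>}) \<longlonglongrightarrow> 0"
  shows "\<exists>r. strict_mono r \<and> (AE w in M. (\<lambda>n. X (r n) w) \<longlonglongrightarrow> Y w)"
proof -
  define u where "u n w = min 1 \<bar>X n w - Y w\<bar>" for n w
  have u0: "0 \<le> u n w" for n w by (simp add: u_def)
  have um [measurable]: "u n \<in> borel_measurable M" for n unfolding u_def by measurable
  have ui: "integrable M (u n)" for n
    by (rule integrable_const_bound[where B=1, OF _ um]) (simp add: u_def)
  have bound: "(\<integral>w. u n w \<partial>M) \<le> \<epsilon> + prob {w \<in> space M. \<bar>X n w - Y w\<bar> > \<epsilon>}" if "\<epsilon> > 0" for n \<epsilon>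
  proof -
    let ?A = "{w \<in> space M. \<bar>X n w - Y w\<bar> > \<epsilon>}"
    have "?A \<in> sets M" by measurable
    then have ii: "integrable M (indicat_real ?A)"
      by (rule integrable_real_indicator) (simp add: emeasure_eq_measure)
    have ind: "integrable M (\<lambda>w. \<epsilon> + indicator ?A w :: real)"
      by (rule Bochner_Integration.integrable_add[OF integrable_const ii])
    have "(\<integral>w. u n w \<partial>M) \<le> (\<integral>w. \<epsilon> + indicator ?A w \<partial>M)"
      by (rule integral_mono[OF ui ind]) (use that in \<open>auto simp: u_def split: split_indicator\<close>)
    also have "\<dots> = \<epsilon> + prob ?A"
      by (subst Bochner_Integration.integral_add[OF integrable_const ii]) (simp add: prob_space)
    finally show ?thesis .
  qed
  have lim: "(\<lambda>n. \<integral>w. u n w \<partial>M) \<longlonglongrightarrow> 0"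
  proof (rule order_tendstoI)
    fix e :: real assume e: "0 < e"
    then have "0 < e / 2" by simp
    from order_tendstoD(2)[OF conv[OF this] this]
    show "\<forall>\<^sub>F n in sequentially. (\<integral>w. u n w \<partial>M) < e"
    proof (rule eventually_mono)
      fix n assume "prob {w \<in> space M. \<bar>X n w - Y w\<bar> > e / 2} < e / 2"
      with bound[OF \<open>0 < e / 2\<close>, of n] show "(\<integral>w. u n w \<partial>M) < e" by linarith
    qed
  next
    fix e :: real assume "e < 0"
    moreover have "0 \<le> (\<integral>w. u n w \<partial>M)" for n by (intro integral_nonneg_AE AE_I2 u0)
    ultimately show "\<forall>\<^sub>F n in sequentially. e < (\<integral>w. u n w \<partial>M)"
      by (intro always_eventually allI) (rule less_le_trans)
  qed
  then have "(\<lambda>n. \<integral>w. norm (u n w) \<partial>M) \<longlonglongrightarrow> 0" by (simp only: real_norm_def abs_of_nonneg[OF u0])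
  from tendsto_L1_AE_subseq[OF ui this]
  obtain r where r: "strict_mono r" "AE w in M. (\<lambda>n. u (r n) w) \<longlonglongrightarrow> 0" by blast
  have "(\<lambda>n. X (r n) w) \<longlonglongrightarrow> Y w" if l: "(\<lambda>n. u (r n) w) \<longlonglongrightarrow> 0" for w
  proof -
    \<comment> \<open>Once the capped distance is below 1 the cap is inactive, so it equals the true
      distance.\<close>
    have "\<forall>\<^sub>F n in sequentially. u (r n) w < 1" by (rule order_tendstoD(2)[OF l zero_less_one])
    then have ev: "\<forall>\<^sub>F n in sequentially. u (r n) w = \<bar>X (r n) w - Y w\<bar>"
      by (rule eventually_mono) (unfold u_def, linarith)
    have "(\<lambda>n. \<bar>X (r n) w - Y w\<bar>) \<longlonglongrightarrow> 0" by (rule Lim_transform_eventually[OF l ev])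
    then show ?thesis by (rule LIM_zero_cancel[OF tendsto_rabs_zero_cancel])
  qed
  with r(2) have "AE w in M. (\<lambda>n. X (r n) w) \<longlonglongrightarrow> Y w" by (rule eventually_mono)
  with r(1) show ?thesis by blast
qed

lemma integrable_tail_small:
  fixes Y :: "'a \<Rightarrow> real"
  assumes Y: "integrable M Y" and "0 < e"
  shows "\<exists>R>0. (\<integral>w. max 0 (Y w - R) \<partial>M) < e"
proof -
  have [measurable]: "Y \<in> borel_measurable M" using Y by auto
  have "(\<lambda>n. \<integral>w. max 0 (Y w - real n) \<partial>M) \<longlonglongrightarrow> (\<integral>w. 0 \<partial>M)"
  proof (rule integral_dominated_convergence[where w="\<lambda>w. \<bar>Y w\<bar>"])
    show "AE w in M. (\<lambda>n. max 0 (Y w - real n)) \<longlonglongrightarrow> 0"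
    proof (rule AE_I2)
      fix w
      obtain N where "Y w \<le> real N" using real_arch_simple by blast
      then show "(\<lambda>n. max 0 (Y w - real n)) \<longlonglongrightarrow> 0"
        by (intro tendsto_eventually eventually_sequentiallyI[of N]) auto
    qed
    show "integrable M (\<lambda>w. \<bar>Y w\<bar>)" using Y by simp
    show "AE w in M. norm (max 0 (Y w - real n)) \<le> \<bar>Y w\<bar>" for n by (rule AE_I2) simp
  qed measurable
  then have l: "(\<lambda>n. \<integral>w. max 0 (Y w - real n) \<partial>M) \<longlonglongrightarrow> 0" by simp
  have "\<forall>\<^sub>F n in sequentially. (\<integral>w. max 0 (Y w - real n) \<partial>M) < e"
    by (rule order_tendstoD(2)[OF l \<open>0 < e\<close>])
  then obtain N where N: "\<And>n. n \<ge> N \<Longrightarrow> (\<integral>w. max 0 (Y w - real n) \<partial>M) < e"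
    by (auto simp: eventually_sequentially)
  show ?thesis using N[of "Suc N"] by (intro exI[of _ "real (Suc N)"]) auto
qed

lemma exists_fine_partition:
  assumes "0 \<le> t" "0 < \<delta>"
  shows "\<exists>N. \<forall>n\<ge>N. is_partition t (Suc n) (\<lambda>i. t * real i / real (Suc n)) \<and>
    (\<forall>i<Suc n. t * real (Suc i) / real (Suc n) - t * real i / real (Suc n) < \<delta>)"
proof -
  obtain N where N: "t / \<delta> < real N" using reals_Archimedean2 by blast
  have p: "is_partition t (Suc n) (\<lambda>i. t * real i / real (Suc n))" for n
    unfolding is_partition_def using assms(1)
    by (intro conjI allI impI divide_right_mono mult_left_mono) simp_all
  have q: "t * real (Suc i) / real (Suc n) - t * real i / real (Suc n) < \<delta>" if "n \<ge> N" for n i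
  proof -
    have "t * real (Suc i) / real (Suc n) - t * real i / real (Suc n) = t / real (Suc n)"
    proof -
      have "t * real (Suc i) - t * real i = t" by (simp add: distrib_left)
      then show ?thesis by (simp only: diff_divide_distrib[symmetric])
    qed
    moreover have "t < real N * \<delta>" using N assms(2) by (subst (asm) pos_divide_less_eq)
    moreover have "real N * \<delta> \<le> real (Suc n) * \<delta>" using that assms(2) by (intro mult_right_mono) simp_all
    ultimately show ?thesis by (simp only: pos_divide_less_eq of_nat_0_less_iff) (simp add: pos_divide_less_eq mult.commute)
  qed
  show ?thesis using p q by blast
qed

context bracketed_martingale
begin

definition squares :: "(nat \<Rightarrow> real) \<Rightarrow> nat \<Rightarrow> 'a \<Rightarrow> real" where
  "squares p n w = (\<Sum>i<n. (L (p (Suc i)) w - L (p i) w)\<^sup>2)"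

lemma squares_integrable:
  assumes "is_partition t n p" "t < T"
  shows "integrable P (squares p n)"
proof -
  have b: "0 \<le> p i" "p i < T" if "i \<le> n" for i using partition_bounds[OF assms(1) that] assms(2) by auto
  show ?thesis unfolding squares_def[abs_def]
    using b by (intro Bochner_Integration.integrable_sum L_diff_square_integrable) auto
qed

lemma squares_expectation:
  assumes "is_partition t n p" "t < T"
  shows "(\<integral>w. squares p n w \<partial>P) = (\<integral>w. (L t w)\<^sup>2 \<partial>P)"
  unfolding squares_def using squared_increments_expectation[OF assms order_refl] assms
  by (simp add: is_partition_def)

lemma squares_converge:
  assumes "t \<in> {0..<T}" "0 < \<epsilon>" "0 < \<eta>"
  shows "\<exists>\<delta>>0. \<forall>n p. is_partition t n p \<and> mesh_below \<delta> n p \<longrightarrow>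
    prob {w \<in> space P. \<bar>squares p n w - Q t w\<bar> > \<epsilon>} < \<eta>"
  using L_bracket' assms unfolding quadratic_variation_def squares_def by blast

text \<open>The bound does not depend on the partition. Its constant 16 is 8 + 8:
  \<open>(a - 2 * v)\<^sup>2\<close> is at most \<open>2 * a\<^sup>2 + 8 * v\<^sup>2\<close>, the
  linear bound on \<open>huber\<close> turns the first summand into
  \<open>8 * K\<^sup>2 * (L t w)\<^sup>2\<close>, and the second moment of the transform is at most
  \<open>K\<^sup>2\<close> times that of \<open>L t\<close>.\<close>

lemma transform_huber_second_moment:
  assumes p: "is_partition t n p" "t < T" and K: "0 \<le> K"
  defines "Y \<equiv> \<lambda>w. huber K (L t w) - 2 * transform K p n w"
  shows "integrable P Y" "integrable P (\<lambda>w. (Y w)\<^sup>2)"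
    "(\<integral>w. Y w \<partial>P) = (\<integral>w. huber K (L t w) \<partial>P)"
    "(\<integral>w. (Y w)\<^sup>2 \<partial>P) \<le> 16 * K\<^sup>2 * (\<integral>w. (L t w)\<^sup>2 \<partial>P)"
proof -
  have t: "0 \<le> t" using partition_bounds[OF p(1), of n] by simp
  have pn: "p n = t" using p by (simp add: is_partition_def)
  note tm = transform_moments[OF p K order_refl, unfolded pn]
  have [measurable]: "L t \<in> borel_measurable P" using L_measurable t p by auto
  have Vm [measurable]: "transform K p n \<in> borel_measurable P"
    using tm measurable_F_imp_P[of t] t p by auto
  have L2: "integrable P (\<lambda>w. (L t w)\<^sup>2)" using L_square_integrable t p by auto
  have h: "integrable P (\<lambda>w. huber K (L t w))"
    by (rule Bochner_Integration.integrable_bound[OF L2])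
      (use huber_nonneg[OF K] huber_le in auto)
  have V: "integrable P (transform K p n)" using square_integrable_imp_integrable[OF Vm] tm by auto
  show "integrable P Y" unfolding Y_def using h V by auto
  show "(\<integral>w. Y w \<partial>P) = (\<integral>w. huber K (L t w) \<partial>P)"
    unfolding Y_def using h V tm by simp
  have b: "(Y w)\<^sup>2 \<le> 8 * K\<^sup>2 * (L t w)\<^sup>2 + 8 * (transform K p n w)\<^sup>2" for w
  proof -
    have "(huber K (L t w))\<^sup>2 \<le> (2 * K * \<bar>L t w\<bar>)\<^sup>2"
      using huber_nonneg[OF K] huber_linear_bound[OF K] by (intro power_mono) auto
    then have h2: "(huber K (L t w))\<^sup>2 \<le> 4 * K\<^sup>2 * (L t w)\<^sup>2" by (simp add: power_mult_distrib)
    have "(a - 2 * v)\<^sup>2 \<le> 2 * a\<^sup>2 + 8 * v\<^sup>2" for a v :: real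
    proof -
      have "0 \<le> (a + 2 * v)\<^sup>2" by simp
      then show ?thesis by (simp add: power2_eq_square algebra_simps)
    qed
    from this[of "huber K (L t w)" "transform K p n w"] and h2
    show ?thesis unfolding Y_def by linarith
  qed
  have I: "integrable P (\<lambda>w. 8 * K\<^sup>2 * (L t w)\<^sup>2 + 8 * (transform K p n w)\<^sup>2)"
    using L2 tm by auto
  have Ym: "Y \<in> borel_measurable P" unfolding Y_def by measurable
  show Y2: "integrable P (\<lambda>w. (Y w)\<^sup>2)"
  proof (rule Bochner_Integration.integrable_bound[OF I])
    show "AE w in P. norm ((Y w)\<^sup>2) \<le> norm (8 * K\<^sup>2 * (L t w)\<^sup>2 + 8 * (transform K p n w)\<^sup>2)"
      unfolding real_norm_def by (rule AE_I2, rule order_trans[OF _ abs_ge_self]) (use b in simp)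
  qed (use Ym in measurable)
  have "(\<integral>w. (Y w)\<^sup>2 \<partial>P) \<le> (\<integral>w. 8 * K\<^sup>2 * (L t w)\<^sup>2 + 8 * (transform K p n w)\<^sup>2 \<partial>P)"
    using Y2 I b by (intro integral_mono) auto
  also have "\<dots> = 8 * K\<^sup>2 * (\<integral>w. (L t w)\<^sup>2 \<partial>P) + 8 * (\<integral>w. (transform K p n w)\<^sup>2 \<partial>P)"
    using L2 tm by simp
  finally show "(\<integral>w. (Y w)\<^sup>2 \<partial>P) \<le> 16 * K\<^sup>2 * (\<integral>w. (L t w)\<^sup>2 \<partial>P)" using tm by simp
qed

text \<open>
  The upper bound is Fatou's lemma. For the lower bound, \<open>huber K (L t)\<close> minus twice a martingale
  transform is dominated by the sum of squares and bounded in \<open>L\<^sub>2\<close>, hence uniformly integrable.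
\<close>

lemma Q_integrable_expectation:
  assumes t: "0 \<le> t" "t < T"
  shows "integrable P (Q t)" "(\<integral>w. Q t w \<partial>P) = (\<integral>w. (L t w)\<^sup>2 \<partial>P)"
proof -
  let ?h = "\<lambda>K. \<integral>w. huber K (L t w) \<partial>P"
  define c where "c = (\<integral>w. (L t w)\<^sup>2 \<partial>P)"
  define p where "p n i = t * real i / real (Suc n)" for n i
  have part: "is_partition t (Suc n) (p n)" for n
    unfolding p_def using t by (auto simp: is_partition_def intro!: divide_right_mono mult_left_mono)
  have Sm [measurable]: "squares (p n) (Suc n) \<in> borel_measurable P" for n
    using squares_integrable[OF part t(2)] by auto
  have Qm [measurable]: "Q t \<in> borel_measurable P" using Q_measurable t by auto
  have "(\<lambda>n. prob {w \<in> space P. \<bar>squares (p n) (Suc n) w - Q t w\<bar> > \<epsilon>}) \<longlonglongrightarrow> 0" if "\<epsilon> > 0" for \<epsilon>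
  proof (rule LIMSEQ_I)
    fix \<eta> :: real assume "0 < \<eta>"
    with squares_converge[of t \<epsilon> \<eta>] that t obtain \<delta> where \<delta>: "\<delta> > 0"
      "\<And>n p. is_partition t n p \<Longrightarrow> mesh_below \<delta> n p \<Longrightarrow>
        prob {w \<in> space P. \<bar>squares p n w - Q t w\<bar> > \<epsilon>} < \<eta>" by auto
    obtain N where "\<And>n. n \<ge> N \<Longrightarrow> \<forall>i<Suc n. p n (Suc i) - p n i < \<delta>"
      using exists_fine_partition[OF t(1) \<delta>(1)] unfolding p_def by blast
    then show "\<exists>N. \<forall>n\<ge>N. norm (prob {w \<in> space P. \<bar>squares (p n) (Suc n) w - Q t w\<bar> > \<epsilon>} - 0) < \<eta>"
      using \<delta>(2)[OF part] by (intro exI[of _ N]) auto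
  qed
  from convergence_in_probability_AE_subseq[OF Sm Qm this]
  obtain r where r: "strict_mono r" "AE w in P. (\<lambda>n. squares (p (r n)) (Suc (r n)) w) \<longlonglongrightarrow> Q t w"
    by blast
  define S where "S n = squares (p (r n)) (Suc (r n))" for n
  have S [measurable]: "S n \<in> borel_measurable P" and Si: "integrable P (S n)"
    and ES: "(\<integral>w. S n w \<partial>P) = c" and S0: "0 \<le> S n w" for n w
    using squares_integrable[OF part t(2)] squares_expectation[OF part t(2)]
    by (auto simp: S_def c_def squares_def sum_nonneg)
  have lim: "AE w in P. (\<lambda>n. S n w) \<longlonglongrightarrow> Q t w" using r by (simp add: S_def)
  have Q0: "AE w in P. 0 \<le> Q t w" using Q_nonneg t by auto
  have "(\<integral>\<^sup>+w. ennreal (Q t w) \<partial>P) = (\<integral>\<^sup>+w. liminf (\<lambda>n. ennreal (S n w)) \<partial>P)"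
  proof (rule nn_integral_cong_AE, rule AE_mp[OF lim], rule AE_I2, rule impI)
    fix w assume "(\<lambda>n. S n w) \<longlonglongrightarrow> Q t w"
    then show "ennreal (Q t w) = liminf (\<lambda>n. ennreal (S n w))"
      by (intro lim_imp_Liminf[symmetric] tendsto_ennrealI) auto
  qed
  also have "\<dots> \<le> liminf (\<lambda>n. \<integral>\<^sup>+w. ennreal (S n w) \<partial>P)"
    by (rule nn_integral_liminf) measurable
  also have "\<dots> = ennreal c"
    using nn_integral_eq_integral[OF Si] S0 ES by (simp add: Liminf_const)
  finally have le: "(\<integral>\<^sup>+w. ennreal (Q t w) \<partial>P) \<le> ennreal c" .
  show Qi: "integrable P (Q t)"
    by (rule integrableI_nonneg[OF Qm Q0]) (rule le_less_trans[OF le], simp)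
  have "ennreal (\<integral>w. Q t w \<partial>P) \<le> ennreal c"
    using le nn_integral_eq_integral[OF Qi Q0] by simp
  then have upper: "(\<integral>w. Q t w \<partial>P) \<le> c" by (simp add: c_def)
  \<comment> \<open>Order of limits: with \<open>K\<close> and \<open>R\<close> fixed,
    \<open>n\<close> tends to infinity, where the cut-off sums are bounded by \<open>R\<close>; next
    \<open>R\<close> tends to infinity and removes the loss from the second moment. The limit in
    \<open>K\<close> is taken only at the end of the proof.\<close>
  have hub: "?h K \<le> (\<integral>w. Q t w \<partial>P)" if K: "0 \<le> K" for K
  proof -
    have R: "?h K \<le> (\<integral>w. Q t w \<partial>P) + 16 * K\<^sup>2 * c / R" if "R > 0" for R
    proof -
      have "?h K \<le> (\<integral>w. min (S n w) R \<partial>P) + 16 * K\<^sup>2 * c / R" for n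
      proof -
        let ?Y = "\<lambda>w. huber K (L t w) - 2 * transform K (p (r n)) (Suc (r n)) w"
        note y = transform_huber_second_moment[OF part t(2) K, of "r n"]
        have mi: "integrable P (\<lambda>w. min (S n w) R)"
          using \<open>R > 0\<close> S0 by (intro integrable_const_bound[where B=R]) auto
        have "?h K = (\<integral>w. ?Y w \<partial>P)" using y by simp
        also have "\<dots> \<le> (\<integral>w. min (S n w) R + (?Y w)\<^sup>2 / R \<partial>P)"
        proof (intro integral_mono)
          fix w assume "w \<in> space P"
          then have "?Y w \<le> S n w"
            using huber_transform_le[OF part K, of w "Suc (r n)" "r n"] part[of "r n"]
            by (simp add: S_def squares_def is_partition_def)
          then show "?Y w \<le> min (S n w) R + (?Y w)\<^sup>2 / R" using \<open>R > 0\<close> by (rule le_min_add_square)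
        qed (use y mi in auto)
        also have "\<dots> = (\<integral>w. min (S n w) R \<partial>P) + (\<integral>w. (?Y w)\<^sup>2 \<partial>P) / R" using mi y by simp
        also have "(\<integral>w. (?Y w)\<^sup>2 \<partial>P) / R \<le> 16 * K\<^sup>2 * c / R"
          using y \<open>R > 0\<close> by (intro divide_right_mono) (auto simp: c_def)
        finally show ?thesis by simp
      qed
      moreover have "(\<lambda>n. \<integral>w. min (S n w) R \<partial>P) \<longlonglongrightarrow> (\<integral>w. min (Q t w) R \<partial>P)"
      proof (rule integral_dominated_convergence[where w="\<lambda>_. R"])
        show "AE w in P. (\<lambda>n. min (S n w) R) \<longlonglongrightarrow> min (Q t w) R"
          using lim by eventually_elim (intro tendsto_intros)
      qed (use S0 \<open>R > 0\<close> in auto)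
      ultimately have "?h K \<le> (\<integral>w. min (Q t w) R \<partial>P) + 16 * K\<^sup>2 * c / R"
        by (intro LIMSEQ_le_const[of "\<lambda>n. (\<integral>w. min (S n w) R \<partial>P) + 16 * K\<^sup>2 * c / R"] tendsto_intros) auto
      also have "(\<integral>w. min (Q t w) R \<partial>P) \<le> (\<integral>w. Q t w \<partial>P)"
        using Qi by (intro integral_mono) auto
      finally show ?thesis by simp
    qed
    have "(\<lambda>n. (\<integral>w. Q t w \<partial>P) + 16 * K\<^sup>2 * c / real (Suc n)) \<longlonglongrightarrow> (\<integral>w. Q t w \<partial>P) + 0"
      by (intro tendsto_intros LIMSEQ_Suc lim_const_over_n)
    then show ?thesis using R by (intro LIMSEQ_le_const[of _ _ "?h K"]) auto
  qed
  have [measurable]: "L t \<in> borel_measurable P" using L_measurable t by auto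
  have "(\<lambda>n. \<integral>w. huber (real n) (L t w) \<partial>P) \<longlonglongrightarrow> (\<integral>w. (L t w)\<^sup>2 \<partial>P)"
  proof (rule integral_dominated_convergence[where w="\<lambda>w. (L t w)\<^sup>2"])
    show "AE w in P. (\<lambda>n. huber (real n) (L t w)) \<longlonglongrightarrow> (L t w)\<^sup>2"
    proof (rule AE_I2)
      fix w
      obtain N where "\<bar>L t w\<bar> \<le> real N" using real_arch_simple by blast
      then show "(\<lambda>n. huber (real n) (L t w)) \<longlonglongrightarrow> (L t w)\<^sup>2"
        by (intro tendsto_eventually eventually_sequentiallyI[of N] huber_eq) auto
    qed
  qed (use L_square_integrable t huber_nonneg huber_le in auto)
  then have "c \<le> (\<integral>w. Q t w \<partial>P)"
    unfolding c_def using hub by (intro LIMSEQ_le_const2[of _ "(\<integral>w. (L t w)\<^sup>2 \<partial>P)"]) auto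
  with upper show "(\<integral>w. Q t w \<partial>P) = (\<integral>w. (L t w)\<^sup>2 \<partial>P)" by (simp add: c_def)
qed

lemma L_increment_bracket:
  assumes "0 \<le> s" "s \<le> t" "t < T"
  shows "(\<integral>w. (L t w - L s w)\<^sup>2 \<partial>P) = (\<integral>w. Q t w - Q s w \<partial>P)"
  using L_increment_square[OF assms] Q_integrable_expectation[of s] Q_integrable_expectation[of t] assms
  by simp

text \<open>Scheffe's argument: equal expectations reduce the \<open>L\<^sub>1\<close> distance to the dominated part \<open>(Q t - squares)\<^sup>+\<close>.\<close>

lemma squares_converge_L1:
  assumes t: "0 \<le> t" "t < T" and "0 < \<epsilon>"
  shows "\<exists>\<delta>>0. \<forall>n p. is_partition t n p \<and> mesh_below \<delta> n p \<longrightarrow>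
    (\<integral>w. \<bar>squares p n w - Q t w\<bar> \<partial>P) \<le> \<epsilon>"
proof -
  \<comment> \<open>Three contributions of at most \<open>e\<close> each, doubled by passing from
    the positive part to the absolute value.\<close>
  define e where "e = \<epsilon> / 6"
  have e: "0 < e" using assms by (simp add: e_def)
  note Qi = Q_integrable_expectation[OF t]
  have [measurable]: "Q t \<in> borel_measurable P" using Q_measurable t by auto
  obtain R where R: "R > 0" "(\<integral>w. max 0 (Q t w - R) \<partial>P) < e"
    using integrable_tail_small[OF Qi(1) e] by auto
  obtain \<delta> where \<delta>: "\<delta> > 0"
    "\<And>n p. is_partition t n p \<Longrightarrow> mesh_below \<delta> n p \<Longrightarrow>
        prob {w \<in> space P. \<bar>squares p n w - Q t w\<bar> > e} < e / R"
    using squares_converge[of t e "e / R"] t e R by auto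
  have "(\<integral>w. \<bar>squares p n w - Q t w\<bar> \<partial>P) \<le> \<epsilon>"
    if p: "is_partition t n p" "mesh_below \<delta> n p" for n p
  proof -
    let ?S = "squares p n"
    let ?A = "{w \<in> space P. \<bar>?S w - Q t w\<bar> > e}"
    have Si: "integrable P ?S" using squares_integrable[OF p(1) t(2)] .
    have [measurable]: "?S \<in> borel_measurable P" using Si by auto
    have ES: "(\<integral>w. ?S w \<partial>P) = (\<integral>w. Q t w \<partial>P)" using squares_expectation[OF p(1) t(2)] Qi by simp
    have m: "integrable P (\<lambda>w. max 0 (Q t w - ?S w))" "integrable P (\<lambda>w. max 0 (Q t w - R))"
      using Si Qi by auto
    have ind: "integrable P (\<lambda>w. R * indicator ?A w)"
      by (intro integrable_mult_right integrable_real_indicator) (auto simp: emeasure_eq_measure)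
    \<comment> \<open>An absolute value is the number itself plus twice its negative part; the
      number has mean zero here.\<close>
    have "(\<integral>w. \<bar>?S w - Q t w\<bar> \<partial>P) = (\<integral>w. (?S w - Q t w) + 2 * max 0 (Q t w - ?S w) \<partial>P)"
      by (intro Bochner_Integration.integral_cong) (simp_all add: max_def)
    also have "\<dots> = 2 * (\<integral>w. max 0 (Q t w - ?S w) \<partial>P)" using Si Qi m ES by simp
    \<comment> \<open>Off \<open>?A\<close> the positive part is at most \<open>e\<close>. On
      \<open>?A\<close> the nonnegative sum of squares is dropped and \<open>Q t\<close> is split at
      the level \<open>R\<close>.\<close>
    also have "(\<integral>w. max 0 (Q t w - ?S w) \<partial>P) \<le> (\<integral>w. (e + R * indicator ?A w) + max 0 (Q t w - R) \<partial>P)"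
    proof (intro integral_mono)
      fix w assume "w \<in> space P"
      moreover have "0 \<le> ?S w" by (simp add: squares_def sum_nonneg)
      ultimately show "max 0 (Q t w - ?S w) \<le> e + R * indicator ?A w + max 0 (Q t w - R)"
        using e R(1) by (auto simp: indicator_def)
    qed (use m ind in auto)
    also have "\<dots> = e + R * prob ?A + (\<integral>w. max 0 (Q t w - R) \<partial>P)"
      using m ind by (simp add: prob_space)
    also have "R * prob ?A \<le> e" using \<delta>(2)[OF p] R by (simp add: pos_less_divide_eq mult.commute less_imp_le)
    finally show ?thesis using R by (simp add: e_def)
  qed
  then show ?thesis using \<delta>(1) by blast
qed

end

subsection \<open>The Saks--Henstock lemma\<close>

lemma jointly_measurable_of_continuous:
  fixes X :: "real \<Rightarrow> 'a \<Rightarrow> real"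
  assumes [measurable]: "\<And>u. X u \<in> borel_measurable M"
    and cont: "\<And>w. w \<in> space M \<Longrightarrow> continuous_on UNIV (\<lambda>u. X u w)"
  shows "(\<lambda>z. X (fst z) (snd z)) \<in> borel_measurable (borel \<Otimes>\<^sub>M M)"
proof (rule borel_measurable_LIMSEQ_real)
  let ?g = "\<lambda>n z. real_of_int \<lfloor>real (Suc n) * fst z\<rfloor> / real (Suc n)"
  let ?f = "\<lambda>n z. X (?g n z) (snd z)"
  show "?f n \<in> borel_measurable (borel \<Otimes>\<^sub>M M)" for n
  proof (rule measurable_compose_countable[where f="\<lambda>i z. X (real_of_int i / real (Suc n)) (snd z)"])
    show "(\<lambda>z. \<lfloor>real (Suc n) * fst z\<rfloor>) \<in> borel \<Otimes>\<^sub>M M \<rightarrow>\<^sub>M count_space UNIV" by measurable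
  qed measurable
  fix z :: "real \<times> 'a" assume "z \<in> space (borel \<Otimes>\<^sub>M M)"
  then have z: "snd z \<in> space M" by (auto simp: space_pair_measure)
  have "(\<lambda>n. ?g n z) \<longlonglongrightarrow> fst z"
  proof (rule tendsto_sandwich)
    have eq: "fst z - 1 / real (Suc n) = (real (Suc n) * fst z - 1) / real (Suc n)" for n
      by (simp add: field_simps)
    have "(\<lambda>n. fst z - 1 / real (Suc n)) \<longlonglongrightarrow> fst z - 0"
      by (intro tendsto_diff tendsto_const LIMSEQ_Suc[OF lim_1_over_n])
    then show "(\<lambda>n. fst z - 1 / real (Suc n)) \<longlonglongrightarrow> fst z" by simp
    show "\<forall>\<^sub>F n in sequentially. fst z - 1 / real (Suc n) \<le> ?g n z"
      unfolding eq by (intro always_eventually allI divide_right_mono) linarith+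
    show "\<forall>\<^sub>F n in sequentially. ?g n z \<le> fst z"
    proof (intro always_eventually allI)
      fix n
      show "?g n z \<le> fst z"
        by (subst pos_divide_le_eq) (simp_all add: mult.commute)
    qed
  qed simp
  moreover have "isCont (\<lambda>u. X u (snd z)) (fst z)"
    using cont[OF z] by (simp add: continuous_on_eq_continuous_at)
  ultimately show "(\<lambda>n. ?f n z) \<longlonglongrightarrow> X (fst z) (snd z)"
    by (rule isCont_tendsto_compose[rotated])
qed

text \<open>Tonelli's theorem for the absolute value of \<open>H\<close>: the L_1 norm of an
  integral over a parameter is at most the integral of the L_1 norms.\<close>

lemma (in prob_space) integral_over_interval_L1_bound:
  fixes H :: "real \<Rightarrow> 'a \<Rightarrow> real"
  assumes H [measurable]: "(\<lambda>z. H (fst z) (snd z)) \<in> borel_measurable (borel \<Otimes>\<^sub>M M)"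
    and ab: "a \<le> b" and "0 \<le> \<epsilon>"
    and bound: "\<And>x. x \<in> {a..b} \<Longrightarrow> integrable M (H x)"
      "\<And>x. x \<in> {a..b} \<Longrightarrow> (\<integral>w. \<bar>H x w\<bar> \<partial>M) \<le> \<epsilon>"
  shows "integrable M (\<lambda>w. LBINT x:{a..b}. H x w)"
    and "(\<integral>w. \<bar>LBINT x:{a..b}. H x w\<bar> \<partial>M) \<le> \<epsilon> * (b - a)"
proof -
  interpret lp: pair_sigma_finite lborel M ..
  let ?G = "\<lambda>w. LBINT x:{a..b}. H x w"
  have H1 [measurable]: "(\<lambda>z. H (fst z) (snd z)) \<in> borel_measurable (lborel \<Otimes>\<^sub>M M)"
    using H by (simp cong: measurable_cong_sets)
  have H2: "(\<lambda>z. indicator {a..b} (fst z) * ennreal \<bar>H (fst z) (snd z)\<bar>) \<in> borel_measurable (lborel \<Otimes>\<^sub>M M)"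
    by measurable
  have sw: "(\<lambda>z. (indicator {a..b} (snd z) * H (snd z) (fst z)) :: real) \<in> borel_measurable (M \<Otimes>\<^sub>M lborel)"
  proof -
    have "(\<lambda>z. H (snd z) (fst z)) \<in> borel_measurable (M \<Otimes>\<^sub>M lborel)"
      using measurable_compose[OF measurable_pair_swap' H1] by (simp add: case_prod_beta comp_def)
    then show ?thesis by measurable
  qed
  have G [measurable]: "?G \<in> borel_measurable M"
    unfolding set_lebesgue_integral_def real_scaleR_def
    by (rule sigma_finite_measure.borel_measurable_lebesgue_integral[OF sigma_finite_lborel])
      (use sw in \<open>simp add: case_prod_beta\<close>)
  have "(\<integral>\<^sup>+w. ennreal \<bar>?G w\<bar> \<partial>M) \<le> (\<integral>\<^sup>+w. (\<integral>\<^sup>+x. indicator {a..b} x * ennreal \<bar>H x w\<bar> \<partial>lborel) \<partial>M)"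
  proof (rule nn_integral_mono)
    fix w
    \<comment> \<open>If the path is not integrable, the Bochner integral is 0 by convention and the
      bound is trivial, so no exceptional set of paths has to be removed.\<close>
    have "ennreal (norm (?G w)) \<le> (\<integral>\<^sup>+x. norm (indicator {a..b} x *\<^sub>R H x w) \<partial>lborel)"
      unfolding set_lebesgue_integral_def
      by (cases "integrable lborel (\<lambda>x. indicator {a..b} x *\<^sub>R H x w)")
        (rule integral_norm_bound_ennreal, auto simp: not_integrable_integral_eq)
    also have "\<dots> = (\<integral>\<^sup>+x. indicator {a..b} x * ennreal \<bar>H x w\<bar> \<partial>lborel)"
      by (intro nn_integral_cong) (simp split: split_indicator)
    finally show "ennreal \<bar>?G w\<bar> \<le> (\<integral>\<^sup>+x. indicator {a..b} x * ennreal \<bar>H x w\<bar> \<partial>lborel)" by simp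
  qed
  also have "\<dots> = (\<integral>\<^sup>+x. (\<integral>\<^sup>+w. indicator {a..b} x * ennreal \<bar>H x w\<bar> \<partial>M) \<partial>lborel)"
    using lp.Fubini[OF H2] by simp
  also have "\<dots> \<le> (\<integral>\<^sup>+x. ennreal \<epsilon> * indicator {a..b} x \<partial>lborel)"
  proof (rule nn_integral_mono)
    fix x :: real
    show "(\<integral>\<^sup>+w. indicator {a..b} x * ennreal \<bar>H x w\<bar> \<partial>M) \<le> ennreal \<epsilon> * indicator {a..b} x"
    proof (cases "x \<in> {a..b}")
      case True
      have "(\<integral>\<^sup>+w. ennreal \<bar>H x w\<bar> \<partial>M) = ennreal (\<integral>w. \<bar>H x w\<bar> \<partial>M)"
        by (rule nn_integral_eq_integral) (use bound(1)[OF True] in simp_all)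
      then show ?thesis using True bound(2)[OF True] \<open>0 \<le> \<epsilon>\<close> by (simp add: ennreal_leI)
    qed simp
  qed
  also have "\<dots> = ennreal (\<epsilon> * (b - a))"
    using ab \<open>0 \<le> \<epsilon>\<close> by (simp add: nn_integral_cmult_indicator ennreal_mult)
  finally have le: "(\<integral>\<^sup>+w. ennreal \<bar>?G w\<bar> \<partial>M) \<le> ennreal (\<epsilon> * (b - a))" .
  show Gi: "integrable M ?G"
    by (rule integrableI_bounded[OF G]) (use le_less_trans[OF le] in simp)
  have "ennreal (\<integral>w. \<bar>?G w\<bar> \<partial>M) = (\<integral>\<^sup>+w. ennreal \<bar>?G w\<bar> \<partial>M)"
    by (rule nn_integral_eq_integral[symmetric]) (use Gi in simp_all)
  with le have "ennreal (\<integral>w. \<bar>?G w\<bar> \<partial>M) \<le> ennreal (\<epsilon> * (b - a))" by simp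
  then show "(\<integral>w. \<bar>?G w\<bar> \<partial>M) \<le> \<epsilon> * (b - a)"
    by (rule iffD1[OF ennreal_le_iff, rotated]) (use ab \<open>0 \<le> \<epsilon>\<close> in simp)
qed

text \<open>The \<open>L\<^sub>1\<close> norm is convex in each coefficient, so it is maximal at a vertex of the cube.\<close>

lemma L1_norm_convex_combination:
  fixes X :: "'i \<Rightarrow> 'a \<Rightarrow> real"
  assumes "finite I" "\<And>i. i \<in> I \<Longrightarrow> integrable M (X i)" "\<And>i. i \<in> I \<Longrightarrow> c i \<in> {0..1}"
    and "integrable M Y"
    and "\<And>S. S \<subseteq> I \<Longrightarrow> (\<integral>w. \<bar>Y w + (\<Sum>i\<in>S. X i w)\<bar> \<partial>M) \<le> \<epsilon>"
  shows "(\<integral>w. \<bar>Y w + (\<Sum>i\<in>I. c i * X i w)\<bar> \<partial>M) \<le> \<epsilon>"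
  using assms
proof (induction I arbitrary: Y rule: finite_induct)
  case empty
  from empty.prems(4)[of "{}"] show ?case by simp
next
  case (insert j I)
  let ?Z = "\<lambda>w. \<Sum>i\<in>I. c i * X i w"
  have Xi: "integrable M (X i)" if "i \<in> insert j I" for i using insert.prems(1)[OF that] .
  have Z: "integrable M ?Z" using Xi by (intro Bochner_Integration.integrable_sum integrable_mult_right) auto
  \<comment> \<open>The coefficient of \<open>j\<close> is set to 0 here and to 1 in the next step,
    where \<open>Y\<close> absorbs \<open>X j\<close>; this is why the induction is over arbitrary
    \<open>Y\<close>.\<close>
  have 0: "(\<integral>w. \<bar>Y w + ?Z w\<bar> \<partial>M) \<le> \<epsilon>"
  proof (rule insert.IH)
    fix S assume "S \<subseteq> I"
    then show "(\<integral>w. \<bar>Y w + (\<Sum>i\<in>S. X i w)\<bar> \<partial>M) \<le> \<epsilon>" by (intro insert.prems(4)) auto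
  qed (use insert.prems in auto)
  have 1: "(\<integral>w. \<bar>(Y w + X j w) + ?Z w\<bar> \<partial>M) \<le> \<epsilon>"
  proof (rule insert.IH)
    fix S assume S: "S \<subseteq> I"
    then have "j \<notin> S" "finite S" using insert.hyps by (auto intro: finite_subset)
    then have "(\<integral>w. \<bar>Y w + X j w + (\<Sum>i\<in>S. X i w)\<bar> \<partial>M) = (\<integral>w. \<bar>Y w + (\<Sum>i\<in>insert j S. X i w)\<bar> \<partial>M)"
      by (simp add: add.assoc)
    also have "\<dots> \<le> \<epsilon>" using S by (intro insert.prems(4)) auto
    finally show "(\<integral>w. \<bar>Y w + X j w + (\<Sum>i\<in>S. X i w)\<bar> \<partial>M) \<le> \<epsilon>" .
  qed (use insert.prems Xi in auto)
  have cj: "0 \<le> c j" "c j \<le> 1" using insert.prems(2)[of j] by auto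
  have i0: "integrable M (\<lambda>w. \<bar>Y w + ?Z w\<bar>)" and i1: "integrable M (\<lambda>w. \<bar>(Y w + X j w) + ?Z w\<bar>)"
    using insert.prems(3) Z Xi[of j] by auto
  have il: "integrable M (\<lambda>w. \<bar>Y w + (\<Sum>i\<in>insert j I. c i * X i w)\<bar>)"
    using insert.prems(3) Z Xi[of j] insert.hyps by simp
  have "(\<integral>w. \<bar>Y w + (\<Sum>i\<in>insert j I. c i * X i w)\<bar> \<partial>M)
      \<le> (\<integral>w. (1 - c j) * \<bar>Y w + ?Z w\<bar> + c j * \<bar>(Y w + X j w) + ?Z w\<bar> \<partial>M)"
  proof (rule integral_mono[OF il])
    fix w
    have "\<bar>Y w + (\<Sum>i\<in>insert j I. c i * X i w)\<bar>
        = \<bar>(1 - c j) * (Y w + ?Z w) + c j * ((Y w + X j w) + ?Z w)\<bar>"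
      using insert.hyps by (simp add: algebra_simps)
    also have "\<dots> \<le> \<bar>(1 - c j) * (Y w + ?Z w)\<bar> + \<bar>c j * ((Y w + X j w) + ?Z w)\<bar>"
      by (rule abs_triangle_ineq)
    also have "\<dots> = (1 - c j) * \<bar>Y w + ?Z w\<bar> + c j * \<bar>(Y w + X j w) + ?Z w\<bar>"
      using cj by (simp add: abs_mult)
    finally show "\<bar>Y w + (\<Sum>i\<in>insert j I. c i * X i w)\<bar>
      \<le> (1 - c j) * \<bar>Y w + ?Z w\<bar> + c j * \<bar>(Y w + X j w) + ?Z w\<bar>" .
  qed (use i0 i1 in simp)
  also have "\<dots> = (1 - c j) * (\<integral>w. \<bar>Y w + ?Z w\<bar> \<partial>M) + c j * (\<integral>w. \<bar>(Y w + X j w) + ?Z w\<bar> \<partial>M)"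
    using i0 i1 by simp
  also have "\<dots> \<le> (1 - c j) * \<epsilon> + c j * \<epsilon>"
    using 0 1 cj by (intro add_mono mult_left_mono) auto
  finally show ?case by (simp add: algebra_simps)
qed

lemma sum_lessThan_double:
  fixes f :: "nat \<Rightarrow> 'b :: comm_monoid_add"
  shows "(\<Sum>k<2 * n. f k) = (\<Sum>i<n. f (2 * i) + f (Suc (2 * i)))"
  by (induction n) (simp_all add: add.assoc)

section \<open>Compensated squares on selected or weighted intervals of fine partitions\<close>

context bracketed_martingale
begin

text \<open>Sums of squared increments over partitions with mesh below \<open>\<delta>\<close>,
  recorded without the partition itself. Concatenating partitions of adjacent intervals becomes a
  plain induction instead of an operation on indexed points.\<close>

inductive fine_sum :: "real \<Rightarrow> real \<Rightarrow> real \<Rightarrow> ('a \<Rightarrow> real) \<Rightarrow> bool" for \<delta> a where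
  fine_sum_refl: "fine_sum \<delta> a a (\<lambda>_. 0)"
| fine_sum_step: "fine_sum \<delta> a b X \<Longrightarrow> b \<le> c \<Longrightarrow> c - b < \<delta> \<Longrightarrow>
    fine_sum \<delta> a c (\<lambda>w. X w + (L c w - L b w)\<^sup>2)"

lemma fine_sum_le: "fine_sum \<delta> a b X \<Longrightarrow> a \<le> b"
  by (induction rule: fine_sum.induct) auto

lemma fine_sum_mono: "fine_sum \<delta> a b X \<Longrightarrow> \<delta> \<le> \<delta>' \<Longrightarrow> fine_sum \<delta>' a b X"
  by (induction rule: fine_sum.induct) (auto intro!: fine_sum_refl fine_sum_step)

lemma fine_sum_append:
  assumes "fine_sum \<delta> b c Y" "fine_sum \<delta> a b X"
  shows "fine_sum \<delta> a c (\<lambda>w. X w + Y w)"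
  using assms
proof (induction rule: fine_sum.induct)
  case fine_sum_refl then show ?case by simp
next
  case (fine_sum_step d Y c)
  from fine_sum.fine_sum_step[OF fine_sum_step.IH[OF fine_sum_step.prems] fine_sum_step.hyps(2,3)]
  show ?case by (simp add: add.assoc)
qed

lemma fine_sum_partition:
  "fine_sum \<delta> 0 b X \<Longrightarrow> \<exists>n p. is_partition b n p \<and> mesh_below \<delta> n p \<and> X = squares p n"
proof (induction rule: fine_sum.induct)
  case fine_sum_refl
  show ?case by (intro exI[of _ 0] exI[of _ "\<lambda>_. 0"]) (auto simp: is_partition_def squares_def)
next
  case (fine_sum_step b X c)
  then obtain n p where p: "is_partition b n p" "mesh_below \<delta> n p" "X = squares p n" by blast
  let ?p = "p(Suc n := c)"
  have "is_partition c (Suc n) ?p" using p(1) fine_sum_step.hyps by (auto simp: is_partition_def less_Suc_eq)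
  moreover have "\<forall>i<Suc n. ?p (Suc i) - ?p i < \<delta>"
    using p fine_sum_step.hyps by (auto simp: is_partition_def less_Suc_eq)
  moreover have "(\<lambda>w. X w + (L c w - L b w)\<^sup>2) = squares ?p (Suc n)"
    using p by (auto simp: squares_def is_partition_def)
  ultimately show ?case by blast
qed

lemma fine_sum_exists:
  assumes "a \<le> b" "0 < \<delta>"
  shows "\<exists>X. fine_sum \<delta> a b X"
proof -
  have "\<exists>X. fine_sum \<delta> a b X" if "a \<le> b" "b \<le> a + real n * (\<delta> / 2)" for n b
    using that
  proof (induction n arbitrary: b)
    case 0
    then have "b = a" by simp
    then show ?case using fine_sum_refl by blast
  next
    case (Suc n)
    define b' where "b' = max a (b - \<delta> / 2)"
    have "b - \<delta> / 2 \<le> a + real n * (\<delta> / 2)" using Suc.prems by (simp add: field_simps)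
    moreover have "0 \<le> real n * (\<delta> / 2)" using assms(2) by simp
    ultimately have "b' \<le> a + real n * (\<delta> / 2)" "a \<le> b'" by (simp_all add: b'_def)
    then obtain X where "fine_sum \<delta> a b' X" using Suc.IH[of b'] by blast
    moreover have "b' \<le> b" "b - b' < \<delta>" using Suc.prems assms(2) by (auto simp: b'_def)
    ultimately show ?case using fine_sum_step by blast
  qed
  moreover obtain n where "(b - a) / (\<delta> / 2) \<le> real n" using real_arch_simple by blast
  then have "b \<le> a + real n * (\<delta> / 2)" using assms(2) by (simp add: field_simps)
  ultimately show ?thesis using assms(1) by blast
qed

lemma fine_sum_integrable:
  "fine_sum \<delta> a b X \<Longrightarrow> 0 \<le> a \<Longrightarrow> b < T \<Longrightarrow> integrable P X"
proof (induction rule: fine_sum.induct)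
  case (fine_sum_step b X c)
  have "a \<le> b" using fine_sum_le[OF fine_sum_step.hyps(1)] .
  then show ?case using fine_sum_step
    by (intro Bochner_Integration.integrable_add L_diff_square_integrable) auto
qed simp

lemma fine_sum_converges:
  assumes "0 \<le> t" "t < T" "0 < \<epsilon>"
  shows "\<exists>\<delta>>0. \<forall>X. fine_sum \<delta> 0 t X \<longrightarrow> (\<integral>w. \<bar>X w - Q t w\<bar> \<partial>P) \<le> \<epsilon>"
  using squares_converge_L1[OF assms] fine_sum_partition by blast

text \<open>A fine sum up to \<open>s\<close> followed by one from \<open>s\<close> to
  \<open>t\<close> is a fine sum up to \<open>t\<close>. Both initial sums are close to the bracket,
  hence so is their difference. The mesh may be refined as far as \<open>\<epsilon>\<close> requires
  while staying below the prescribed \<open>\<delta>\<close>.\<close>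

lemma fine_sum_subinterval:
  assumes st: "0 \<le> s" "s \<le> t" "t < T" and "0 < \<epsilon>" "0 < \<delta>"
  shows "\<exists>X. fine_sum \<delta> s t X \<and> (\<integral>w. \<bar>X w - (Q t w - Q s w)\<bar> \<partial>P) \<le> \<epsilon>"
proof -
  obtain d1 where d1: "0 < d1" "\<And>X. fine_sum d1 0 s X \<Longrightarrow> (\<integral>w. \<bar>X w - Q s w\<bar> \<partial>P) \<le> \<epsilon> / 2"
    using fine_sum_converges[of s "\<epsilon> / 2"] st \<open>0 < \<epsilon>\<close> by auto
  obtain d2 where d2: "0 < d2" "\<And>X. fine_sum d2 0 t X \<Longrightarrow> (\<integral>w. \<bar>X w - Q t w\<bar> \<partial>P) \<le> \<epsilon> / 2"
    using fine_sum_converges[of t "\<epsilon> / 2"] st \<open>0 < \<epsilon>\<close> by auto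
  define d where "d = min \<delta> (min d1 d2)"
  have d: "0 < d" "d \<le> \<delta>" "d \<le> d1" "d \<le> d2" using d1 d2 \<open>0 < \<delta>\<close> by (auto simp: d_def)
  obtain X where X: "fine_sum d 0 s X" using fine_sum_exists[OF st(1) d(1)] by blast
  obtain Y where Y: "fine_sum d s t Y" using fine_sum_exists[OF st(2) d(1)] by blast
  have i: "integrable P X" "integrable P Y" "integrable P (Q s)" "integrable P (Q t)"
    using fine_sum_integrable[OF X] fine_sum_integrable[OF Y] Q_integrable_expectation st by auto
  have "(\<integral>w. \<bar>Y w - (Q t w - Q s w)\<bar> \<partial>P) \<le> (\<integral>w. \<bar>(X w + Y w) - Q t w\<bar> + \<bar>X w - Q s w\<bar> \<partial>P)"
    using i by (intro integral_mono) auto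
  also have "\<dots> = (\<integral>w. \<bar>(X w + Y w) - Q t w\<bar> \<partial>P) + (\<integral>w. \<bar>X w - Q s w\<bar> \<partial>P)"
    using i by simp
  also have "\<dots> \<le> \<epsilon> / 2 + \<epsilon> / 2"
    using d1(2)[OF fine_sum_mono[OF X d(3)]] d2(2)[OF fine_sum_mono[OF fine_sum_append[OF Y X] d(4)]]
    by (intro add_mono) auto
  finally show ?thesis using fine_sum_mono[OF Y d(2)] by auto
qed

definition compensated :: "real \<Rightarrow> real \<Rightarrow> 'a \<Rightarrow> real" where
  "compensated s t w = (L t w - L s w)\<^sup>2 - (Q t w - Q s w)"

lemma compensated_integrable:
  assumes "0 \<le> s" "s < T" "0 \<le> t" "t < T"
  shows "integrable P (compensated s t)"
  unfolding compensated_def using L_diff_square_integrable[OF assms] Q_integrable_expectation assms by auto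

text \<open>
  The argument of the Saks--Henstock lemma: on the intervals outside \<open>S\<close> the partition is refined
  until the squares there reproduce the bracket, so the total error is the error on \<open>S\<close>.
\<close>

lemma saks_henstock:
  assumes t: "0 \<le> t" "t < T" and "0 < \<epsilon>"
  shows "\<exists>\<delta>>0. \<forall>n p S. is_partition t n p \<and> mesh_below \<delta> n p \<and> S \<subseteq> {..<n} \<longrightarrow>
    (\<integral>w. \<bar>\<Sum>i\<in>S. compensated (p i) (p (Suc i)) w\<bar> \<partial>P) \<le> \<epsilon>"
proof -
  obtain \<delta> where \<delta>: "0 < \<delta>" "\<And>X. fine_sum \<delta> 0 t X \<Longrightarrow> (\<integral>w. \<bar>X w - Q t w\<bar> \<partial>P) \<le> \<epsilon> / 2"
    using fine_sum_converges[OF t, of "\<epsilon> / 2"] \<open>0 < \<epsilon>\<close> by auto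
  have "(\<integral>w. \<bar>\<Sum>i\<in>S. compensated (p i) (p (Suc i)) w\<bar> \<partial>P) \<le> \<epsilon>"
    if p: "is_partition t n p" "mesh_below \<delta> n p" and S: "S \<subseteq> {..<n}" for n p S
  proof -
    define C where "C i = compensated (p i) (p (Suc i))" for i
    \<comment> \<open>At most \<open>n\<close> intervals are refined, each at the cost
      \<open>e\<close>, which uses up half of \<open>\<epsilon>\<close>; the other half is the error
      of the whole fine sum. Adding 1 covers \<open>n = 0\<close>.\<close>
    define e where "e = \<epsilon> / (2 * (real n + 1))"
    have e: "0 < e" using \<open>0 < \<epsilon>\<close> by (simp add: e_def)
    have b: "0 \<le> p i" "p i < T" if "i \<le> n" for i using partition_bounds[OF p(1) that] t by auto
    have m: "p i \<le> p (Suc i)" if "i < n" for i using p(1) that by (auto simp: is_partition_def)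
    have Ci: "integrable P (C i)" if "i < n" for i
      unfolding C_def using b that by (intro compensated_integrable) auto
    have CS: "integrable P (\<lambda>w. \<Sum>i\<in>A. C i w)" if "A \<subseteq> {..<n}" for A
      using Ci that by (intro Bochner_Integration.integrable_sum) auto
    \<comment> \<open>\<open>Y\<close> keeps the intervals in \<open>S\<close> unchanged, where its
      error is exactly \<open>C i\<close>, and replaces every other interval by a refinement with
      error at most \<open>e\<close>. It remains a sum of mesh below \<open>\<delta>\<close>, so the
      estimate for whole sums applies to it.\<close>
    have "\<exists>Y. fine_sum \<delta> 0 (p k) Y \<and>
        (\<integral>w. \<bar>Y w - Q (p k) w - (\<Sum>i\<in>S \<inter> {..<k}. C i w)\<bar> \<partial>P) \<le> real k * e" if "k \<le> n" for k
      using that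
    proof (induction k)
      case 0
      have p0: "p 0 = 0" using p(1) by (simp add: is_partition_def)
      have "(\<integral>w. \<bar>0 - Q (p 0) w - (\<Sum>i\<in>S \<inter> {..<0}. C i w)\<bar> \<partial>P) = (\<integral>w. 0 \<partial>P)"
        by (intro Bochner_Integration.integral_cong) (auto simp: p0 Q_zero)
      then show ?case using fine_sum_refl[of \<delta> 0] p0 by (intro exI[of _ "\<lambda>_. 0"]) simp
    next
      case (Suc k)
      then obtain Y where Y: "fine_sum \<delta> 0 (p k) Y"
        "(\<integral>w. \<bar>Y w - Q (p k) w - (\<Sum>i\<in>S \<inter> {..<k}. C i w)\<bar> \<partial>P) \<le> real k * e" by auto
      have k: "k < n" "k \<le> n" using Suc.prems by auto
      have bk: "0 \<le> p k" "p k < T" "0 \<le> p (Suc k)" "p (Suc k) < T" using b Suc.prems by auto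
      have Yi: "integrable P Y" using fine_sum_integrable[OF Y(1)] bk by simp
      have Qi: "integrable P (Q (p k))" "integrable P (Q (p (Suc k)))"
        using Q_integrable_expectation bk by auto
      show ?case
      proof (cases "k \<in> S")
        case True
        have ins: "S \<inter> {..<Suc k} = insert k (S \<inter> {..<k})" using True by (auto simp: less_Suc_eq)
        have "fine_sum \<delta> 0 (p (Suc k)) (\<lambda>w. Y w + (L (p (Suc k)) w - L (p k) w)\<^sup>2)"
          using p(2) k m[OF k(1)] by (intro fine_sum_step[OF Y(1)]) auto
        moreover have "(\<lambda>w. \<bar>Y w + (L (p (Suc k)) w - L (p k) w)\<^sup>2 - Q (p (Suc k)) w - (\<Sum>i\<in>S \<inter> {..<Suc k}. C i w)\<bar>)
            = (\<lambda>w. \<bar>Y w - Q (p k) w - (\<Sum>i\<in>S \<inter> {..<k}. C i w)\<bar>)"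
          unfolding ins by (auto simp: C_def compensated_def algebra_simps)
        moreover have "real k * e \<le> real (Suc k) * e" using e by (intro mult_right_mono) auto
        ultimately show ?thesis using Y(2)
          by (intro exI[of _ "\<lambda>w. Y w + (L (p (Suc k)) w - L (p k) w)\<^sup>2"]) simp
      next
        case False
        have ins: "S \<inter> {..<Suc k} = S \<inter> {..<k}" using False by (auto simp: less_Suc_eq)
        obtain Z where Z: "fine_sum \<delta> (p k) (p (Suc k)) Z"
          "(\<integral>w. \<bar>Z w - (Q (p (Suc k)) w - Q (p k) w)\<bar> \<partial>P) \<le> e"
          using fine_sum_subinterval[OF bk(1) m[OF k(1)] bk(4) e \<delta>(1)] by blast
        have Zi: "integrable P Z" using fine_sum_integrable[OF Z(1)] bk by simp
        have Ai: "integrable P (\<lambda>w. \<Sum>i\<in>S \<inter> {..<k}. C i w)" using S by (intro CS) auto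
        have "(\<integral>w. \<bar>Y w + Z w - Q (p (Suc k)) w - (\<Sum>i\<in>S \<inter> {..<k}. C i w)\<bar> \<partial>P)
          \<le> (\<integral>w. \<bar>Y w - Q (p k) w - (\<Sum>i\<in>S \<inter> {..<k}. C i w)\<bar> + \<bar>Z w - (Q (p (Suc k)) w - Q (p k) w)\<bar> \<partial>P)"
          using Yi Zi Qi Ai by (intro integral_mono) auto
        also have "\<dots> = (\<integral>w. \<bar>Y w - Q (p k) w - (\<Sum>i\<in>S \<inter> {..<k}. C i w)\<bar> \<partial>P)
          + (\<integral>w. \<bar>Z w - (Q (p (Suc k)) w - Q (p k) w)\<bar> \<partial>P)"
          using Yi Zi Qi Ai by simp
        also have "\<dots> \<le> real (Suc k) * e" using Y(2) Z(2) by (simp add: algebra_simps)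
        finally show ?thesis unfolding ins using fine_sum_append[OF Z(1) Y(1)] by blast
      qed
    qed
    from this[of n] obtain Y where Y: "fine_sum \<delta> 0 t Y"
      "(\<integral>w. \<bar>Y w - Q t w - (\<Sum>i\<in>S \<inter> {..<n}. C i w)\<bar> \<partial>P) \<le> real n * e"
      using p(1) by (auto simp: is_partition_def)
    have Sn: "S \<inter> {..<n} = S" using S by auto
    have Yi: "integrable P Y" using fine_sum_integrable[OF Y(1)] t by simp
    have Qi: "integrable P (Q t)" using Q_integrable_expectation t by auto
    have "(\<integral>w. \<bar>\<Sum>i\<in>S. C i w\<bar> \<partial>P) \<le>
        (\<integral>w. \<bar>Y w - Q t w - (\<Sum>i\<in>S. C i w)\<bar> + \<bar>Y w - Q t w\<bar> \<partial>P)"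
      using Yi Qi CS[OF S] by (intro integral_mono) auto
    also have "\<dots> = (\<integral>w. \<bar>Y w - Q t w - (\<Sum>i\<in>S. C i w)\<bar> \<partial>P) + (\<integral>w. \<bar>Y w - Q t w\<bar> \<partial>P)"
      using Yi Qi CS[OF S] by simp
    also have "\<dots> \<le> real n * e + \<epsilon> / 2" using Y(2) \<delta>(2)[OF Y(1)] by (simp add: Sn)
    also have "real n * e \<le> (real n + 1) * e" using e by (intro mult_right_mono) auto
    also have "(real n + 1) * e = \<epsilon> / 2" by (simp add: e_def divide_simps)
    finally show ?thesis by (simp add: C_def)
  qed
  then show ?thesis using \<delta>(1) by blast
qed

lemma saks_henstock_weighted:
  assumes t: "0 \<le> t" "t < T" and "0 < \<epsilon>"
  shows "\<exists>\<delta>>0. \<forall>n p c. is_partition t n p \<and> mesh_below \<delta> n p \<and> (\<forall>i<n. c i \<in> {0..1}) \<longrightarrow>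
    (\<integral>w. \<bar>\<Sum>i<n. c i * compensated (p i) (p (Suc i)) w\<bar> \<partial>P) \<le> \<epsilon>"
proof -
  obtain \<delta> where \<delta>: "0 < \<delta>" "\<And>n p S. is_partition t n p \<Longrightarrow> mesh_below \<delta> n p \<Longrightarrow> S \<subseteq> {..<n} \<Longrightarrow>
    (\<integral>w. \<bar>\<Sum>i\<in>S. compensated (p i) (p (Suc i)) w\<bar> \<partial>P) \<le> \<epsilon>"
    using saks_henstock[OF assms] by blast
  have "(\<integral>w. \<bar>\<Sum>i<n. c i * compensated (p i) (p (Suc i)) w\<bar> \<partial>P) \<le> \<epsilon>"
    if p: "is_partition t n p" "mesh_below \<delta> n p" and c: "\<forall>i<n. c i \<in> {0..1}" for n p c
  proof -
    have b: "0 \<le> p i" "p i < T" if "i \<le> n" for i using partition_bounds[OF p(1) that] t by auto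
    have "(\<integral>w. \<bar>0 + (\<Sum>i<n. c i * compensated (p i) (p (Suc i)) w)\<bar> \<partial>P) \<le> \<epsilon>"
    proof (rule L1_norm_convex_combination)
      show "integrable P (compensated (p i) (p (Suc i)))" if "i \<in> {..<n}" for i
        using b that by (intro compensated_integrable) auto
    qed (use c \<delta>(2)[OF p] in auto)
    then show ?thesis by simp
  qed
  then show ?thesis using \<delta>(1) by blast
qed

end

section \<open>Averages over an interval, written as integrals over the unit interval\<close>

definition unit_average :: "(real \<Rightarrow> real) \<Rightarrow> real \<Rightarrow> real \<Rightarrow> real" where
  "unit_average f s t = (LBINT x:{0..1}. f (s + x * (t - s)))"

lemma segment_mem:
  fixes s t x :: real
  assumes "s \<le> t" "x \<in> {0..1}"
  shows "s + x * (t - s) \<in> {s..t}"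
proof -
  have "0 \<le> x * (t - s)" "x * (t - s) \<le> 1 * (t - s)"
    using assms by (intro mult_nonneg_nonneg mult_right_mono; simp)+
  then show ?thesis by auto
qed

lemma unit_average_integrable:
  fixes f :: "real \<Rightarrow> real"
  assumes "s \<le> t" "continuous_on {s..t} f"
  shows "set_integrable lborel {0..1} (\<lambda>x. f (s + x * (t - s)))"
  by (intro borel_integrable_atLeastAtMost' continuous_on_compose2[OF assms(2)] continuous_intros)
    (use segment_mem[OF assms(1)] in auto)

lemma unit_average_diff:
  assumes "s \<le> t" "continuous_on {s..t} f" "continuous_on {s..t} g"
  shows "unit_average (\<lambda>u. f u - g u) s t = unit_average f s t - unit_average g s t"
  unfolding unit_average_def using assms by (intro set_integral_diff unit_average_integrable)

lemma unit_average_add: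
  assumes "s \<le> t" "continuous_on {s..t} f" "continuous_on {s..t} g"
  shows "unit_average (\<lambda>u. f u + g u) s t = unit_average f s t + unit_average g s t"
  unfolding unit_average_def using assms by (intro set_integral_add unit_average_integrable)

lemma unit_average_cmult: "unit_average (\<lambda>u. c * f u) s t = c * unit_average f s t"
  unfolding unit_average_def by simp

lemma unit_average_const: "unit_average (\<lambda>u. c) s t = c"
  unfolding unit_average_def set_lebesgue_integral_def by simp

lemma unit_average_bound:
  assumes "s \<le> t" "continuous_on {s..t} f" "\<And>u. u \<in> {s..t} \<Longrightarrow> \<bar>f u\<bar> \<le> B"
  shows "\<bar>unit_average f s t\<bar> \<le> B"
proof -
  have i: "set_integrable lborel {0..1} (\<lambda>x. f (s + x * (t - s)))"
    using unit_average_integrable[OF assms(1,2)] .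
  have c: "set_integrable lborel {0..1::real} (\<lambda>x. B)" by (intro borel_integrable_atLeastAtMost') auto
  have "\<bar>unit_average f s t\<bar> \<le> (LBINT x:{0..1}. \<bar>f (s + x * (t - s))\<bar>)"
    unfolding unit_average_def using set_integral_norm_bound[OF i] by simp
  also have "\<dots> \<le> (LBINT x:{0..1::real}. B)"
  proof (rule set_integral_mono[OF _ c])
    show "set_integrable lborel {0..1} (\<lambda>x. \<bar>f (s + x * (t - s))\<bar>)" using i by (rule set_integrable_abs)
    show "\<bar>f (s + x * (t - s))\<bar> \<le> B" if "x \<in> {0..1}" for x
      using assms(3)[OF segment_mem[OF assms(1) that]] .
  qed
  also have "\<dots> = B" unfolding set_lebesgue_integral_def by simp
  finally show ?thesis .
qed

text \<open>The value 1/2 is the origin of the factor 2 in front of the scaled error.\<close>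

lemma unit_average_affine: "unit_average (\<lambda>u. u - s) s t = (t - s) / 2"
proof -
  have "unit_average (\<lambda>u. u - s) s t = (LBINT x:{0..1}. x) * (t - s)"
    unfolding unit_average_def by simp
  also have "(LBINT x:{0..1}. x) = (1::real) / 2"
    using integral_power[of 0 1 1] unfolding set_lebesgue_integral_def by (simp add: mult.commute)
  finally show ?thesis by simp
qed

text \<open>Since the average is defined by substitution and not by dividing by the length, it has a
  finite value on intervals of length 0 as well, and both sides vanish there. Such intervals occur
  after a net is cut off.\<close>

lemma integral_eq_unit_average:
  assumes "s \<le> t"
  shows "(LBINT u:{s..t}. f u) = (t - s) * unit_average f s t"
proof (cases "s = t")
  case True
  have "(LBINT u:{t..t}. f u) = (\<integral>u. indicator {t} u *\<^sub>R f t \<partial>lborel)"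
    unfolding set_lebesgue_integral_def by (intro Bochner_Integration.integral_cong) (auto simp: indicator_def)
  also have "\<dots> = 0" by simp
  finally show ?thesis using True by simp
next
  case False
  with assms have d: "0 < t - s" by simp
  have ind: "indicator {s..t} (s + (t - s) * x) = (indicator {0..1} x :: real)" for x
  proof -
    have "s + (t - s) * x \<le> t \<longleftrightarrow> (t - s) * x \<le> (t - s) * 1" by auto
    also have "\<dots> \<longleftrightarrow> x \<le> 1" using d by (simp only: mult_le_cancel_left_pos)
    finally show ?thesis using d by (auto simp: indicator_def zero_le_mult_iff)
  qed
  show ?thesis unfolding unit_average_def set_lebesgue_integral_def
    by (subst lborel_integral_real_affine[where c="t - s" and t=s]) (use d ind in \<open>auto simp: mult.commute\<close>)
qed

section \<open>Estimates for compensated squares averaged over their right end point\<close>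

context bracketed_martingale
begin

lemma clamp_mem: "0 \<le> t \<Longrightarrow> max 0 (min t u) \<in> {0..t}" for t u :: real
  by auto

lemma L_continuous_on: "t < T \<Longrightarrow> w \<in> space P \<Longrightarrow> continuous_on {0..t} (\<lambda>u. L u w)"
  by (rule continuous_on_subset[OF L_continuous]) auto

text \<open>Clamping the time extends the process by its end values, so that paths controlled only
  on \<open>{0..t}\<close> become continuous on the whole line.\<close>

lemma clamped_joint_measurable:
  fixes X :: "real \<Rightarrow> 'a \<Rightarrow> real"
  assumes t: "0 \<le> t"
    and meas: "\<And>u. u \<in> {0..t} \<Longrightarrow> X u \<in> borel_measurable P"
    and cont: "\<And>w. w \<in> space P \<Longrightarrow> continuous_on {0..t} (\<lambda>u. X u w)"
  shows "(\<lambda>z. X (max 0 (min t (fst z))) (snd z)) \<in> borel_measurable (borel \<Otimes>\<^sub>M P)"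
proof (rule jointly_measurable_of_continuous[where X="\<lambda>u. X (max 0 (min t u))"])
  show "X (max 0 (min t u)) \<in> borel_measurable P" for u by (rule meas[OF clamp_mem[OF t]])
  show "continuous_on UNIV (\<lambda>u. X (max 0 (min t u)) w)" if "w \<in> space P" for w
    by (rule continuous_on_compose2[OF cont[OF that]]) (use t in \<open>auto intro!: continuous_intros\<close>)
qed

lemma unit_average_L1_bound:
  fixes X :: "real \<Rightarrow> 'a \<Rightarrow> real"
  assumes st: "0 \<le> s" "s \<le> t" and "0 \<le> \<epsilon>"
    and meas: "\<And>u. u \<in> {0..t} \<Longrightarrow> X u \<in> borel_measurable P"
    and cont: "\<And>w. w \<in> space P \<Longrightarrow> continuous_on {0..t} (\<lambda>u. X u w)"
    and i: "\<And>u. u \<in> {s..t} \<Longrightarrow> integrable P (X u)"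
    and e: "\<And>u. u \<in> {s..t} \<Longrightarrow> (\<integral>w. \<bar>X u w\<bar> \<partial>P) \<le> \<epsilon>"
  shows "integrable P (\<lambda>w. unit_average (\<lambda>u. X u w) s t)"
    "(\<integral>w. \<bar>unit_average (\<lambda>u. X u w) s t\<bar> \<partial>P) \<le> \<epsilon>"
proof -
  define H where "H x = X (max 0 (min t (s + x * (t - s))))" for x
  have seg: "s + x * (t - s) \<in> {s..t}" if "x \<in> {0..1}" for x using segment_mem[OF st(2) that] .
  have t: "0 \<le> t" using st by simp
  have m: "(\<lambda>z. H (fst z) (snd z)) \<in> borel_measurable (borel \<Otimes>\<^sub>M P)"
    using measurable_compose[OF _ clamped_joint_measurable[OF t meas cont], of "\<lambda>z. (s + fst z * (t - s), snd z)"]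
    by (simp add: H_def)
  have Hx: "H x = X (s + x * (t - s))" if "x \<in> {0..1}" for x
  proof -
    have "max 0 (min t (s + x * (t - s))) = s + x * (t - s)" using seg[OF that] st by auto
    then show ?thesis by (simp only: H_def)
  qed
  have hi: "integrable P (H x)" and he: "(\<integral>w. \<bar>H x w\<bar> \<partial>P) \<le> \<epsilon>" if "x \<in> {0..1}" for x
    unfolding Hx[OF that] using i e seg[OF that] by blast+
  have eq: "(LBINT x:{0..1}. H x w) = unit_average (\<lambda>u. X u w) s t" for w
    unfolding unit_average_def by (rule set_lebesgue_integral_cong) (auto simp: Hx)
  note B = integral_over_interval_L1_bound[OF m, of 0 1, OF _ \<open>0 \<le> \<epsilon>\<close> hi he]
  show "integrable P (\<lambda>w. unit_average (\<lambda>u. X u w) s t)" using B(1) by (simp add: eq)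
  show "(\<integral>w. \<bar>unit_average (\<lambda>u. X u w) s t\<bar> \<partial>P) \<le> \<epsilon>" using B(2) by (simp add: eq)
qed

lemma compensated_continuous:
  assumes "0 \<le> s" "t < T" "w \<in> space P"
  shows "continuous_on {0..t} (\<lambda>u. compensated s u w)"
  unfolding compensated_def using L_continuous_on[of t w] Q_continuous[of t w] assms
  by (intro continuous_intros) auto

abbreviation mean_compensated :: "(nat \<Rightarrow> real) \<Rightarrow> nat \<Rightarrow> 'a \<Rightarrow> real" where
  "mean_compensated p i w \<equiv> unit_average (\<lambda>u. compensated (p i) u w) (p i) (p (Suc i))"

text \<open>For a fixed relative position \<open>x\<close> the intermediate points are added to the
  partition, and the weight 0 is put on the right-hand pieces. The mesh does not grow, so the
  weighted estimate holds with the same error for every \<open>x\<close>, and integration over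
  \<open>x\<close> preserves it.\<close>

lemma saks_henstock_averaged:
  assumes t: "0 \<le> t" "t < T" and "0 < \<epsilon>"
  shows "\<exists>\<delta>>0. \<forall>n p c. is_partition t n p \<and> mesh_below \<delta> n p \<and> (\<forall>i<n. c i \<in> {0..1}) \<longrightarrow>
    integrable P (\<lambda>w. \<Sum>i<n. c i * mean_compensated p i w) \<and>
    (\<integral>w. \<bar>\<Sum>i<n. c i * mean_compensated p i w\<bar> \<partial>P) \<le> \<epsilon>"
proof -
  obtain \<delta> where \<delta>: "0 < \<delta>" "\<And>n p c. is_partition t n p \<Longrightarrow> mesh_below \<delta> n p \<Longrightarrow>
      (\<forall>i<n. c i \<in> {0..1}) \<Longrightarrow> (\<integral>w. \<bar>\<Sum>i<n. c i * compensated (p i) (p (Suc i)) w\<bar> \<partial>P) \<le> \<epsilon>"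
    using saks_henstock_weighted[OF assms] by blast
  have "integrable P (\<lambda>w. \<Sum>i<n. c i * mean_compensated p i w) \<and>
    (\<integral>w. \<bar>\<Sum>i<n. c i * mean_compensated p i w\<bar> \<partial>P) \<le> \<epsilon>"
    if p: "is_partition t n p" "mesh_below \<delta> n p" and c: "\<forall>i<n. c i \<in> {0..1}" for n p c
  proof -
    have b: "0 \<le> p i" "p i \<le> t" "p i < T" if "i \<le> n" for i
      using partition_bounds[OF p(1) that] t by auto
    have m: "p i \<le> p (Suc i)" if "i < n" for i using p(1) that by (auto simp: is_partition_def)
    define y where "y x i = p i + x * (p (Suc i) - p i)" for x i
    have y: "p i \<le> y x i" "y x i \<le> p (Suc i)" "0 \<le> y x i" "y x i \<le> t" "max 0 (min t (y x i)) = y x i"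
      if "i < n" "x \<in> {0..1}" for i x
      using segment_mem[OF m[OF that(1)] that(2)] b[of i] b[of "Suc i"] that(1) by (auto simp: y_def)
    define H where "H x w = (\<Sum>i<n. c i * compensated (p i) (max 0 (min t (y x i))) w)" for x w
    have Hx: "H x = (\<lambda>w. \<Sum>i<n. c i * compensated (p i) (y x i) w)" if "x \<in> {0..1}" for x
      unfolding H_def using y(5)[OF _ that] by (auto intro!: sum.cong)
    have Hm: "(\<lambda>z. H (fst z) (snd z)) \<in> borel_measurable (borel \<Otimes>\<^sub>M P)"
      unfolding H_def
    proof (intro borel_measurable_sum borel_measurable_times borel_measurable_const)
      fix i assume i: "i \<in> {..<n}"
      have "(\<lambda>z. compensated (p i) (max 0 (min t (fst z))) (snd z)) \<in> borel_measurable (borel \<Otimes>\<^sub>M P)"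
        using compensated_integrable b[of i] compensated_continuous[of "p i" t] i t
        by (intro clamped_joint_measurable) auto
      from measurable_compose[OF _ this, of "\<lambda>z. (y (fst z) i, snd z)"]
      show "(\<lambda>z. compensated (p i) (max 0 (min t (y (fst z) i))) (snd z)) \<in> borel_measurable (borel \<Otimes>\<^sub>M P)"
        unfolding y_def by simp
    qed
    have Hi: "integrable P (H x)" if "x \<in> {0..1}" for x
    proof -
      have "integrable P (compensated (p i) (y x i))" if "i < n" for i
        using y[OF that \<open>x \<in> {0..1}\<close>] b[of i] t that by (intro compensated_integrable) auto
      then show ?thesis unfolding Hx[OF that]
        by (intro Bochner_Integration.integrable_sum integrable_mult_right) auto
    qed
    have HE: "(\<integral>w. \<bar>H x w\<bar> \<partial>P) \<le> \<epsilon>" if x: "x \<in> {0..1}" for x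
    proof -
      \<comment> \<open>Even indices are the old points, odd ones the inserted points; the last
        index \<open>2 * n\<close> is even and gives \<open>p n\<close>. In \<open>c'\<close> the
        even indices mark the left-hand pieces, which keep their weight.\<close>
      define p' where "p' k = (if even k then p (k div 2) else y x (k div 2))" for k
      define c' where "c' k = (if even k then c (k div 2) else 0)" for k
      have le: "p' k \<le> p' (Suc k) \<and> p' (Suc k) - p' k < \<delta>" if "k < 2 * n" for k
      proof -
        have "k div 2 < n" using that by auto
        moreover have "Suc k div 2 = Suc (k div 2)" if "odd k" using that by presburger
        ultimately show ?thesis using y[of "k div 2" x] x p(2)[rule_format, of "k div 2"]
          by (auto simp: p'_def)
      qed
      have part: "is_partition t (2 * n) p'"
        using p(1) le by (auto simp: is_partition_def p'_def)
      have "(\<integral>w. \<bar>\<Sum>k<2 * n. c' k * compensated (p' k) (p' (Suc k)) w\<bar> \<partial>P) \<le> \<epsilon>"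
        using le c by (intro \<delta>(2)[OF part]) (auto simp: c'_def)
      then show ?thesis unfolding sum_lessThan_double Hx[OF x] by (simp add: c'_def p'_def)
    qed
    note B = integral_over_interval_L1_bound[OF Hm, of 0 1 \<epsilon>, OF _ _ Hi HE]
    have eq: "(LBINT x:{0..1}. H x w) = (\<Sum>i<n. c i * mean_compensated p i w)"
      if "w \<in> space P" for w
    proof -
      have "(LBINT x:{0..1}. H x w) = (LBINT x:{0..1}. \<Sum>i<n. c i * compensated (p i) (y x i) w)"
        by (rule set_lebesgue_integral_cong) (use Hx in auto)
      also have "\<dots> = (\<Sum>i<n. LBINT x:{0..1}. c i * compensated (p i) (y x i) w)"
        unfolding set_lebesgue_integral_def scaleR_sum_right
      proof (rule Bochner_Integration.integral_sum)
        fix i assume i: "i \<in> {..<n}"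
        have "continuous_on {p i..p (Suc i)} (\<lambda>u. compensated (p i) u w)"
          by (rule continuous_on_subset[OF compensated_continuous[of "p i" t]])
            (use b[of i] b[of "Suc i"] i t that in auto)
        from unit_average_integrable[OF m this] i
        have "set_integrable lborel {0..1} (\<lambda>x. c i * compensated (p i) (y x i) w)"
          by (intro set_integrable_mult_right) (auto simp: y_def)
        then show "integrable lborel (\<lambda>x. indicator {0..1} x *\<^sub>R (c i * compensated (p i) (y x i) w))"
          by (simp add: set_integrable_def)
      qed
      finally show ?thesis by (simp add: unit_average_def y_def)
    qed
    have "integrable P (\<lambda>w. LBINT x:{0..1}. H x w)" "(\<integral>w. \<bar>LBINT x:{0..1}. H x w\<bar> \<partial>P) \<le> \<epsilon>"
      using B \<open>0 < \<epsilon>\<close> by auto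
    then show ?thesis
      by (simp add: eq cong: Bochner_Integration.integrable_cong Bochner_Integration.integral_cong)
  qed
  then show ?thesis using \<delta>(1) by blast
qed

end

subsection \<open>Averages of primitives\<close>

lemma trunc_continuous: "continuous_on A f \<Longrightarrow> continuous_on A (\<lambda>x. trunc K (f x))"
  unfolding trunc_def by (intro continuous_intros)

lemma trunc_eq: "\<bar>x\<bar> \<le> K \<Longrightarrow> trunc K x = x"
  by (auto simp: trunc_def)

lemma abs_diff_trunc_le: "0 \<le> K \<Longrightarrow> \<bar>x - trunc K x\<bar> \<le> \<bar>x\<bar>"
  by (auto simp: trunc_def)

lemma abs_integral_le_integral:
  fixes f g :: "real \<Rightarrow> real"
  assumes "f integrable_on S" "g integrable_on S" "\<And>x. x \<in> S \<Longrightarrow> \<bar>f x\<bar> \<le> g x"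
  shows "\<bar>integral S f\<bar> \<le> integral S g"
  using integral_norm_bound_integral[OF assms(1,2)] assms(3) by simp

text \<open>Truncation makes the function bounded at a small cost in L_1. A bounded measurable
  function is an almost everywhere limit of continuous ones, which may be truncated at the same
  level, and dominated convergence on the bounded interval applies.\<close>

lemma continuous_dense_L1:
  fixes g :: "real \<Rightarrow> real"
  assumes g: "set_integrable lborel {a..b} g" and "0 < e"
  shows "\<exists>h. continuous_on UNIV h \<and> (\<lambda>u. \<bar>g u - h u\<bar>) integrable_on {a..b} \<and>
    integral {a..b} (\<lambda>u. \<bar>g u - h u\<bar>) < e"
proof -
  define f where "f u = indicator {a..b} u * g u" for u
  have f: "integrable lborel f" using g by (simp add: set_integrable_def f_def[abs_def])
  have [measurable]: "f \<in> borel_measurable borel" using f by auto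
  have "(\<lambda>n. \<integral>u. \<bar>f u - trunc (real n) (f u)\<bar> \<partial>lborel) \<longlonglongrightarrow> (\<integral>u. 0 \<partial>(lborel :: real measure))"
  proof (rule integral_dominated_convergence[where w="\<lambda>u. \<bar>f u\<bar>"])
    show "AE u in lborel. (\<lambda>n. \<bar>f u - trunc (real n) (f u)\<bar>) \<longlonglongrightarrow> 0"
    proof (rule AE_I2)
      fix u
      obtain N where "\<bar>f u\<bar> \<le> real N" using real_arch_simple by blast
      then show "(\<lambda>n. \<bar>f u - trunc (real n) (f u)\<bar>) \<longlonglongrightarrow> 0"
        by (intro tendsto_eventually eventually_sequentiallyI[of N]) (simp add: trunc_eq)
    qed
    show "AE u in lborel. norm \<bar>f u - trunc (real n) (f u)\<bar> \<le> \<bar>f u\<bar>" for n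
      by (rule AE_I2) (simp add: abs_diff_trunc_le)
    show "integrable lborel (\<lambda>u. \<bar>f u\<bar>)" using f by simp
  qed measurable
  then have "(\<lambda>n. \<integral>u. \<bar>f u - trunc (real n) (f u)\<bar> \<partial>lborel) \<longlonglongrightarrow> 0" by simp
  from order_tendstoD(2)[OF this, of "e / 2"] \<open>0 < e\<close>
  obtain N where N: "(\<integral>u. \<bar>f u - trunc (real N) (f u)\<bar> \<partial>lborel) < e / 2"
    by (auto simp: eventually_sequentially)
  define K where "K = real N"
  have K: "0 \<le> K" by (simp add: K_def)
  have "f \<in> borel_measurable lebesgue" using f by (simp add: measurable_completion)
  \<comment> \<open>This notion of measurability directly supplies continuous functions that
    converge to \<open>f\<close> off a negligible set.\<close>
  from lebesgue_measurable_imp_measurable_on[OF this, of UNIV]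
  obtain Z G where Z: "negligible Z" and G: "\<And>n. continuous_on UNIV (G n)"
    "\<And>x. x \<notin> Z \<Longrightarrow> (\<lambda>n. G n x) \<longlonglongrightarrow> f x"
    by (auto simp: measurable_on_def)
  let ?d = "\<lambda>n u. indicator {a..b} u * \<bar>trunc K (f u) - trunc K (G n u)\<bar>"
  have "AE x in lebesgue. x \<notin> Z" using Z by (intro AE_not_in) (simp add: negligible_iff_null_sets)
  then have ae: "AE x in lborel. x \<notin> Z" by (simp add: AE_completion_iff)
  have Gm [measurable]: "G n \<in> borel_measurable borel" for n
    using G(1) by (rule borel_measurable_continuous_onI)
  have I: "integrable lborel (\<lambda>u. indicator {a..b} u * (2 * K))"
    using integrable_real_indicator[of "{a..b}" lborel] by (simp add: emeasure_lborel_Icc_eq)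
  have "(\<lambda>n. \<integral>u. ?d n u \<partial>lborel) \<longlonglongrightarrow> (\<integral>u. 0 \<partial>(lborel :: real measure))"
  proof (rule integral_dominated_convergence[OF _ _ I])
    show "AE u in lborel. (\<lambda>n. ?d n u) \<longlonglongrightarrow> 0"
      using ae
    proof eventually_elim
      case (elim u)
      have "isCont (trunc K) (f u)"
        using trunc_continuous[OF continuous_on_id, of UNIV K] by (simp add: continuous_on_eq_continuous_at)
      from isCont_tendsto_compose[OF this G(2)[OF elim]]
      have "(\<lambda>n. ?d n u) \<longlonglongrightarrow>
          indicator {a..b} u * \<bar>trunc K (f u) - trunc K (f u)\<bar>"
        by (intro tendsto_intros)
      then show ?case by simp
    qed
    show "AE u in lborel. norm (?d n u)
        \<le> indicator {a..b} u * (2 * K)" for n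
    proof (rule AE_I2)
      fix u
      have "\<bar>trunc K (f u) - trunc K (G n u)\<bar> \<le> 2 * K"
        using abs_trunc[OF K, of "f u"] abs_trunc[OF K, of "G n u"] by linarith
      then show "norm (?d n u) \<le> indicator {a..b} u * (2 * K)"
        by (simp split: split_indicator)
    qed
  qed measurable
  then have "(\<lambda>n. \<integral>u. ?d n u \<partial>lborel) \<longlonglongrightarrow> 0" by simp
  from order_tendstoD(2)[OF this, of "e / 2"] \<open>0 < e\<close>
  obtain n where n: "(\<integral>u. ?d n u \<partial>lborel) < e / 2"
    by (auto simp: eventually_sequentially)
  define h where "h u = trunc K (G n u)" for u
  have [measurable]: "h \<in> borel_measurable borel" unfolding h_def by measurable
  have fK: "integrable lborel (\<lambda>u. \<bar>f u - trunc K (f u)\<bar>)"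
    by (rule Bochner_Integration.integrable_bound[OF f]) (use abs_diff_trunc_le[OF K] in auto)
  have fh: "integrable lborel (\<lambda>u. indicator {a..b} u * \<bar>trunc K (f u) - h u\<bar>)"
  proof (rule Bochner_Integration.integrable_bound[OF I])
    have "\<bar>trunc K (f u) - h u\<bar> \<le> 2 * K" for u
      using abs_trunc[OF K, of "f u"] abs_trunc[OF K, of "G n u"] by (simp add: h_def)
    then show "AE u in lborel. norm (indicator {a..b} u * \<bar>trunc K (f u) - h u\<bar>) \<le> norm (indicator {a..b} u * (2 * K))"
      using K by (intro AE_I2) (simp split: split_indicator)
  qed measurable
  have le: "indicator {a..b} u * \<bar>g u - h u\<bar> \<le> \<bar>f u - trunc K (f u)\<bar> + indicator {a..b} u * \<bar>trunc K (f u) - h u\<bar>" for u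
    by (cases "u \<in> {a..b}") (simp_all add: f_def)
  have gh: "integrable lborel (\<lambda>u. indicator {a..b} u * \<bar>g u - h u\<bar>)"
  proof (rule Bochner_Integration.integrable_bound[OF Bochner_Integration.integrable_add[OF fK fh]])
    have "(\<lambda>u. indicator {a..b} u * \<bar>g u - h u\<bar>) = (\<lambda>u. indicator {a..b} u * \<bar>f u - h u\<bar>)"
      by (auto simp: f_def split: split_indicator)
    then show "(\<lambda>u. indicator {a..b} u * \<bar>g u - h u\<bar>) \<in> borel_measurable lborel" by simp
    show "AE u in lborel. norm (indicator {a..b} u * \<bar>g u - h u\<bar>)
      \<le> norm (\<bar>f u - trunc K (f u)\<bar> + indicator {a..b} u * \<bar>trunc K (f u) - h u\<bar>)"
      using le by (intro AE_I2) (simp add: abs_mult)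
  qed
  have "(LBINT u:{a..b}. \<bar>g u - h u\<bar>) \<le>
      (\<integral>u. \<bar>f u - trunc K (f u)\<bar> + indicator {a..b} u * \<bar>trunc K (f u) - h u\<bar> \<partial>lborel)"
    unfolding set_lebesgue_integral_def real_scaleR_def
    by (rule integral_mono[OF gh Bochner_Integration.integrable_add[OF fK fh] le])
  also have "\<dots> = (\<integral>u. \<bar>f u - trunc K (f u)\<bar> \<partial>lborel) + (\<integral>u. indicator {a..b} u * \<bar>trunc K (f u) - h u\<bar> \<partial>lborel)"
    by (rule Bochner_Integration.integral_add[OF fK fh])
  also have "\<dots> < e" using N n by (simp add: K_def h_def)
  finally have "(LBINT u:{a..b}. \<bar>g u - h u\<bar>) < e" .
  moreover have "set_integrable lborel {a..b} (\<lambda>u. \<bar>g u - h u\<bar>)" using gh by (simp add: set_integrable_def)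
  moreover have "continuous_on UNIV h" unfolding h_def using G(1) by (rule trunc_continuous)
  ultimately show ?thesis using set_borel_integral_eq_integral[of "{a..b}" "\<lambda>u. \<bar>g u - h u\<bar>"] by auto
qed

lemma integral_partition_sum:
  fixes f :: "real \<Rightarrow> real"
  assumes p: "is_partition t n p" and f: "f integrable_on {0..t}" and "k \<le> n"
  shows "(\<Sum>i<k. integral {p i..p (Suc i)} f) = integral {0..p k} f"
  using \<open>k \<le> n\<close>
proof (induction k)
  case 0 then show ?case using p by (simp add: is_partition_def)
next
  case (Suc k)
  have b: "0 \<le> p k" "p k \<le> p (Suc k)" "p (Suc k) \<le> t"
    using partition_bounds[OF p, of k] partition_bounds[OF p, of "Suc k"] p Suc.prems
    by (auto simp: is_partition_def)
  have "f integrable_on {0..p (Suc k)}" by (rule integrable_on_subinterval[OF f]) (use b in auto)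
  from Henstock_Kurzweil_Integration.integral_combine[OF b(1,2) this] Suc show ?case by simp
qed

text \<open>
  For continuous \<open>g\<close> the increments of the primitive are asymptotically linear on the intervals,
  and linear increments cancel exactly; density of the continuous functions does the rest.
\<close>

lemma averaged_primitive:
  fixes g q :: "real \<Rightarrow> real"
  assumes g: "set_integrable lborel {0..b} g" and "0 \<le> b" "0 < e"
    and q: "\<And>s t. 0 \<le> s \<Longrightarrow> s \<le> t \<Longrightarrow> t \<le> b \<Longrightarrow> q t - q s = integral {s..t} g"
  shows "\<exists>\<delta>>0. \<forall>n p. is_partition b n p \<and> mesh_below \<delta> n p \<longrightarrow>
    (\<Sum>i<n. \<bar>2 * unit_average (\<lambda>u. q u - q (p i)) (p i) (p (Suc i)) - (q (p (Suc i)) - q (p i))\<bar>) \<le> e"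
proof -
  let ?F = "\<lambda>s t. \<bar>2 * unit_average (\<lambda>u. q u - q s) s t - (q t - q s)\<bar>"
  \<comment> \<open>Chosen so that 3 times (\<open>e / 6\<close> + \<open>\<eta> * b\<close>) is at
    most \<open>e\<close>; the added 1 keeps it defined for \<open>b = 0\<close>.\<close>
  define \<eta> where "\<eta> = e / (6 * (b + 1))"
  have \<eta>: "0 < \<eta>" using assms by (simp add: \<eta>_def)
  obtain h where h: "continuous_on UNIV h" "(\<lambda>u. \<bar>g u - h u\<bar>) integrable_on {0..b}"
    "integral {0..b} (\<lambda>u. \<bar>g u - h u\<bar>) < e / 6"
    using continuous_dense_L1[OF g, of "e / 6"] \<open>0 < e\<close> by auto
  let ?k = "\<lambda>u. \<bar>g u - h u\<bar> + \<eta>"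
  have gi: "g integrable_on {0..b}" using set_borel_integral_eq_integral[OF g] by simp
  have "uniformly_continuous_on {0..b} h"
    by (rule compact_uniformly_continuous) (use h continuous_on_subset in auto)
  then obtain \<delta> where \<delta>: "0 < \<delta>" "\<And>u v. u \<in> {0..b} \<Longrightarrow> v \<in> {0..b} \<Longrightarrow> dist u v < \<delta> \<Longrightarrow> dist (h u) (h v) < \<eta>"
    using \<eta> unfolding uniformly_continuous_on_def by blast
  have main: "?F s t
      \<le> 3 * integral {s..t} ?k"
    if st: "0 \<le> s" "s \<le> t" "t \<le> b" "t - s < \<delta>" for s t
  proof -
    \<comment> \<open>The deviation of \<open>q\<close> from the line of slope \<open>h s\<close>.
      Twice the average of the line equals its increment and cancels, so only \<open>E\<close> is
      left: twice through its average and once through its end value, which gives the constant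
      3.\<close>
    define E where "E u = q u - q s - h s * (u - s)" for u
    have sub: "f integrable_on {s..u}" if "f integrable_on {0..b}" "u \<le> t" for f :: "real \<Rightarrow> real" and u
      by (rule integrable_on_subinterval[OF that(1)]) (use st that in auto)
    have ki: "?k integrable_on {0..b}"
      using h(2) by (intro integrable_add integrable_const_ivl)
    have Eb: "\<bar>E u\<bar> \<le> integral {s..t} ?k" if u: "u \<in> {s..t}" for u
    proof -
      have gs: "g integrable_on {s..u}" using sub[OF gi] u by auto
      have "E u = integral {s..u} (\<lambda>v. g v - h s)"
        using q[of s u] st u integral_diff[OF gs integrable_const_ivl[of "h s"]] by (simp add: E_def)
      also have "\<bar>\<dots>\<bar> \<le> integral {s..u} ?k"
      proof (rule abs_integral_le_integral)
        show "(\<lambda>v. g v - h s) integrable_on {s..u}" using gs by (intro integrable_diff integrable_const_ivl)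
        show "?k integrable_on {s..u}" using sub[OF ki] u by auto
        fix v assume v: "v \<in> {s..u}"
        then have "dist (h v) (h s) < \<eta>" using u st by (intro \<delta>(2)) (auto simp: dist_real_def)
        then show "\<bar>g v - h s\<bar> \<le> \<bar>g v - h v\<bar> + \<eta>" by (auto simp: dist_real_def)
      qed
      also have "\<dots> \<le> integral {s..t} ?k"
        using u sub[OF ki] \<eta> by (intro integral_subset_le) auto
      finally show ?thesis .
    qed
    have qc: "continuous_on {s..t} q"
    proof -
      have "continuous_on {s..t} (\<lambda>u. q s + integral {s..u} g)"
        using sub[OF gi] by (intro continuous_intros indefinite_integral_continuous_1) auto
      moreover have "q s + integral {s..u} g = q u" if "u \<in> {s..t}" for u
        using q[of s u] st that by simp
      ultimately show ?thesis by (rule continuous_on_eq)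
    qed
    have Ec: "continuous_on {s..t} E" unfolding E_def using qc by (intro continuous_intros)
    have "unit_average (\<lambda>u. q u - q s) s t = unit_average (\<lambda>u. E u + h s * (u - s)) s t"
      by (simp add: E_def)
    also have "\<dots> = unit_average E s t + h s * ((t - s) / 2)"
      using st Ec by (subst unit_average_add) (auto intro!: continuous_intros simp: unit_average_cmult unit_average_affine)
    finally have "2 * unit_average (\<lambda>u. q u - q s) s t - (q t - q s) = 2 * unit_average E s t - E t"
      by (simp add: E_def)
    moreover have "\<bar>unit_average E s t\<bar> \<le> integral {s..t} ?k"
      using unit_average_bound[OF st(2) Ec Eb] by simp
    moreover have "\<bar>E t\<bar> \<le> integral {s..t} ?k" using Eb[of t] st by simp
    ultimately show ?thesis by linarith
  qed
  have "(\<Sum>i<n. ?F (p i) (p (Suc i))) \<le> e"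
    if p: "is_partition b n p" "mesh_below \<delta> n p" for n p
  proof -
    have ki: "?k integrable_on {0..b}"
      using h(2) by (intro integrable_add integrable_const_ivl)
    have "(\<Sum>i<n. ?F (p i) (p (Suc i)))
      \<le> (\<Sum>i<n. 3 * integral {p i..p (Suc i)} ?k)"
    proof (rule sum_mono)
      fix i assume i: "i \<in> {..<n}"
      show "?F (p i) (p (Suc i))
        \<le> 3 * integral {p i..p (Suc i)} ?k"
        using partition_bounds[OF p(1), of i] partition_bounds[OF p(1), of "Suc i"] p i
        by (intro main) (auto simp: is_partition_def)
    qed
    also have "\<dots> = 3 * integral {0..b} ?k"
      using integral_partition_sum[OF p(1) ki order_refl] p(1) by (simp add: sum_distrib_left[symmetric] is_partition_def)
    also have "integral {0..b} ?k = integral {0..b} (\<lambda>u. \<bar>g u - h u\<bar>) + \<eta> * b"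
      using integral_add[OF h(2) integrable_const_ivl[of \<eta>]] \<open>0 \<le> b\<close> by simp
    also have "\<eta> * b \<le> e / 6"
      using \<open>0 \<le> b\<close> \<open>0 < e\<close> by (simp add: \<eta>_def divide_simps algebra_simps)
    finally show ?thesis using h(3) by simp
  qed
  then show ?thesis using \<delta>(1) by blast
qed

text \<open>
  The weight \<open>c i\<close> may be off by up to \<open>1\<close> on the interval that is cut at \<open>b\<close>, which is contained in
  \<open>{b - \<delta>..b}\<close>.
\<close>

lemma weighted_increments:
  fixes g q wt :: "real \<Rightarrow> real" and c :: "nat \<Rightarrow> real"
  assumes p: "is_partition b n p" and "0 \<le> \<delta>" "\<delta> \<le> b" "0 \<le> \<eta>"
    and g: "g integrable_on {0..b}" "(\<lambda>u. wt u * g u) integrable_on {0..b}" "\<And>u. u \<in> {0..b} \<Longrightarrow> 0 \<le> g u"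
    and q: "\<And>s t. 0 \<le> s \<Longrightarrow> s \<le> t \<Longrightarrow> t \<le> b \<Longrightarrow> q t - q s = integral {s..t} g"
    and c: "\<And>i u. i < n \<Longrightarrow> u \<in> {p i..p (Suc i)} \<Longrightarrow> \<bar>c i - wt u\<bar> \<le> \<eta> + (if b - \<delta> \<le> u then 1 else 0)"
  shows "\<bar>(\<Sum>i<n. c i * (q (p (Suc i)) - q (p i))) - integral {0..b} (\<lambda>u. wt u * g u)\<bar>
    \<le> \<eta> * (q b - q 0) + (q b - q (b - \<delta>))"
proof -
  \<comment> \<open>A majorant of \<open>\<bar>c i - wt u\<bar> * g u\<close> on each interval that
    no longer depends on \<open>i\<close>, so the errors add up to a single integral.\<close>
  define k where "k u = \<eta> * g u + (if u \<in> {b - \<delta>..b} then g u else 0)" for u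
  have b: "0 \<le> b" using \<open>0 \<le> \<delta>\<close> \<open>\<delta> \<le> b\<close> by linarith
  have g2: "g integrable_on {b - \<delta>..b}" by (rule integrable_on_subinterval[OF g(1)]) (use \<open>0 \<le> \<delta>\<close> \<open>\<delta> \<le> b\<close> in auto)
  have r: "(\<lambda>u. if u \<in> {b - \<delta>..b} then g u else 0) integrable_on {0..b}"
    using g2 \<open>0 \<le> \<delta>\<close> \<open>\<delta> \<le> b\<close> by (subst integrable_restrict_Int) (simp add: Int_absorb1)
  have ri: "integral {0..b} (\<lambda>u. if u \<in> {b - \<delta>..b} then g u else 0) = integral {b - \<delta>..b} g"
    using \<open>0 \<le> \<delta>\<close> \<open>\<delta> \<le> b\<close> by (subst integral_restrict_Int) (simp add: Int_absorb1)
  have k: "k integrable_on {0..b}"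
    unfolding k_def using integrable_on_cmult_left[OF g(1), of \<eta>] r by (intro integrable_add) simp_all
  have kI: "integral {0..b} k = \<eta> * (q b - q 0) + (q b - q (b - \<delta>))"
  proof -
    have "integral {0..b} k = integral {0..b} (\<lambda>u. \<eta> * g u) + integral {b - \<delta>..b} g"
      unfolding k_def using integral_add[OF integrable_on_cmult_left[OF g(1), of \<eta>] r] ri by simp
    then show ?thesis using q[of 0 b] q[of "b - \<delta>" b] \<open>0 \<le> \<delta>\<close> \<open>\<delta> \<le> b\<close> by simp
  qed
  have bd: "0 \<le> p i" "p i \<le> p (Suc i)" "p (Suc i) \<le> b" if "i < n" for i
    using partition_bounds[OF p, of i] partition_bounds[OF p, of "Suc i"] p that by (auto simp: is_partition_def)
  have sub: "f integrable_on {p i..p (Suc i)}" if "f integrable_on {0..b}" "i < n" for f :: "real \<Rightarrow> real" and i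
    by (rule integrable_on_subinterval[OF that(1)]) (use bd[OF that(2)] in auto)
  have "(\<Sum>i<n. c i * (q (p (Suc i)) - q (p i))) - integral {0..b} (\<lambda>u. wt u * g u)
      = (\<Sum>i<n. c i * (q (p (Suc i)) - q (p i)) - integral {p i..p (Suc i)} (\<lambda>u. wt u * g u))"
    using integral_partition_sum[OF p g(2) order_refl] p by (simp add: sum_subtractf is_partition_def)
  also have "\<bar>\<dots>\<bar> \<le> (\<Sum>i<n. integral {p i..p (Suc i)} k)"
  proof (rule order_trans[OF sum_abs sum_mono])
    fix i assume "i \<in> {..<n}"
    then have i: "i < n" by simp
    have cg: "(\<lambda>u. c i * g u) integrable_on {p i..p (Suc i)}"
      using integrable_on_cmult_left[OF sub[OF g(1) i], of "c i"] by simp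
    have "c i * (q (p (Suc i)) - q (p i)) - integral {p i..p (Suc i)} (\<lambda>u. wt u * g u)
        = integral {p i..p (Suc i)} (\<lambda>u. c i * g u - wt u * g u)"
      using integral_diff[OF cg sub[OF g(2) i]] q[OF bd[OF i]] by simp
    also have "\<bar>\<dots>\<bar> \<le> integral {p i..p (Suc i)} k"
    proof (rule abs_integral_le_integral)
      fix u assume u: "u \<in> {p i..p (Suc i)}"
      then have ub: "u \<in> {0..b}" using bd[OF i] by auto
      have "\<bar>c i * g u - wt u * g u\<bar> = \<bar>c i - wt u\<bar> * g u"
        using g(3)[OF ub] by (simp add: left_diff_distrib[symmetric] abs_mult)
      also have "\<dots> \<le> (\<eta> + (if b - \<delta> \<le> u then 1 else 0)) * g u"
        using c[OF i u] g(3)[OF ub] by (rule mult_right_mono)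
      also have "\<dots> = k u" using ub by (auto simp: k_def algebra_simps)
      finally show "\<bar>c i * g u - wt u * g u\<bar> \<le> k u" .
    qed (use integrable_diff[OF cg sub[OF g(2) i]] sub[OF k i] in auto)
    finally show "\<bar>c i * (q (p (Suc i)) - q (p i)) - integral {p i..p (Suc i)} (\<lambda>u. wt u * g u)\<bar>
      \<le> integral {p i..p (Suc i)} k" .
  qed
  also have "\<dots> = integral {0..b} k"
    using integral_partition_sum[OF p k order_refl] p by (simp add: is_partition_def)
  finally show ?thesis using kI by simp
qed

subsection \<open>The nets and the error along them\<close>

text \<open>With f x = T - T (1 - x) powr (1 / \<theta>), this is \<theta> / T times the derivative
  of f at the point x where f x = \<open>u\<close>, for x < 1.\<close>

definition weight :: "real \<Rightarrow> real \<Rightarrow> real \<Rightarrow> real" where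
  "weight T \<theta> u = ((T - u) / T) powr (1 - \<theta>)"

lemma weight_bounds:
  assumes "0 < T" "\<theta> \<le> 1" "0 \<le> u" "u \<le> T"
  shows "0 \<le> weight T \<theta> u" "weight T \<theta> u \<le> 1"
  unfolding weight_def using assms by (auto intro!: powr_le1)

lemma weight_continuous: "0 < T \<Longrightarrow> b < T \<Longrightarrow> continuous_on {0..b} (weight T \<theta>)"
  unfolding weight_def by (intro continuous_intros) auto

lemma weight_measurable [measurable]: "weight T \<theta> \<in> borel_measurable borel"
  unfolding weight_def by measurable

lemma theta_net_0: "0 < n \<Longrightarrow> theta_net T \<theta> n 0 = 0"
  by (simp add: theta_net_def)

lemma theta_net_n: "0 < n \<Longrightarrow> theta_net T \<theta> n n = T"
  by (simp add: theta_net_def)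

text \<open>The mean value theorem for the function \<open>f\<close> that maps the uniform grid to
  the net; \<open>\<xi>\<close> is its value at the intermediate point. The derivative becomes a
  function of that value because (1 - x) powr (1 / \<theta> - 1) is the power 1 - \<theta> of (1 -
  x) powr (1 / \<theta>).\<close>

lemma theta_net_step:
  assumes T: "0 < T" and \<theta>: "0 < \<theta>" "\<theta> \<le> 1" and i: "i < n"
  shows "\<exists>\<xi>. theta_net T \<theta> n i \<le> \<xi> \<and> \<xi> \<le> theta_net T \<theta> n (Suc i) \<and> 0 \<le> \<xi> \<and> \<xi> \<le> T \<and>
    \<theta> * real n * (theta_net T \<theta> n (Suc i) - theta_net T \<theta> n i) / T = weight T \<theta> \<xi>"
proof -
  define f where "f x = T - T * (1 - x) powr (1 / \<theta>)" for x
  define a where "a = real i / real n"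
  define b where "b = real (Suc i) / real n"
  have n: "0 < real n" using i by simp
  have ab: "a < b" "0 \<le> a" "b \<le> 1" using i n by (auto simp: a_def b_def divide_strict_right_mono)
  have anti: "f x \<le> f y" if "x \<le> y" "y \<le> 1" for x y
    using that T \<theta> by (simp add: f_def powr_mono2)
  have "continuous_on {a..b} f"
    unfolding f_def using ab \<theta> by (intro continuous_intros continuous_on_powr') auto
  moreover have "(f has_derivative (\<lambda>h. T / \<theta> * (1 - x) powr (1 / \<theta> - 1) * h)) (at x)"
    if "a < x" "x < b" for x
  proof -
    have "(f has_real_derivative T / \<theta> * (1 - x) powr (1 / \<theta> - 1)) (at x)"
      unfolding f_def using that ab by (auto intro!: derivative_eq_intros simp: field_simps)
    then show ?thesis unfolding has_field_derivative_def .
  qed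
  ultimately obtain x where x: "a < x" "x < b" "f b - f a = T / \<theta> * (1 - x) powr (1 / \<theta> - 1) * (b - a)"
    using mvt[OF ab(1), of f "\<lambda>x h. T / \<theta> * (1 - x) powr (1 / \<theta> - 1) * h"] by auto
  have net: "theta_net T \<theta> n i = f a" "theta_net T \<theta> n (Suc i) = f b"
    by (simp_all add: theta_net_def f_def a_def b_def)
  have "b - a = 1 / real n" using n by (simp add: a_def b_def divide_simps)
  then have "\<theta> * real n * (f b - f a) / T = (1 - x) powr (1 / \<theta> - 1)"
    using x(3) n T \<theta> by simp
  also have "\<dots> = ((1 - x) powr (1 / \<theta>)) powr (1 - \<theta>)"
    using \<theta> by (simp add: powr_powr field_simps)
  also have "\<dots> = weight T \<theta> (f x)" using T by (simp add: weight_def f_def)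
  finally have "\<theta> * real n * (f b - f a) / T = weight T \<theta> (f x)" .
  moreover have "f a \<le> f x" "f x \<le> f b" using anti x ab by auto
  moreover have "0 \<le> f x" using anti[of 0 x] x ab by (simp add: f_def)
  moreover have "f x \<le> T" using T by (simp add: f_def)
  ultimately show ?thesis unfolding net by blast
qed

locale theta_setting = bracketed_martingale +
  fixes \<theta> b :: real
  assumes theta: "0 < \<theta>" "\<theta> \<le> 1" and b: "0 \<le> b" "b < T"
begin

abbreviation tau :: "nat \<Rightarrow> nat \<Rightarrow> real" where "tau \<equiv> theta_net T \<theta>"

definition pt :: "nat \<Rightarrow> nat \<Rightarrow> real" where
  "pt n i = min (tau n i) b"

text \<open>The prefactor 2 \<theta> n / T of the error is split: this part goes with the interval
  length, and the factor 2 stays with the average over the interval.\<close>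

definition net_weight :: "nat \<Rightarrow> nat \<Rightarrow> real" where
  "net_weight n i = \<theta> * real n * (pt n (Suc i) - pt n i) / T"

lemma theta_net_mono: "i < n \<Longrightarrow> tau n i \<le> tau n (Suc i)"
  using theta_net_step[OF T_pos theta] by (meson order_trans)

lemma theta_net_mono': "i \<le> j \<Longrightarrow> j \<le> n \<Longrightarrow> tau n i \<le> tau n j"
proof (induction j rule: dec_induct)
  case (step j)
  then show ?case using theta_net_mono[of j n] by simp
qed simp

text \<open>Since \<theta> \<le> 1, the weight in \<open>theta_net_step\<close> is at most
  1.\<close>

lemma theta_net_mesh:
  assumes "i < n"
  shows "tau n (Suc i) - tau n i \<le> T / (\<theta> * real n)"
proof -
  obtain \<xi> where \<xi>: "0 \<le> \<xi>" "\<xi> \<le> T"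
    "\<theta> * real n * (tau n (Suc i) - tau n i) / T = weight T \<theta> \<xi>"
    using theta_net_step[OF T_pos theta assms] by blast
  then have "\<theta> * real n * (tau n (Suc i) - tau n i) / T \<le> 1"
    using weight_bounds[OF T_pos theta(2)] by simp
  then show ?thesis using T_pos theta assms by (simp add: field_simps)
qed

lemma pt_mono: "i < n \<Longrightarrow> pt n i \<le> pt n (Suc i)"
  using theta_net_mono[of i n] by (auto simp: pt_def)

lemma pt_partition:
  assumes "0 < n" shows "is_partition b n (pt n)"
proof -
  have "pt n 0 = 0" "pt n n = b" using assms b by (simp_all add: pt_def theta_net_0 theta_net_n)
  then show ?thesis using pt_mono by (simp add: is_partition_def)
qed

lemma pt_increment: "i < n \<Longrightarrow> pt n (Suc i) - pt n i \<le> tau n (Suc i) - tau n i"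
  using theta_net_mono[of i n] by (auto simp: pt_def)

lemma pt_mesh: "i < n \<Longrightarrow> pt n (Suc i) - pt n i \<le> T / (\<theta> * real n)"
  using pt_increment[of i n] theta_net_mesh[of i n] by simp

lemma pt_bounds:
  assumes "i \<le> n" "0 < n"
  shows "0 \<le> pt n i" "pt n i \<le> b"
  using theta_net_mono'[of 0 i n] theta_net_0[of n T \<theta>] b assms by (auto simp: pt_def)

lemma net_weight_bounds: "i < n \<Longrightarrow> net_weight n i \<in> {0..1}"
proof -
  assume i: "i < n"
  have "net_weight n i \<le> \<theta> * real n * (T / (\<theta> * real n)) / T"
    unfolding net_weight_def using pt_mesh[OF i] T_pos theta by (intro divide_right_mono mult_left_mono) auto
  also have "\<dots> = 1" using T_pos theta i by simp
  finally show ?thesis unfolding net_weight_def using pt_mono[OF i] T_pos theta by simp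
qed

lemma mesh_tends_to_zero:
  assumes "0 < \<delta>"
  shows "\<forall>\<^sub>F n in sequentially. 0 < n \<and> T / (\<theta> * real n) < \<delta>"
proof -
  obtain N where N: "T / (\<theta> * \<delta>) < real N" using reals_Archimedean2 by blast
  have "0 < n \<and> T / (\<theta> * real n) < \<delta>" if "Suc N \<le> n" for n
  proof -
    have "T / (\<theta> * \<delta>) < real n" using N that by simp
    then show ?thesis using assms theta that by (simp add: field_simps)
  qed
  then show ?thesis unfolding eventually_sequentially by blast
qed

text \<open>If \<open>u\<close> is below \<open>b - \<delta>\<close>, its interval ends before
  \<open>b\<close> and is not cut, so \<open>net_weight n i\<close> is a value of
  \<open>weight\<close> at a point within \<open>\<delta>\<close> of \<open>u\<close>. Near
  \<open>b\<close> only the trivial bound 1 is available. The minimum with \<open>b\<close> keeps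
  the threshold nonnegative.\<close>

lemma net_weight_close_to_weight:
  assumes "0 < n" and i: "i < n" and u: "u \<in> {pt n i..pt n (Suc i)}"
    and \<delta>: "0 < \<delta>" "T / (\<theta> * real n) < \<delta>" and "0 \<le> \<eta>"
    and unif: "\<And>u v. u \<in> {0..b} \<Longrightarrow> v \<in> {0..b} \<Longrightarrow> \<bar>u - v\<bar> < \<delta> \<Longrightarrow> \<bar>weight T \<theta> u - weight T \<theta> v\<bar> \<le> \<eta>"
  shows "\<bar>net_weight n i - weight T \<theta> u\<bar> \<le> \<eta> + (if b - min \<delta> b \<le> u then 1 else 0)"
proof -
  have ub: "u \<in> {0..b}" using u pt_bounds[of i n] pt_bounds[of "Suc i" n] i by auto
  show ?thesis
  proof (cases "b - min \<delta> b \<le> u")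
    case True
    have "0 \<le> weight T \<theta> u" "weight T \<theta> u \<le> 1" using weight_bounds[OF T_pos theta(2)] ub b by auto
    then show ?thesis using net_weight_bounds[OF i] True \<open>0 \<le> \<eta>\<close> by auto
  next
    case False
    obtain \<xi> where \<xi>: "tau n i \<le> \<xi>" "\<xi> \<le> tau n (Suc i)" "0 \<le> \<xi>"
      "\<theta> * real n * (tau n (Suc i) - tau n i) / T = weight T \<theta> \<xi>"
      using theta_net_step[OF T_pos theta i] by blast
    have lt: "u < b - \<delta>" using False ub by (auto simp: min_def split: if_splits)
    then have "pt n i < b - \<delta>" using u by auto
    then have 1: "pt n i = tau n i" "tau n i < b - \<delta>" using \<delta> by (auto simp: pt_def)
    then have 2: "tau n (Suc i) < b" using theta_net_mesh[OF i] \<delta> by linarith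
    then have 3: "pt n (Suc i) = tau n (Suc i)" by (simp add: pt_def)
    have "\<bar>\<xi> - u\<bar> < \<delta>" using \<xi> u 1 3 theta_net_mesh[OF i] \<delta> by auto
    then have "\<bar>weight T \<theta> \<xi> - weight T \<theta> u\<bar> \<le> \<eta>" using \<xi> 2 ub by (intro unif) auto
    moreover have "net_weight n i = weight T \<theta> \<xi>" using \<xi>(4) 1 3 by (simp add: net_weight_def)
    ultimately show ?thesis by simp
  qed
qed

abbreviation mean_Q :: "nat \<Rightarrow> nat \<Rightarrow> 'a \<Rightarrow> real" where
  "mean_Q n i w \<equiv> unit_average (\<lambda>u. Q u w - Q (pt n i) w) (pt n i) (pt n (Suc i))"

abbreviation mean_square :: "nat \<Rightarrow> nat \<Rightarrow> 'a \<Rightarrow> real" where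
  "mean_square n i w \<equiv> unit_average (\<lambda>u. (L u w - L (pt n i) w)\<^sup>2) (pt n i) (pt n (Suc i))"

text \<open>On the half-open interval from \<open>pt n i\<close> to \<open>pt n (Suc i)\<close>
  exactly one indicator is active, and its net value is taken at \<open>pt n i\<close>: if that
  interval is nonempty, its left end has not been cut. The intervals are added one at a time; the
  time 0 lies in none of them but is a null set.\<close>

lemma net_error_partition:
  assumes w: "w \<in> space P" and n: "0 < n"
  shows "net_error L n (tau n) b w =
    (\<Sum>i<n. (pt n (Suc i) - pt n i) * mean_square n i w)"
proof -
  define f where "f u = \<bar>L u w - (\<Sum>i=1..n. L (tau n (i - 1)) w * indicator {tau n (i - 1)<..tau n i} u)\<bar>\<^sup>2" for u
  have f: "f u = (L u w - L (pt n i) w)\<^sup>2" if i: "i < n" and u: "u \<in> {pt n i<..pt n (Suc i)}" for i u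
  proof -
    have ti: "tau n i < u" "u \<le> tau n (Suc i)" "pt n i = tau n i"
      using u by (auto simp: pt_def min_def split: if_splits)
    have "(\<Sum>j=1..n. L (tau n (j - 1)) w * indicator {tau n (j - 1)<..tau n j} u)
        = (\<Sum>j=1..n. if j = Suc i then L (tau n i) w else 0)"
    proof (rule sum.cong)
      fix j assume j: "j \<in> {1..n}"
      consider "j = Suc i" | "j \<le> i" | "Suc i \<le> j - 1" using j by fastforce
      then show "L (tau n (j - 1)) w * indicator {tau n (j - 1)<..tau n j} u = (if j = Suc i then L (tau n i) w else 0)"
      proof cases
        case 1 then show ?thesis using ti by simp
      next
        case 2
        then show ?thesis using ti theta_net_mono'[of j i n] i by simp
      next
        case 3
        moreover have "j - 1 \<le> n" using j by auto
        ultimately have "tau n (Suc i) \<le> tau n (j - 1)" by (rule theta_net_mono')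
        then show ?thesis using 3 ti by simp
      qed
    qed simp
    also have "\<dots> = L (tau n i) w" using i by simp
    finally show ?thesis by (simp add: f_def ti(3))
  qed
  have "set_integrable lborel {0..pt n k} f \<and> (LBINT u:{0..pt n k}. f u) =
    (\<Sum>i<k. (pt n (Suc i) - pt n i) * mean_square n i w)"
    if "k \<le> n" for k
    using that
  proof (induction k)
    case 0
    have "pt n 0 = 0" using b n by (simp add: pt_def theta_net_0)
    moreover have "set_integrable lborel {0..0} f"
    proof -
      have "(\<lambda>u. indicator {0..0} u *\<^sub>R f u) = (\<lambda>u. indicator {0} u * f 0)"
        by (auto simp: indicator_def)
      then show ?thesis by (simp add: set_integrable_def)
    qed
    ultimately show ?case using integral_eq_unit_average[of 0 0 f] by simp
  next
    case (Suc k)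
    let ?s = "pt n k" and ?t = "pt n (Suc k)"
    let ?g = "\<lambda>u. (L u w - L ?s w)\<^sup>2"
    have k: "k < n" and st: "0 \<le> ?s" "?s \<le> ?t" "?t \<le> b"
      using Suc.prems pt_bounds[of k n] pt_bounds[of "Suc k" n] pt_mono[of k n] n by auto
    have "continuous_on {?s..?t} ?g"
      by (intro continuous_intros continuous_on_subset[OF L_continuous_on[of b w]]) (use st b w in auto)
    then have gi: "set_integrable lborel {?s..?t} ?g" by (rule borel_integrable_atLeastAtMost')
    then have gi': "set_integrable lborel {?s<..?t} ?g" by (rule set_integrable_subset) auto
    have fi: "set_integrable lborel {?s<..?t} f"
      by (rule iffD2[OF set_integrable_cong[OF refl refl f[OF k]] gi'])
    have "(LBINT u:{?s<..?t}. f u) = (LBINT u:{?s<..?t}. ?g u)"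
      by (rule set_lebesgue_integral_cong) (use f[OF k] in auto)
    also have "\<dots> = (LBINT u:{?s..?t}. ?g u)"
      using interval_integral_Ioc[OF st(2), of ?g] interval_integral_Icc[OF st(2), of ?g] by simp
    also have "\<dots> = (?t - ?s) * unit_average ?g ?s ?t" by (rule integral_eq_unit_average[OF st(2)])
    finally have I: "(LBINT u:{?s<..?t}. f u) = (?t - ?s) * unit_average ?g ?s ?t" .
    have IH: "set_integrable lborel {0..?s} f" "(LBINT u:{0..?s}. f u) =
      (\<Sum>i<k. (pt n (Suc i) - pt n i) * mean_square n i w)"
      using Suc by auto
    have un: "{0..?t} = {0..?s} \<union> {?s<..?t}" using st by auto
    have "{0..?s} \<inter> {?s<..?t} = {}" by auto
    then show ?case unfolding un
      using set_integrable_Un[OF IH(1) fi] set_integral_Un[OF _ IH(1) fi] I IH(2) by simp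
  qed
  from this[of n] show ?thesis using pt_partition[OF n] by (simp add: net_error_def f_def is_partition_def)
qed

section \<open>The limit, and convergence to it along the paths of the bracket\<close>

definition weighted_bracket :: "'a \<Rightarrow> real" where
  "weighted_bracket w = (LBINT u:{0..b}. weight T \<theta> u * D u w)"

lemma weighted_integrable:
  assumes "w \<in> space P"
  shows "set_integrable lborel {0..b} (\<lambda>u. weight T \<theta> u * D u w)"
proof -
  have "integrable lborel (\<lambda>u. (indicator {0..b} u * weight T \<theta> u) * (indicator {0..b} u * D u w))"
  proof (rule integrable_bounded_mult[where B=1])
    show "integrable lborel (\<lambda>u. indicator {0..b} u * D u w)"
      using D_integrable[of b w] assms b by (simp add: set_integrable_def)
    show "\<bar>indicator {0..b} u * weight T \<theta> u\<bar> \<le> 1" for u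
      using weight_bounds[OF T_pos theta(2), of u] b by (auto simp: indicator_def)
  qed measurable
  moreover have "(\<lambda>u. (indicator {0..b} u * weight T \<theta> u) * (indicator {0..b} u * D u w))
    = (\<lambda>u. indicator {0..b} u * (weight T \<theta> u * D u w))" by (auto simp: indicator_def)
  ultimately show ?thesis by (simp add: set_integrable_def)
qed

lemma weighted_bracket_integral:
  assumes "w \<in> space P"
  shows "weighted_bracket w = integral {0..b} (\<lambda>u. weight T \<theta> u * D u w)"
    "(\<lambda>u. weight T \<theta> u * D u w) integrable_on {0..b}"
  using set_borel_integral_eq_integral[OF weighted_integrable[OF assms]] by (auto simp: weighted_bracket_def)

lemma weighted_bracket_bounds:
  assumes "w \<in> space P"
  shows "0 \<le> weighted_bracket w" "weighted_bracket w \<le> Q b w"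
proof -
  have D: "0 \<le> D u w" if "u \<in> {0..b}" for u using that b assms by (intro D_nonneg) auto
  have wt: "0 \<le> weight T \<theta> u" "weight T \<theta> u \<le> 1" if "u \<in> {0..b}" for u
    using weight_bounds[OF T_pos theta(2), of u] that b by auto
  note wi = weighted_bracket_integral[OF assms]
  show "0 \<le> weighted_bracket w" unfolding wi(1)
    by (rule Henstock_Kurzweil_Integration.integral_nonneg[OF wi(2)]) (simp add: D wt)
  have Qi: "Q b w = integral {0..b} (\<lambda>u. D u w)" "(\<lambda>u. D u w) integrable_on {0..b}"
    using Q_eq_integral[of b w] assms b by auto
  show "weighted_bracket w \<le> Q b w" unfolding wi(1) Qi(1)
    using D wt by (intro integral_le[OF wi(2) Qi(2)] mult_left_le_one_le) auto
qed

text \<open>Progressive measurability at time \<open>b\<close> gives joint measurability with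
  respect to \<open>F b\<close> on \<open>{0..b}\<close> only. The integral is therefore taken over
  the restricted Lebesgue measure, where measurability of integrals with a parameter
  applies.\<close>

lemma weighted_bracket_measurable: "weighted_bracket \<in> borel_measurable (F b)"
proof -
  let ?N = "restrict_space lborel {0..b}"
  have sN: "sigma_finite_measure ?N"
    by (rule sigma_finite_measure_restrict_space[OF sigma_finite_lborel]) simp
  have "(\<lambda>z. D (fst z) (snd z)) \<in> borel_measurable (restrict_space borel {0..b} \<Otimes>\<^sub>M F b)"
    using D_progressive b by (simp add: progressively_measurable_def case_prod_beta')
  moreover have "sets (restrict_space borel {0..b}) = sets ?N"
    by (intro sets_restrict_space_cong) simp
  ultimately have "(\<lambda>z. D (fst z) (snd z)) \<in> borel_measurable (?N \<Otimes>\<^sub>M F b)"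
    by (simp cong: measurable_cong_sets sets_pair_measure_cong)
  from measurable_compose[OF measurable_pair_swap' this]
  have D: "(\<lambda>z. D (snd z) (fst z)) \<in> borel_measurable (F b \<Otimes>\<^sub>M ?N)"
    by (simp add: case_prod_beta comp_def)
  have "weight T \<theta> \<in> borel_measurable ?N" by (rule measurable_restrict_space1) simp
  then have W: "(\<lambda>z. weight T \<theta> (snd z)) \<in> borel_measurable (F b \<Otimes>\<^sub>M ?N)"
    by (rule measurable_compose[OF measurable_snd])
  have "(\<lambda>w. \<integral>u. weight T \<theta> u * D u w \<partial>?N) \<in> borel_measurable (F b)"
    by (rule sigma_finite_measure.borel_measurable_lebesgue_integral[OF sN])
      (use borel_measurable_times[OF W D] in \<open>simp add: case_prod_beta\<close>)
  moreover have "(\<lambda>w. \<integral>u. weight T \<theta> u * D u w \<partial>?N) = weighted_bracket"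
    unfolding weighted_bracket_def set_lebesgue_integral_def
    by (intro ext integral_restrict_space) simp
  ultimately show ?thesis by simp
qed

text \<open>What is left of the scaled error when squared increments of \<open>L\<close> are
  replaced by increments of \<open>Q\<close>.\<close>

definition mean_bracket :: "nat \<Rightarrow> 'a \<Rightarrow> real" where
  "mean_bracket n w = (\<Sum>i<n. net_weight n i * (2 * mean_Q n i w))"

text \<open>Uniform continuity of \<open>weight\<close> controls the uncut intervals, and continuity
  of the bracket at \<open>b\<close> pays for the one that is cut.\<close>

lemma net_weight_sum_close:
  assumes w: "w \<in> space P" and "0 < e"
  shows "\<forall>\<^sub>F n in sequentially. \<bar>(\<Sum>i<n. net_weight n i * (Q (pt n (Suc i)) w - Q (pt n i) w)) - weighted_bracket w\<bar> < e"
proof -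
  have Q0: "0 \<le> Q b w" using Q_nonneg b w by auto
  define \<eta> where "\<eta> = e / (2 * (Q b w + 1))"
  have \<eta>: "0 < \<eta>" using \<open>0 < e\<close> Q0 by (simp add: \<eta>_def)
  have "uniformly_continuous_on {0..b} (weight T \<theta>)"
    using weight_continuous[OF T_pos b(2)] by (intro compact_uniformly_continuous) auto
  then obtain \<delta>1 where \<delta>1: "0 < \<delta>1" "\<And>u v. u \<in> {0..b} \<Longrightarrow> v \<in> {0..b} \<Longrightarrow> dist u v < \<delta>1 \<Longrightarrow>
      dist (weight T \<theta> u) (weight T \<theta> v) < \<eta>"
    using \<eta> unfolding uniformly_continuous_on_def by blast
  have "continuous_on {0..b} (\<lambda>u. Q u w)" using Q_continuous b w by auto
  then obtain \<delta>2 where \<delta>2: "0 < \<delta>2" "\<And>v. v \<in> {0..b} \<Longrightarrow> dist v b < \<delta>2 \<Longrightarrow> dist (Q v w) (Q b w) < e / 2"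
    using b \<open>0 < e\<close> unfolding continuous_on_iff by (metis atLeastAtMost_iff half_gt_zero order_refl)
  \<comment> \<open>Halving \<open>\<delta>2\<close> makes the point at distance
    \<open>min \<delta> b\<close> from \<open>b\<close> strictly closer than
    \<open>\<delta>2\<close>.\<close>
  define \<delta> where "\<delta> = min \<delta>1 (\<delta>2 / 2)"
  have \<delta>: "0 < \<delta>" "\<delta> \<le> \<delta>1" "\<delta> < \<delta>2" using \<delta>1 \<delta>2 by (auto simp: \<delta>_def)
  have "\<bar>(\<Sum>i<n. net_weight n i * (Q (pt n (Suc i)) w - Q (pt n i) w)) - weighted_bracket w\<bar> < e"
    if n: "0 < n" "T / (\<theta> * real n) < \<delta>" for n
  proof -
    have "\<bar>(\<Sum>i<n. net_weight n i * (Q (pt n (Suc i)) w - Q (pt n i) w)) - weighted_bracket w\<bar>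
      \<le> \<eta> * (Q b w - Q 0 w) + (Q b w - Q (b - min \<delta> b) w)"
      unfolding weighted_bracket_integral(1)[OF w]
    proof (rule weighted_increments[OF pt_partition[OF n(1)]])
      show "(\<lambda>u. D u w) integrable_on {0..b}" using Q_eq_integral[of b w] b w by auto
      show "(\<lambda>u. weight T \<theta> u * D u w) integrable_on {0..b}" by (rule weighted_bracket_integral(2)[OF w])
      show "0 \<le> D u w" if "u \<in> {0..b}" for u using that b w by (intro D_nonneg) auto
      show "Q t w - Q s w = integral {s..t} (\<lambda>u. D u w)" if "0 \<le> s" "s \<le> t" "t \<le> b" for s t
        using that b w by (intro Q_diff) auto
      show "\<bar>net_weight n i - weight T \<theta> u\<bar> \<le> \<eta> + (if b - min \<delta> b \<le> u then 1 else 0)"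
        if "i < n" "u \<in> {pt n i..pt n (Suc i)}" for i u
      proof (rule net_weight_close_to_weight[OF n(1) that \<delta>(1) n(2)])
        fix u v assume "u \<in> {0..b}" "v \<in> {0..b}" "\<bar>u - v\<bar> < \<delta>"
        then show "\<bar>weight T \<theta> u - weight T \<theta> v\<bar> \<le> \<eta>"
          using \<delta>1(2)[of u v] \<delta> by (simp add: dist_real_def)
      qed (use \<eta> in simp)
    qed (use \<delta> \<eta> b in auto)
    also have "\<eta> * (Q b w - Q 0 w) \<le> e / 2"
      using Q0 Q_zero[OF w] \<open>0 < e\<close> by (simp add: \<eta>_def field_simps)
    also have "Q b w - Q (b - min \<delta> b) w < e / 2"
    proof -
      have "min \<delta> b < \<delta>2" using \<delta> by linarith
      then have "dist (Q (b - min \<delta> b) w) (Q b w) < e / 2" using \<delta> b by (intro \<delta>2(2)) (auto simp: dist_real_def)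
      then show ?thesis unfolding dist_real_def by linarith
    qed
    finally show ?thesis by simp
  qed
  then show ?thesis using mesh_tends_to_zero[OF \<delta>(1)] by (auto elim!: eventually_mono)
qed

text \<open>By \<open>averaged_primitive\<close> twice an average may be replaced by the increment.
  The errors are summable over the intervals independently of the weights, which are at most 1, and
  a Riemann-type sum with these weights remains.\<close>

lemma mean_bracket_limit:
  assumes w: "w \<in> space P"
  shows "(\<lambda>n. mean_bracket n w) \<longlonglongrightarrow> weighted_bracket w"
proof (rule LIMSEQ_I)
  fix e :: real assume e: "0 < e"
  then have e2: "0 < e / 2" by simp
  have "set_integrable lborel {0..b} (\<lambda>u. D u w)" using D_integrable b w by auto
  moreover have "Q t w - Q s w = integral {s..t} (\<lambda>u. D u w)" if "0 \<le> s" "s \<le> t" "t \<le> b" for s t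
    using that b w by (intro Q_diff) auto
  ultimately obtain \<delta> where \<delta>: "0 < \<delta>" "\<And>n p. is_partition b n p \<Longrightarrow> mesh_below \<delta> n p \<Longrightarrow>
    (\<Sum>i<n. \<bar>2 * unit_average (\<lambda>u. Q u w - Q (p i) w) (p i) (p (Suc i)) - (Q (p (Suc i)) w - Q (p i) w)\<bar>) \<le> e / 2"
    using averaged_primitive[OF _ b(1) e2, of "\<lambda>u. D u w" "\<lambda>u. Q u w"] by blast
  have "\<forall>\<^sub>F n in sequentially. norm (mean_bracket n w - weighted_bracket w) < e"
    using mesh_tends_to_zero[OF \<delta>(1)] net_weight_sum_close[OF w e2]
  proof eventually_elim
    case (elim n)
    let ?q = "\<lambda>i. Q (pt n (Suc i)) w - Q (pt n i) w"
    let ?a = "\<lambda>i. 2 * mean_Q n i w"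
    have "\<bar>mean_bracket n w - (\<Sum>i<n. net_weight n i * ?q i)\<bar> = \<bar>\<Sum>i<n. net_weight n i * (?a i - ?q i)\<bar>"
      unfolding mean_bracket_def by (simp add: sum_subtractf[symmetric] right_diff_distrib)
    also have "\<dots> \<le> (\<Sum>i<n. \<bar>?a i - ?q i\<bar>)"
    proof (rule order_trans[OF sum_abs sum_mono])
      fix i assume "i \<in> {..<n}"
      then have "0 \<le> net_weight n i" "net_weight n i \<le> 1" using net_weight_bounds[of i n] by auto
      then show "\<bar>net_weight n i * (?a i - ?q i)\<bar> \<le> \<bar>?a i - ?q i\<bar>"
        by (simp add: abs_mult mult_left_le_one_le)
    qed
    also have "\<dots> \<le> e / 2"
    proof (rule \<delta>(2)[OF pt_partition])
      show "0 < n" using elim by simp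
      show "\<forall>i<n. pt n (Suc i) - pt n i < \<delta>" using elim(1) pt_mesh le_less_trans by blast
    qed
    finally show ?case using elim(2) unfolding real_norm_def by linarith
  qed
  then show "\<exists>N. \<forall>n\<ge>N. norm (mean_bracket n w - weighted_bracket w) < e"
    by (simp add: eventually_sequentially)
qed

text \<open>Provides the integrable majorant for dominated convergence: for the monotone bracket an
  average of increments is at most the full increment, and those telescope.\<close>

lemma mean_bracket_bound:
  assumes w: "w \<in> space P" and n: "0 < n"
  shows "\<bar>mean_bracket n w\<bar> \<le> 2 * Q b w"
proof -
  have "\<bar>mean_bracket n w\<bar> \<le> (\<Sum>i<n. 2 * (Q (pt n (Suc i)) w - Q (pt n i) w))"
    unfolding mean_bracket_def
  proof (rule order_trans[OF sum_abs sum_mono])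
    fix i assume "i \<in> {..<n}"
    then have i: "i < n" by simp
    have st: "0 \<le> pt n i" "pt n i \<le> pt n (Suc i)" "pt n (Suc i) \<le> b"
      using pt_bounds[of i n] pt_bounds[of "Suc i" n] pt_mono[OF i] i by auto
    have "\<bar>mean_Q n i w\<bar> \<le> Q (pt n (Suc i)) w - Q (pt n i) w"
    proof (rule unit_average_bound[OF st(2)])
      show "continuous_on {pt n i..pt n (Suc i)} (\<lambda>u. Q u w - Q (pt n i) w)"
        by (intro continuous_intros continuous_on_subset[OF Q_continuous[OF b(2) w]]) (use st in auto)
      fix u assume "u \<in> {pt n i..pt n (Suc i)}"
      then show "\<bar>Q u w - Q (pt n i) w\<bar> \<le> Q (pt n (Suc i)) w - Q (pt n i) w"
        using Q_mono[of "pt n i" u w] Q_mono[of u "pt n (Suc i)" w] st b w by auto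
    qed
    moreover have "0 \<le> net_weight n i" "net_weight n i \<le> 1" using net_weight_bounds[OF i] by auto
    ultimately show "\<bar>net_weight n i * (2 * mean_Q n i w)\<bar>
      \<le> 2 * (Q (pt n (Suc i)) w - Q (pt n i) w)"
      by (simp add: abs_mult mult_le_one order_trans[OF mult_left_le_one_le])
  qed
  also have "\<dots> = 2 * (Q b w - Q 0 w)"
    using sum_lessThan_telescope[of "\<lambda>i. Q (pt n i) w" n] pt_partition[OF n]
    unfolding sum_distrib_left[symmetric] by (simp add: is_partition_def)
  finally show ?thesis using Q_zero[OF w] by simp
qed

lemma unit_average_Q_integrable:
  assumes st: "0 \<le> s" "s \<le> t" "t \<le> b"
  shows "integrable P (\<lambda>w. unit_average (\<lambda>u. Q u w - Q s w) s t)"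
proof (rule unit_average_L1_bound(1)[OF st(1,2)])
  have Qi: "integrable P (\<lambda>w. Q u w - Q s w)" if "u \<in> {s..t}" for u
    using Q_integrable_expectation[of u] Q_integrable_expectation[of s] st b that by simp
  show "0 \<le> (\<integral>w. Q t w - Q s w \<partial>P)"
    using Q_mono st b by (intro integral_nonneg_AE AE_I2) auto
  show "continuous_on {0..t} (\<lambda>u. Q u w - Q s w)" if "w \<in> space P" for w
    using Q_continuous[of t w] that st b by (intro continuous_intros) auto
  show "(\<lambda>w. Q u w - Q s w) \<in> borel_measurable P" if "u \<in> {0..t}" for u
    using Q_measurable that st b by (intro borel_measurable_diff) auto
  fix u assume u: "u \<in> {s..t}"
  show "integrable P (\<lambda>w. Q u w - Q s w)" by (rule Qi[OF u])
  have "t \<in> {s..t}" using st by simp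
  show "(\<integral>w. \<bar>Q u w - Q s w\<bar> \<partial>P) \<le> (\<integral>w. Q t w - Q s w \<partial>P)"
  proof (rule integral_mono[OF integrable_abs[OF Qi[OF u]] Qi[OF \<open>t \<in> {s..t}\<close>]])
    fix w assume "w \<in> space P"
    then show "\<bar>Q u w - Q s w\<bar> \<le> Q t w - Q s w"
      using Q_mono[of s u w] Q_mono[of u t w] u st b by auto
  qed
qed

lemma mean_bracket_integrable: "integrable P (mean_bracket n)"
proof -
  have "integrable P (\<lambda>w. mean_Q n i w)" if "i < n" for i
    using pt_bounds[of i n] pt_bounds[of "Suc i" n] pt_mono[of i n] that
    by (intro unit_average_Q_integrable) auto
  then show ?thesis unfolding mean_bracket_def[abs_def]
    by (intro Bochner_Integration.integrable_sum integrable_mult_right) auto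
qed

section \<open>Convergence of the scaled error to the weighted bracket in L_1\<close>

abbreviation scaled_error :: "nat \<Rightarrow> 'a \<Rightarrow> real" where
  "scaled_error n w \<equiv> 2 * \<theta> * real n / T * net_error L n (tau n) b w"

lemma scaled_net_error:
  assumes w: "w \<in> space P" and n: "0 < n"
  shows "scaled_error n w =
    2 * (\<Sum>i<n. net_weight n i * mean_compensated (pt n) i w)
    + mean_bracket n w"
proof -
  have "scaled_error n w =
    (\<Sum>i<n. net_weight n i * (2 * mean_square n i w))"
    unfolding net_error_partition[OF assms] sum_distrib_left net_weight_def
    by (intro sum.cong refl) simp
  also have "\<dots> = (\<Sum>i<n. net_weight n i * (2 * mean_compensated (pt n) i w)
    + net_weight n i * (2 * mean_Q n i w))"
  proof (rule sum.cong[OF refl])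
    fix i assume "i \<in> {..<n}"
    then have i: "i < n" by simp
    have st: "0 \<le> pt n i" "pt n i \<le> pt n (Suc i)" "pt n (Suc i) \<le> b"
      using pt_bounds[of i n] pt_bounds[of "Suc i" n] pt_mono[OF i] i by auto
    have c1: "continuous_on {pt n i..pt n (Suc i)} (\<lambda>u. compensated (pt n i) u w)"
      by (rule continuous_on_subset[OF compensated_continuous[OF st(1) b(2) w]]) (use st in auto)
    have c2: "continuous_on {pt n i..pt n (Suc i)} (\<lambda>u. Q u w - Q (pt n i) w)"
      by (intro continuous_intros continuous_on_subset[OF Q_continuous[OF b(2) w]]) (use st in auto)
    have "mean_square n i w =
      mean_compensated (pt n) i w
      + mean_Q n i w"
      using unit_average_add[OF st(2) c1 c2] by (simp add: compensated_def)
    then show "net_weight n i * (2 * mean_square n i w) =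
      net_weight n i * (2 * mean_compensated (pt n) i w)
      + net_weight n i * (2 * mean_Q n i w)"
      by (simp add: distrib_left)
  qed
  also have "\<dots> = 2 * (\<Sum>i<n. net_weight n i * mean_compensated (pt n) i w)
    + mean_bracket n w"
    by (simp add: mean_bracket_def sum.distrib sum_distrib_left mult.left_commute)
  finally show ?thesis .
qed

lemma weighted_bracket_integrable: "integrable P weighted_bracket"
proof (rule Bochner_Integration.integrable_bound)
  show "integrable P (Q b)" using Q_integrable_expectation b by auto
  show "weighted_bracket \<in> borel_measurable P"
    using weighted_bracket_measurable measurable_F_imp_P[of b] b by auto
  show "AE w in P. norm (weighted_bracket w) \<le> norm (Q b w)"
    using weighted_bracket_bounds Q_nonneg b by (intro AE_I2) auto
qed

lemma scaled_net_error_converges: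
  "(\<lambda>n. \<integral>\<^sup>+w. ennreal \<bar>scaled_error n w - weighted_bracket w\<bar> \<partial>P)
    \<longlonglongrightarrow> 0"
proof -
  let ?N = "\<lambda>n. \<integral>\<^sup>+w. ennreal \<bar>scaled_error n w - weighted_bracket w\<bar> \<partial>P"
  define C where "C n w = (\<Sum>i<n. net_weight n i * mean_compensated (pt n) i w)"
    for n w
  define x where "x n = (\<integral>w. \<bar>mean_bracket n w - weighted_bracket w\<bar> \<partial>P)" for n
  \<comment> \<open>The majorant \<open>3 * Q b w\<close> consists of 2 from
    \<open>mean_bracket_bound\<close> and 1 from the limit. The shift of the index supplies the
    positivity of \<open>n\<close> that this bound asks for.\<close>
  have "(\<lambda>n. x (Suc n)) \<longlonglongrightarrow> (\<integral>w. 0 \<partial>P)"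
    unfolding x_def
  proof (rule integral_dominated_convergence[where w="\<lambda>w. 3 * Q b w"])
    show "integrable P (\<lambda>w. 3 * Q b w)" using Q_integrable_expectation b by auto
    show "AE w in P. (\<lambda>n. \<bar>mean_bracket (Suc n) w - weighted_bracket w\<bar>) \<longlonglongrightarrow> 0"
    proof (rule AE_I2)
      fix w assume "w \<in> space P"
      from LIMSEQ_Suc[OF mean_bracket_limit[OF this]]
      show "(\<lambda>n. \<bar>mean_bracket (Suc n) w - weighted_bracket w\<bar>) \<longlonglongrightarrow> 0"
        by (intro tendsto_rabs_zero LIM_zero)
    qed
    show "AE w in P. norm \<bar>mean_bracket (Suc n) w - weighted_bracket w\<bar> \<le> 3 * Q b w" for n
    proof (rule AE_I2)
      fix w assume "w \<in> space P"
      then show "norm \<bar>mean_bracket (Suc n) w - weighted_bracket w\<bar> \<le> 3 * Q b w"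
        using mean_bracket_bound[of w "Suc n"] weighted_bracket_bounds[of w] by auto
    qed
  qed (use mean_bracket_integrable weighted_bracket_integrable in auto)
  then have x: "x \<longlonglongrightarrow> 0" by (subst (asm) filterlim_sequentially_Suc) simp
  have "\<forall>\<^sub>F n in sequentially. ?N n \<le> ennreal e" if e: "0 < e" for e
  proof -
    \<comment> \<open>The compensated part enters with the factor 2, so a quarter for it and a half
      for the bracket part suffice.\<close>
    have e4: "0 < e / 4" and e2: "0 < e / 2" using e by auto
    obtain \<delta> where \<delta>: "0 < \<delta>" "\<And>n p c. is_partition b n p \<Longrightarrow> mesh_below \<delta> n p \<Longrightarrow>
      (\<forall>i<n. c i \<in> {0..1}) \<Longrightarrow>
      integrable P (\<lambda>w. \<Sum>i<n. c i * mean_compensated p i w) \<and>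
      (\<integral>w. \<bar>\<Sum>i<n. c i * mean_compensated p i w\<bar> \<partial>P) \<le> e / 4"
      using saks_henstock_averaged[OF b e4] by blast
    show ?thesis
      using mesh_tends_to_zero[OF \<delta>(1)] order_tendstoD(2)[OF x e2]
    proof eventually_elim
      case (elim n)
      then have n: "0 < n" by simp
      have "\<forall>i<n. pt n (Suc i) - pt n i < \<delta>" using elim(1) pt_mesh le_less_trans by blast
      then have C: "integrable P (C n)" "(\<integral>w. \<bar>C n w\<bar> \<partial>P) \<le> e / 4"
        using \<delta>(2)[OF pt_partition[OF n], of "net_weight n"] net_weight_bounds by (auto simp: C_def[abs_def])
      define Y where "Y w = 2 * C n w + (mean_bracket n w - weighted_bracket w)" for w
      have Y: "integrable P Y" unfolding Y_def
        using C(1) mean_bracket_integrable weighted_bracket_integrable by simp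
      have "(\<integral>w. \<bar>Y w\<bar> \<partial>P) \<le> (\<integral>w. 2 * \<bar>C n w\<bar> + \<bar>mean_bracket n w - weighted_bracket w\<bar> \<partial>P)"
      proof (rule integral_mono)
        show "integrable P (\<lambda>w. 2 * \<bar>C n w\<bar> + \<bar>mean_bracket n w - weighted_bracket w\<bar>)"
          using C(1) mean_bracket_integrable[of n] weighted_bracket_integrable by simp
        show "integrable P (\<lambda>w. \<bar>Y w\<bar>)" using Y by simp
      qed (simp add: Y_def)
      also have "\<dots> = 2 * (\<integral>w. \<bar>C n w\<bar> \<partial>P) + x n"
        using C(1) mean_bracket_integrable[of n] weighted_bracket_integrable by (simp add: x_def)
      also have "\<dots> \<le> e" using C(2) elim(2) by simp
      finally have EY: "(\<integral>w. \<bar>Y w\<bar> \<partial>P) \<le> e" .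
      have "?N n
          = (\<integral>\<^sup>+w. ennreal \<bar>Y w\<bar> \<partial>P)"
        using scaled_net_error[OF _ n] by (intro nn_integral_cong) (simp add: Y_def C_def)
      also have "\<dots> = ennreal (\<integral>w. \<bar>Y w\<bar> \<partial>P)"
        by (rule nn_integral_eq_integral) (use Y in simp_all)
      finally show ?case using EY by (simp add: ennreal_leI)
    qed
  qed
  note close = this
  show ?thesis
  proof (rule tendsto_zero_ennreal)
    fix r :: real assume r: "0 < r"
    then have lt: "ennreal (r / 2) < ennreal r" by (simp add: ennreal_lessI)
    have "0 < r / 2" using r by simp
    from close[OF this]
    show "\<forall>\<^sub>F n in sequentially. ?N n < ennreal r"
      by (rule eventually_mono) (erule le_less_trans[OF _ lt])
  qed
qed

end

subsection \<open>The bracket of the Riemann--Liouville transform\<close>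

text \<open>Reflection at \<open>T\<close> moves the possible singularity to 0, where x powr (a - 1)
  is integrable because a - 1 > -1. Nonnegativity carries the gauge integral over to the Lebesgue
  integral.\<close>

lemma powr_kernel_integral:
  fixes a t T :: real
  assumes "0 < a" "t \<le> T"
  shows "set_integrable lborel {t..T} (\<lambda>u. (T - u) powr (a - 1))"
    and "(LBINT u:{t..T}. (T - u) powr (a - 1)) = (T - t) powr a / a"
proof -
  define f where "f x = indicator {0..T - t} x * x powr (a - 1)" for x :: real
  have [measurable]: "f \<in> borel_measurable borel" unfolding f_def by measurable
  have f0: "0 \<le> f x" for x by (simp add: f_def)
  have c: "0 \<le> T - t" "-1 < a - 1" using assms by auto
  have "((\<lambda>x. if x \<in> {0..T - t} then x powr (a - 1) else 0) has_integral (T - t) powr a / a) UNIV"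
    using has_integral_powr_from_0[OF c(2,1)] by (subst has_integral_restrict_UNIV) simp
  moreover have "(\<lambda>x. if x \<in> {0..T - t} then x powr (a - 1) else 0) = f"
    by (auto simp: f_def)
  ultimately have "(f has_integral (T - t) powr a / a) UNIV" by simp
  then have "(\<integral>\<^sup>+x. f x \<partial>lborel) = ennreal ((T - t) powr a / a)"
    by (intro nn_integral_has_integral_lborel f0) simp_all
  then have "has_bochner_integral lborel f ((T - t) powr a / a)"
    using assms f0 by (intro has_bochner_integral_nn_integral) simp_all
  then have "has_bochner_integral lborel (\<lambda>x. f (T + (-1) * x)) ((T - t) powr a / a /\<^sub>R \<bar>-1\<bar>)"
    by (subst (asm) lborel_has_bochner_integral_real_affine_iff[where c="-1" and t=T]) simp_all
  moreover have "(\<lambda>x. f (T + (-1) * x)) = (\<lambda>u. indicator {t..T} u *\<^sub>R (T - u) powr (a - 1))"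
    by (auto simp: f_def indicator_def)
  ultimately have "has_bochner_integral lborel (\<lambda>u. indicator {t..T} u *\<^sub>R (T - u) powr (a - 1)) ((T - t) powr a / a)"
    by simp
  then show "set_integrable lborel {t..T} (\<lambda>u. (T - u) powr (a - 1))"
    "(LBINT u:{t..T}. (T - u) powr (a - 1)) = (T - t) powr a / a"
    by (auto simp: set_integrable_def set_lebesgue_integral_def has_bochner_integral_iff)
qed

lemma unit_average_nonneg:
  assumes "s \<le> t" "\<And>u. u \<in> {s..t} \<Longrightarrow> 0 \<le> f u"
  shows "0 \<le> unit_average f s t"
  unfolding unit_average_def set_lebesgue_integral_def
  using assms segment_mem[OF assms(1)] by (intro integral_nonneg_AE AE_I2) (auto simp: indicator_def)

text \<open>The average of the squared deviation from the mean is nonnegative.\<close>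

lemma unit_average_jensen:
  assumes "s \<le> t" "continuous_on {s..t} f"
  shows "(unit_average f s t)\<^sup>2 \<le> unit_average (\<lambda>u. (f u)\<^sup>2) s t"
proof -
  define m where "m = unit_average f s t"
  have "0 \<le> unit_average (\<lambda>u. (f u - m)\<^sup>2) s t" using assms(1) by (intro unit_average_nonneg) auto
  also have "\<dots> = unit_average (\<lambda>u. ((f u)\<^sup>2 - (2 * m) * f u) + m\<^sup>2) s t"
    by (simp add: power2_diff algebra_simps)
  also have "\<dots> = unit_average (\<lambda>u. (f u)\<^sup>2) s t - (2 * m) * m + m\<^sup>2"
    using assms by (subst unit_average_add, simp, (intro continuous_intros; simp)+, subst unit_average_diff)
      (auto intro!: continuous_intros simp: unit_average_cmult unit_average_const m_def)
  finally show ?thesis by (simp add: m_def power2_eq_square)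
qed

section \<open>Increments of the transform compared with increments of \<open>L\<close>\<close>

context theta_setting
begin

definition \<alpha> :: real where "\<alpha> = (1 - \<theta>) / 2"

definition M :: "real \<Rightarrow> 'a \<Rightarrow> real" where "M = RL_operator T \<alpha> L"

text \<open>The transform is formally the integral of \<open>root\<close> against \<open>L\<close>.
  The exponent \<open>\<alpha>\<close> is such that the square of \<open>root\<close> is
  \<open>weight\<close>.\<close>

definition root :: "real \<Rightarrow> real" where "root t = ((T - t) / T) powr \<alpha>"

text \<open>The largest value on \<open>{0..b}\<close> of the kernel of the transform, which is
  nondecreasing in time since \<open>\<alpha>\<close> < 1. For \<open>\<alpha> = 0\<close> it is 0,
  in accordance with the transform being \<open>L\<close> itself.\<close>

definition kernel_bound :: real where "kernel_bound = \<alpha> / T powr \<alpha> * (T - b) powr (\<alpha> - 1)"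

text \<open>The right end point is the natural choice: on \<open>{t..T}\<close> the stopped paths
  differ by the constant \<open>L t w - L s w\<close>, and the normalised kernel has exactly the
  mass \<open>root t\<close> there.\<close>

definition remainder :: "real \<Rightarrow> real \<Rightarrow> 'a \<Rightarrow> real" where
  "remainder s t w = M t w - M s w - root t * (L t w - L s w)"

lemma alpha_bounds: "0 \<le> \<alpha>" "\<alpha> < 1"
  using theta by (auto simp: \<alpha>_def)

lemma root_square: "(root t)\<^sup>2 = weight T \<theta> t"
  by (simp add: root_def weight_def power2_eq_square powr_add[symmetric] \<alpha>_def)

lemma kernel_bound_nonneg: "0 \<le> kernel_bound"
  using alpha_bounds by (simp add: kernel_bound_def)

lemma stopped_kernel_integrable:
  assumes "0 < \<alpha>" "0 \<le> t" "t \<le> b" "w \<in> space P"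
  shows "set_integrable lborel {0..T} (\<lambda>u. (T - u) powr (\<alpha> - 1) * L (min u t) w)"
proof -
  have "continuous_on {0..t} (\<lambda>u. L u w)" using L_continuous_on[of t w] assms b by auto
  then have "compact ((\<lambda>u. L u w) ` {0..t})" by (intro compact_continuous_image) auto
  then obtain B where B: "\<And>u. u \<in> {0..t} \<Longrightarrow> \<bar>L u w\<bar> \<le> B"
    using bounded_real compact_imp_bounded by (metis imageI)
  have cont: "continuous_on UNIV (\<lambda>u. L (max 0 (min u t)) w)"
    by (rule continuous_on_compose2[OF \<open>continuous_on {0..t} (\<lambda>u. L u w)\<close>])
      (use assms in \<open>auto intro!: continuous_intros\<close>)
  have "integrable lborel (\<lambda>u. L (max 0 (min u t)) w * (indicator {0..T} u * (T - u) powr (\<alpha> - 1)))"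
  proof (rule integrable_bounded_mult[where B=B])
    show "(\<lambda>u. L (max 0 (min u t)) w) \<in> borel_measurable lborel"
      using borel_measurable_continuous_onI[OF cont] by simp
    show "integrable lborel (\<lambda>u. indicator {0..T} u * (T - u) powr (\<alpha> - 1))"
      using powr_kernel_integral(1)[of \<alpha> 0 T] assms T_pos by (simp add: set_integrable_def)
    show "\<bar>L (max 0 (min u t)) w\<bar> \<le> B" for u using assms by (intro B) auto
  qed
  moreover have "(\<lambda>u. L (max 0 (min u t)) w * (indicator {0..T} u * (T - u) powr (\<alpha> - 1)))
      = (\<lambda>u. indicator {0..T} u * ((T - u) powr (\<alpha> - 1) * L (min u t) w))"
    using assms by (auto simp: indicator_def)
  ultimately show ?thesis by (simp add: set_integrable_def)
qed

lemma M_measurable: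
  assumes t: "0 \<le> t" "t \<le> b"
  shows "M t \<in> borel_measurable P"
proof (cases "\<alpha> = 0")
  case True
  then show ?thesis using L_measurable[of t] t b by (simp add: M_def RL_operator_def[abs_def])
next
  case False
  have L: "(\<lambda>z. L (max 0 (min t (fst z))) (snd z)) \<in> borel_measurable (borel \<Otimes>\<^sub>M P)"
    using L_measurable L_continuous_on[of t] t b by (intro clamped_joint_measurable) auto
  then have "(\<lambda>z. L (max 0 (min t (fst z))) (snd z)) \<in> borel_measurable (lborel \<Otimes>\<^sub>M P)"
    by (simp cong: measurable_cong_sets)
  from measurable_compose[OF measurable_pair_swap' this]
  have [measurable]: "(\<lambda>z. L (max 0 (min t (snd z))) (fst z)) \<in> borel_measurable (P \<Otimes>\<^sub>M lborel)"
    by (simp add: case_prod_beta comp_def)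
  have m: "(\<lambda>z. indicator {0..T} (snd z) * (T - snd z) powr (\<alpha> - 1) * L (max 0 (min t (snd z))) (fst z))
    \<in> borel_measurable (P \<Otimes>\<^sub>M lborel)" by measurable
  have "(\<lambda>w. \<integral>u. indicator {0..T} u * (T - u) powr (\<alpha> - 1) * L (max 0 (min t u)) w \<partial>lborel) \<in> borel_measurable P"
    by (rule sigma_finite_measure.borel_measurable_lebesgue_integral[OF sigma_finite_lborel])
      (use m in \<open>simp add: case_prod_beta'\<close>)
  moreover have "(\<integral>u. indicator {0..T} u * (T - u) powr (\<alpha> - 1) * L (max 0 (min t u)) w \<partial>lborel)
      = (LBINT u:{0..T}. (T - u) powr (\<alpha> - 1) * L (min u t) w)" for w
    unfolding set_lebesgue_integral_def
    by (intro Bochner_Integration.integral_cong) (use t in \<open>auto simp: indicator_def min.commute\<close>)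
  ultimately show ?thesis using False by (simp add: M_def RL_operator_def[abs_def])
qed

text \<open>Integration by parts for \<open>\<integral> root dL\<close>.\<close>

lemma remainder_bound:
  assumes st: "0 \<le> s" "s \<le> t" "t \<le> b" and w: "w \<in> space P"
  shows "\<bar>remainder s t w\<bar> \<le> kernel_bound * (t - s) * unit_average (\<lambda>u. \<bar>L u w - L s w\<bar>) s t"
proof (cases "\<alpha> = 0")
  case True
  have "root t = 1" using True st b T_pos by (simp add: root_def)
  then show ?thesis using True by (simp add: remainder_def M_def RL_operator_def kernel_bound_def)
next
  case False
  then have \<alpha>: "0 < \<alpha>" using alpha_bounds by simp
  define \<kappa> where "\<kappa> = \<alpha> / T powr \<alpha>"
  define k where "k u = (T - u) powr (\<alpha> - 1)" for u
  define \<Delta> where "\<Delta> = L t w - L s w"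
  \<comment> \<open>The difference of the two stopped paths is 0 before \<open>s\<close>, the
    running increment on \<open>{s..t}\<close>, and the constant \<open>\<Delta>\<close>
    afterwards.\<close>
  let ?R = "\<lambda>u. indicator {s..t} u *\<^sub>R (k u * (L u w - L s w)) + \<Delta> * (indicator {t..T} u *\<^sub>R k u)"
  let ?S = "\<lambda>u. indicator {0..T} u *\<^sub>R (k u * L (min u t) w - k u * L (min u s) w)"
  have \<kappa>: "0 \<le> \<kappa>" using \<alpha> by (simp add: \<kappa>_def)
  have tT: "t < T" using st b by simp
  have ki: "set_integrable lborel {t..T} k" and kI: "(LBINT u:{t..T}. k u) = (T - t) powr \<alpha> / \<alpha>"
    using powr_kernel_integral[OF \<alpha>, of t T] tT by (simp_all add: k_def[abs_def])
  have Lc: "continuous_on {s..t} (\<lambda>u. L u w)"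
    by (rule continuous_on_subset[OF L_continuous_on[OF tT w]]) (use st in auto)
  have kc: "continuous_on {s..t} k" unfolding k_def using tT by (intro continuous_intros) auto
  have gi: "set_integrable lborel {s..t} (\<lambda>u. k u * (L u w - L s w))"
    by (intro borel_integrable_atLeastAtMost' continuous_intros kc Lc)
  have "M t w - M s w = \<kappa> * (LBINT u:{0..T}. k u * L (min u t) w - k u * L (min u s) w)"
    using False set_integral_diff(2)[OF stopped_kernel_integrable[OF \<alpha>, of t w] stopped_kernel_integrable[OF \<alpha>, of s w]]
      st w by (simp add: M_def RL_operator_def \<kappa>_def k_def right_diff_distrib)
  also have "(LBINT u:{0..T}. k u * L (min u t) w - k u * L (min u s) w)
      = (\<integral>u. ?R u \<partial>lborel)"
    unfolding set_lebesgue_integral_def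
  proof (rule integral_cong_AE)
    have i1: "integrable lborel (\<lambda>u. ?S u)"
      using set_integral_diff(1)[OF stopped_kernel_integrable[OF \<alpha>, of t w] stopped_kernel_integrable[OF \<alpha>, of s w]]
        st w by (simp add: set_integrable_def k_def)
    then show "(\<lambda>u. ?S u) \<in> borel_measurable lborel"
      by (rule borel_measurable_integrable)
    have "integrable lborel (\<lambda>u. ?R u)"
      using gi ki unfolding set_integrable_def
      by (intro Bochner_Integration.integrable_add integrable_mult_right)
    then show "(\<lambda>u. ?R u)
      \<in> borel_measurable lborel" by (rule borel_measurable_integrable)
    \<comment> \<open>The point \<open>t\<close> belongs to both intervals in \<open>?R\<close> and
      is counted twice there, hence equality only almost everywhere.\<close>
    show "AE u in lborel. ?S u
      = ?R u"
      using AE_lborel_singleton[of t]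
    proof eventually_elim
      case (elim u)
      consider "u < s" | "s \<le> u" "u < t" | "t < u" using elim by linarith
      then show ?case
      proof cases
        case 1 then show ?thesis using st by (simp add: indicator_def)
      next
        case 2 then show ?thesis using st tT by (simp add: indicator_def right_diff_distrib)
      next
        case 3 then show ?thesis using st by (simp add: indicator_def \<Delta>_def algebra_simps)
      qed
    qed
  qed
  also have "\<dots> = (LBINT u:{s..t}. k u * (L u w - L s w)) + \<Delta> * (LBINT u:{t..T}. k u)"
    using gi ki unfolding set_integrable_def set_lebesgue_integral_def
    by (subst Bochner_Integration.integral_add) auto
  also have "\<kappa> * \<dots> = \<kappa> * (LBINT u:{s..t}. k u * (L u w - L s w)) + \<kappa> * (LBINT u:{t..T}. k u) * \<Delta>"
    by (simp only: distrib_left ac_simps)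
  also have "\<kappa> * (LBINT u:{t..T}. k u) = root t"
    using \<alpha> T_pos tT by (simp add: kI \<kappa>_def root_def powr_divide)
  finally have "M t w - M s w = \<kappa> * (LBINT u:{s..t}. k u * (L u w - L s w)) + root t * \<Delta>" .
  then have rem: "remainder s t w = \<kappa> * (LBINT u:{s..t}. k u * (L u w - L s w))"
    by (simp add: remainder_def \<Delta>_def)
  have "\<bar>LBINT u:{s..t}. k u * (L u w - L s w)\<bar> \<le> (LBINT u:{s..t}. \<bar>k u * (L u w - L s w)\<bar>)"
    using set_integral_norm_bound[OF gi] by simp
  also have "\<dots> \<le> (LBINT u:{s..t}. (T - b) powr (\<alpha> - 1) * \<bar>L u w - L s w\<bar>)"
  proof (rule set_integral_mono)
    show "set_integrable lborel {s..t} (\<lambda>u. \<bar>k u * (L u w - L s w)\<bar>)" using gi by (rule set_integrable_abs)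
    show "set_integrable lborel {s..t} (\<lambda>u. (T - b) powr (\<alpha> - 1) * \<bar>L u w - L s w\<bar>)"
      by (intro borel_integrable_atLeastAtMost' continuous_intros Lc)
    fix u assume "u \<in> {s..t}"
    then have "k u \<le> (T - b) powr (\<alpha> - 1)"
      unfolding k_def using st b alpha_bounds by (intro powr_mono2') auto
    then show "\<bar>k u * (L u w - L s w)\<bar> \<le> (T - b) powr (\<alpha> - 1) * \<bar>L u w - L s w\<bar>"
      by (simp add: abs_mult k_def mult_right_mono)
  qed
  also have "\<dots> = (T - b) powr (\<alpha> - 1) * ((t - s) * unit_average (\<lambda>u. \<bar>L u w - L s w\<bar>) s t)"
    using integral_eq_unit_average[OF st(2), of "\<lambda>u. \<bar>L u w - L s w\<bar>"] by simp
  finally have "\<kappa> * \<bar>LBINT u:{s..t}. k u * (L u w - L s w)\<bar>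
      \<le> \<kappa> * ((T - b) powr (\<alpha> - 1) * ((t - s) * unit_average (\<lambda>u. \<bar>L u w - L s w\<bar>) s t))"
    using \<kappa> by (rule mult_left_mono)
  then show ?thesis using \<kappa> \<alpha> unfolding rem by (simp add: abs_mult kernel_bound_def \<kappa>_def mult.assoc)
qed

lemma unit_average_L_square:
  assumes st: "0 \<le> s" "s \<le> t" "t \<le> b"
  shows "integrable P (\<lambda>w. unit_average (\<lambda>u. (L u w - L s w)\<^sup>2) s t)"
    "(\<integral>w. \<bar>unit_average (\<lambda>u. (L u w - L s w)\<^sup>2) s t\<bar> \<partial>P) \<le> (\<integral>w. Q t w - Q s w \<partial>P)"
proof -
  have Qi: "integrable P (\<lambda>w. Q u w - Q s w)" if "u \<in> {s..t}" for u
    using Q_integrable_expectation[of u] Q_integrable_expectation[of s] st b that by simp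
  have e0: "0 \<le> (\<integral>w. Q t w - Q s w \<partial>P)"
    using Q_mono st b by (intro integral_nonneg_AE AE_I2) auto
  have i: "integrable P (\<lambda>w. (L u w - L s w)\<^sup>2)" if "u \<in> {0..t}" for u
    using L_diff_square_integrable that st b by auto
  have c: "continuous_on {0..t} (\<lambda>u. (L u w - L s w)\<^sup>2)" if "w \<in> space P" for w
    using L_continuous_on[of t w] that st b by (intro continuous_intros) auto
  have e: "(\<integral>w. \<bar>(L u w - L s w)\<^sup>2\<bar> \<partial>P) \<le> (\<integral>w. Q t w - Q s w \<partial>P)" if u: "u \<in> {s..t}" for u
  proof -
    have "t \<in> {s..t}" using st by simp
    have "(\<integral>w. \<bar>(L u w - L s w)\<^sup>2\<bar> \<partial>P) = (\<integral>w. Q u w - Q s w \<partial>P)"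
      using L_increment_bracket[of s u] u st b by simp
    also have "\<dots> \<le> (\<integral>w. Q t w - Q s w \<partial>P)"
      using Q_mono[of u t] u st b by (intro integral_mono[OF Qi[OF u] Qi[OF \<open>t \<in> {s..t}\<close>]]) auto
    finally show ?thesis .
  qed
  have st0: "u \<in> {0..t}" if "u \<in> {s..t}" for u using that st by auto
  note B = unit_average_L1_bound[OF st(1,2) e0 borel_measurable_integrable[OF i] c i[OF st0] e]
  show "integrable P (\<lambda>w. unit_average (\<lambda>u. (L u w - L s w)\<^sup>2) s t)"
    "(\<integral>w. \<bar>unit_average (\<lambda>u. (L u w - L s w)\<^sup>2) s t\<bar> \<partial>P) \<le> (\<integral>w. Q t w - Q s w \<partial>P)"
    using B by blast+
qed

text \<open>The pathwise bound is squared with Jensen's inequality, and the mean of a squared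
  increment of \<open>L\<close> is that of the bracket. The extra factor of order
  \<open>(t - s)\<^sup>2\<close> makes the sum over a fine partition negligible.\<close>

lemma remainder_second_moment:
  assumes st: "0 \<le> s" "s \<le> t" "t \<le> b"
  shows "integrable P (\<lambda>w. (remainder s t w)\<^sup>2)"
    "(\<integral>w. (remainder s t w)\<^sup>2 \<partial>P) \<le> (kernel_bound * (t - s))\<^sup>2 * (\<integral>w. Q t w - Q s w \<partial>P)"
proof -
  let ?A = "\<lambda>w. unit_average (\<lambda>u. (L u w - L s w)\<^sup>2) s t"
  have bound: "(remainder s t w)\<^sup>2 \<le> (kernel_bound * (t - s))\<^sup>2 * ?A w" if w: "w \<in> space P" for w
  proof -
    have "t < T" using st b by simp
    have c: "continuous_on {s..t} (\<lambda>u. \<bar>L u w - L s w\<bar>)"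
      by (intro continuous_intros continuous_on_subset[OF L_continuous_on[OF \<open>t < T\<close> w]]) (use st in auto)
    have "(remainder s t w)\<^sup>2 \<le> (kernel_bound * (t - s) * unit_average (\<lambda>u. \<bar>L u w - L s w\<bar>) s t)\<^sup>2"
      using remainder_bound[OF st w] by (rule power2_le_iff_abs_le[THEN iffD2, rotated])
        (intro mult_nonneg_nonneg kernel_bound_nonneg unit_average_nonneg; use st in simp)
    also have "\<dots> = (kernel_bound * (t - s))\<^sup>2 * (unit_average (\<lambda>u. \<bar>L u w - L s w\<bar>) s t)\<^sup>2"
      by (simp add: power_mult_distrib)
    also have "\<dots> \<le> (kernel_bound * (t - s))\<^sup>2 * ?A w"
      using unit_average_jensen[OF st(2) c] by (intro mult_left_mono) simp_all
    finally show ?thesis .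
  qed
  note A = unit_average_L_square[OF st]
  have "L t \<in> borel_measurable P" "L s \<in> borel_measurable P" "M t \<in> borel_measurable P" "M s \<in> borel_measurable P"
    using L_measurable M_measurable st b by auto
  then have m: "(\<lambda>w. (remainder s t w)\<^sup>2) \<in> borel_measurable P" unfolding remainder_def by measurable
  have Ai: "integrable P (\<lambda>w. (kernel_bound * (t - s))\<^sup>2 * ?A w)" using A(1) by simp
  show i: "integrable P (\<lambda>w. (remainder s t w)\<^sup>2)"
  proof (rule Bochner_Integration.integrable_bound[OF Ai m], rule AE_I2)
    fix w assume "w \<in> space P"
    from bound[OF this] show "norm ((remainder s t w)\<^sup>2) \<le> norm ((kernel_bound * (t - s))\<^sup>2 * ?A w)" by simp
  qed
  have "(\<integral>w. (remainder s t w)\<^sup>2 \<partial>P) \<le> (\<integral>w. (kernel_bound * (t - s))\<^sup>2 * ?A w \<partial>P)"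
    by (rule integral_mono[OF i Ai bound])
  also have "\<dots> = (kernel_bound * (t - s))\<^sup>2 * (\<integral>w. ?A w \<partial>P)" by simp
  also have "(\<integral>w. ?A w \<partial>P) \<le> (\<integral>w. \<bar>?A w\<bar> \<partial>P)" using A(1) by (intro integral_mono) auto
  also have "\<dots> \<le> (\<integral>w. Q t w - Q s w \<partial>P)" by (rule A(2))
  finally show "(\<integral>w. (remainder s t w)\<^sup>2 \<partial>P) \<le> (kernel_bound * (t - s))\<^sup>2 * (\<integral>w. Q t w - Q s w \<partial>P)"
    by (simp add: mult_left_mono)
qed

end

section \<open>Continuity on a half-open interval and uniqueness of the bracket\<close>

lemma continuous_on_right_open_interval:
  fixes f :: "real \<Rightarrow> real"
  assumes "\<And>t. t < T \<Longrightarrow> continuous_on {0..t} f"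
  shows "continuous_on {0..<T} f"
  unfolding continuous_on_eq_continuous_within
proof
  fix x assume x: "x \<in> {0..<T}"
  define t where "t = (x + T) / 2"
  have t: "x < t" "t < T" using x by (auto simp: t_def)
  have "continuous (at x within {0..t}) f"
    using assms[OF t(2)] x t unfolding continuous_on_eq_continuous_within by simp
  moreover have "at x within {0..<T} = at x within {0..t}"
    by (rule at_within_nhd[of x "{..<t}"]) (use t in auto)
  ultimately show "continuous (at x within {0..<T}) f" by simp
qed

lemma quadratic_variationD:
  assumes "quadratic_variation P F T X Q" "t \<in> {0..<T}" "0 < \<epsilon>" "0 < \<eta>"
  shows "\<exists>\<delta>>0. \<forall>n p. is_partition t n p \<and> mesh_below \<delta> n p \<longrightarrow>
    measure P {w \<in> space P. \<bar>(\<Sum>i<n. (X (p (Suc i)) w - X (p i) w)\<^sup>2) - Q t w\<bar> > \<epsilon>} < \<eta>"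
  using assms(1)[unfolded quadratic_variation_def, THEN conjunct2, THEN conjunct2] assms(2-4) by simp

text \<open>Both candidates are compared with the sum of squares along one partition that is fine
  enough for each. A distance above \<open>2 * \<epsilon>\<close> then forces one of two events of
  arbitrarily small probability.\<close>

lemma (in stochastic_basis) quadratic_variation_unique:
  assumes Q: "quadratic_variation P F T X Q" and Q': "quadratic_variation P F T X Q'"
    and X: "\<And>t. t \<in> {0..<T} \<Longrightarrow> X t \<in> borel_measurable P" and t: "t \<in> {0..<T}"
  shows "AE w in P. Q t w = Q' t w"
proof -
  have adapted: "Z t \<in> borel_measurable P" if "quadratic_variation P F T X Z" for Z
  proof -
    have "Z t \<in> borel_measurable (F t)" using that t unfolding quadratic_variation_def adapted_process_def by blast
    then show ?thesis by (rule measurable_from_subalg[OF subalg, rotated]) (use t in auto)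
  qed
  note [measurable] = adapted[OF Q] adapted[OF Q']
  have null: "prob {w \<in> space P. \<bar>Q t w - Q' t w\<bar> > 2 * \<epsilon>} = 0" if \<epsilon>: "0 < \<epsilon>" for \<epsilon>
  proof (rule antisym[OF field_le_epsilon])
    fix \<eta> :: real assume "0 < \<eta>"
    then have \<eta>: "0 < \<eta> / 2" by simp
    obtain d where d: "0 < d" "\<And>n p. is_partition t n p \<Longrightarrow> mesh_below d n p \<Longrightarrow>
      prob {w \<in> space P. \<bar>(\<Sum>i<n. (X (p (Suc i)) w - X (p i) w)\<^sup>2) - Q t w\<bar> > \<epsilon>} < \<eta> / 2"
      using quadratic_variationD[OF Q t \<epsilon> \<eta>] by blast
    obtain d' where d': "0 < d'" "\<And>n p. is_partition t n p \<Longrightarrow> mesh_below d' n p \<Longrightarrow>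
      prob {w \<in> space P. \<bar>(\<Sum>i<n. (X (p (Suc i)) w - X (p i) w)\<^sup>2) - Q' t w\<bar> > \<epsilon>} < \<eta> / 2"
      using quadratic_variationD[OF Q' t \<epsilon> \<eta>] by blast
    have "0 \<le> t" "0 < min d d'" using t d(1) d'(1) by auto
    from exists_fine_partition[OF this] obtain n p where
      p: "is_partition t n p" "mesh_below (min d d') n p" by blast
    define S where "S w = (\<Sum>i<n. (X (p (Suc i)) w - X (p i) w)\<^sup>2)" for w
    have [measurable]: "S \<in> borel_measurable P"
      unfolding S_def
    proof (intro borel_measurable_sum borel_measurable_power borel_measurable_diff X)
      fix i assume "i \<in> {..<n}"
      then show "p (Suc i) \<in> {0..<T}" "p i \<in> {0..<T}"
        using partition_bounds[OF p(1), of i] partition_bounds[OF p(1), of "Suc i"] t by auto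
    qed
    have "prob {w \<in> space P. \<bar>Q t w - Q' t w\<bar> > 2 * \<epsilon>}
        \<le> prob ({w \<in> space P. \<bar>S w - Q t w\<bar> > \<epsilon>} \<union> {w \<in> space P. \<bar>S w - Q' t w\<bar> > \<epsilon>})"
    proof (rule finite_measure_mono, rule subsetI)
      fix w assume "w \<in> {w \<in> space P. \<bar>Q t w - Q' t w\<bar> > 2 * \<epsilon>}"
      then have "w \<in> space P" "\<bar>Q t w - Q' t w\<bar> > 2 * \<epsilon>" by simp_all
      then show "w \<in> {w \<in> space P. \<bar>S w - Q t w\<bar> > \<epsilon>} \<union> {w \<in> space P. \<bar>S w - Q' t w\<bar> > \<epsilon>}"
        unfolding Un_iff mem_Collect_eq by linarith
    qed measurable
    also have "\<dots> \<le> prob {w \<in> space P. \<bar>S w - Q t w\<bar> > \<epsilon>} + prob {w \<in> space P. \<bar>S w - Q' t w\<bar> > \<epsilon>}"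
      by (rule measure_Un_le) measurable
    also have "\<dots> \<le> \<eta> / 2 + \<eta> / 2"
      unfolding S_def
      by (intro add_mono less_imp_le d(2)[OF p(1)] d'(2)[OF p(1)]; use p(2) in simp)
    finally show "prob {w \<in> space P. \<bar>Q t w - Q' t w\<bar> > 2 * \<epsilon>} \<le> 0 + \<eta>" by simp
  qed simp
  have "AE w in P. \<not> \<bar>Q t w - Q' t w\<bar> > 2 * (1 / real (Suc k))" for k
  proof (rule AE_I[where N="{w \<in> space P. \<bar>Q t w - Q' t w\<bar> > 2 * (1 / real (Suc k))}"])
    show "emeasure P {w \<in> space P. \<bar>Q t w - Q' t w\<bar> > 2 * (1 / real (Suc k))} = 0"
      using null[of "1 / real (Suc k)"] by (simp add: emeasure_eq_measure)
  qed auto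
  then have "AE w in P. \<forall>k. \<not> \<bar>Q t w - Q' t w\<bar> > 2 * (1 / real (Suc k))" unfolding AE_all_countable by blast
  then show ?thesis
  proof (rule eventually_mono)
    fix w assume k: "\<forall>k. \<not> \<bar>Q t w - Q' t w\<bar> > 2 * (1 / real (Suc k))"
    have "(\<lambda>k. 2 * (1 / real (Suc k))) \<longlonglongrightarrow> 2 * 0"
      by (intro tendsto_mult tendsto_const LIMSEQ_Suc[OF lim_1_over_n])
    then have "\<bar>Q t w - Q' t w\<bar> \<le> 2 * 0"
    proof (rule LIMSEQ_le_const)
      show "\<exists>N. \<forall>n\<ge>N. \<bar>Q t w - Q' t w\<bar> \<le> 2 * (1 / real (Suc n))"
        using k unfolding not_less by blast
    qed
    then show "Q t w = Q' t w" by simp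
  qed
qed

text \<open>Young's inequality with a free parameter. Later \<open>\<delta>\<close> is also the mesh
  bound, so the large factor \<open>1 / \<delta>\<close> meets a remainder whose square is of order
  \<open>\<delta>\<^sup>2\<close>.\<close>

lemma square_perturbation:
  fixes a r \<delta> :: real
  assumes "0 < \<delta>"
  shows "\<bar>(a + r)\<^sup>2 - a\<^sup>2\<bar> \<le> \<delta> * a\<^sup>2 + (1 + 1 / \<delta>) * r\<^sup>2"
proof -
  have "2 * \<bar>a\<bar> * \<bar>r\<bar> \<le> \<delta> * a\<^sup>2 + r\<^sup>2 / \<delta>"
  proof -
    have "0 \<le> (\<delta> * \<bar>a\<bar> - \<bar>r\<bar>)\<^sup>2 / \<delta>" using assms by simp
    also have "\<dots> = \<delta> * a\<^sup>2 + r\<^sup>2 / \<delta> - 2 * \<bar>a\<bar> * \<bar>r\<bar>"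
      using assms by (simp add: power2_diff power_mult_distrib power2_eq_square field_simps)
    finally show ?thesis by simp
  qed
  moreover have "\<bar>(a + r)\<^sup>2 - a\<^sup>2\<bar> \<le> 2 * \<bar>a\<bar> * \<bar>r\<bar> + r\<^sup>2"
  proof -
    have "(a + r)\<^sup>2 - a\<^sup>2 = 2 * a * r + r\<^sup>2" by (simp add: power2_sum)
    also have "\<bar>\<dots>\<bar> \<le> \<bar>2 * a * r\<bar> + \<bar>r\<^sup>2\<bar>" by (rule abs_triangle_ineq)
    finally show ?thesis by (simp add: abs_mult)
  qed
  ultimately show ?thesis by (simp add: distrib_right)
qed

section \<open>Sums of squares of the transform and its bracket\<close>

context theta_setting
begin

text \<open>With one \<open>\<delta>\<close> for the mesh and for Young's inequality, the
  coefficient \<open>(1 + 1 / \<delta>) * (kernel_bound * \<delta>)\<^sup>2\<close> equals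
  \<open>(\<delta> + 1) * \<delta> * kernel_bound\<^sup>2\<close>. As \<delta> \<le> 1 this is at
  most \<open>2 * \<delta> * kernel_bound\<^sup>2\<close>, and the expected bracket increments
  telescope.\<close>

lemma perturbation_expectation:
  assumes p: "is_partition b n p" "mesh_below \<delta> n p" and \<delta>: "0 < \<delta>" "\<delta> \<le> 1"
  defines "X \<equiv> \<lambda>w. \<Sum>i<n. \<delta> * (L (p (Suc i)) w - L (p i) w)\<^sup>2
    + (1 + 1 / \<delta>) * (remainder (p i) (p (Suc i)) w)\<^sup>2"
  shows "integrable P X" "(\<integral>w. X w \<partial>P) \<le> \<delta> * ((1 + 2 * kernel_bound\<^sup>2) * (\<integral>w. Q b w \<partial>P))"
proof -
  have bd: "0 \<le> p i" "p i \<le> p (Suc i)" "p (Suc i) \<le> b" if "i < n" for i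
    using partition_bounds[OF p(1), of i] partition_bounds[OF p(1), of "Suc i"] p(1) that
    by (auto simp: is_partition_def)
  let ?l = "\<lambda>i w. (L (p (Suc i)) w - L (p i) w)\<^sup>2"
  let ?r = "\<lambda>i w. (remainder (p i) (p (Suc i)) w)\<^sup>2"
  let ?q = "\<lambda>i. \<integral>w. Q (p (Suc i)) w - Q (p i) w \<partial>P"
  have li: "integrable P (?l i)" if "i < n" for i using L_diff_square_integrable bd[OF that] b by auto
  have ri: "integrable P (?r i)" if "i < n" for i using remainder_second_moment(1)[OF bd[OF that]] .
  show "integrable P X" unfolding X_def
    using li ri by (intro Bochner_Integration.integrable_sum Bochner_Integration.integrable_add integrable_mult_right) auto
  have q0: "0 \<le> ?q i" if "i < n" for i
    using Q_mono bd[OF that] b by (intro integral_nonneg_AE AE_I2) auto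
  have Qi: "integrable P (Q u)" if "0 \<le> u" "u \<le> b" for u using Q_integrable_expectation b that by auto
  have "(\<Sum>i<n. ?q i) = (\<Sum>i<n. (\<integral>w. Q (p (Suc i)) w \<partial>P) - (\<integral>w. Q (p i) w \<partial>P))"
  proof (rule sum.cong[OF refl])
    fix i assume "i \<in> {..<n}"
    then have "integrable P (Q (p (Suc i)))" "integrable P (Q (p i))" using Qi bd[of i] by auto
    then show "?q i = (\<integral>w. Q (p (Suc i)) w \<partial>P) - (\<integral>w. Q (p i) w \<partial>P)" by simp
  qed
  also have "\<dots> = (\<integral>w. Q b w \<partial>P) - (\<integral>w. Q 0 w \<partial>P)"
    using p(1) sum_lessThan_telescope[of "\<lambda>i. \<integral>w. Q (p i) w \<partial>P" n] by (simp add: is_partition_def)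
  also have "(\<integral>w. Q 0 w \<partial>P) = (\<integral>w. 0 \<partial>P)" by (intro Bochner_Integration.integral_cong) (simp_all add: Q_zero)
  finally have qs: "(\<Sum>i<n. ?q i) = (\<integral>w. Q b w \<partial>P)" by simp
  have "(\<integral>w. X w \<partial>P) = (\<Sum>i<n. \<integral>w. \<delta> * ?l i w + (1 + 1 / \<delta>) * ?r i w \<partial>P)"
    unfolding X_def using li ri
    by (intro Bochner_Integration.integral_sum Bochner_Integration.integrable_add integrable_mult_right) auto
  also have "\<dots> \<le> (\<Sum>i<n. \<delta> * (1 + 2 * kernel_bound\<^sup>2) * ?q i)"
  proof (rule sum_mono)
    fix i assume "i \<in> {..<n}"
    then have i: "i < n" by simp
    have "(\<integral>w. \<delta> * ?l i w + (1 + 1 / \<delta>) * ?r i w \<partial>P) = \<delta> * (\<integral>w. ?l i w \<partial>P) + (1 + 1 / \<delta>) * (\<integral>w. ?r i w \<partial>P)"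
      using li[OF i] ri[OF i] by simp
    also have "(\<integral>w. ?l i w \<partial>P) = ?q i" using L_increment_bracket bd[OF i] b by simp
    also have "(1 + 1 / \<delta>) * (\<integral>w. ?r i w \<partial>P) \<le> (1 + 1 / \<delta>) * ((kernel_bound * \<delta>)\<^sup>2 * ?q i)"
    proof (intro mult_left_mono order_trans[OF remainder_second_moment(2)[OF bd[OF i]]] mult_right_mono power_mono)
      show "p (Suc i) - p i \<le> \<delta>" using p(2) i by (simp add: less_imp_le)
    qed (use q0[OF i] kernel_bound_nonneg bd[OF i] \<delta> in auto)
    also have "(1 + 1 / \<delta>) * ((kernel_bound * \<delta>)\<^sup>2 * ?q i) = (\<delta> + 1) * (\<delta> * kernel_bound\<^sup>2 * ?q i)"
      using \<delta> by (simp add: power2_eq_square field_simps)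
    also have "\<dots> \<le> 2 * (\<delta> * kernel_bound\<^sup>2 * ?q i)"
      using \<delta> q0[OF i] by (intro mult_right_mono) auto
    finally show "(\<integral>w. \<delta> * ?l i w + (1 + 1 / \<delta>) * ?r i w \<partial>P) \<le> \<delta> * (1 + 2 * kernel_bound\<^sup>2) * ?q i"
      by (simp add: algebra_simps)
  qed
  also have "\<dots> = \<delta> * ((1 + 2 * kernel_bound\<^sup>2) * (\<integral>w. Q b w \<partial>P))"
    unfolding sum_distrib_left[symmetric] qs by simp
  finally show "(\<integral>w. X w \<partial>P) \<le> \<delta> * ((1 + 2 * kernel_bound\<^sup>2) * (\<integral>w. Q b w \<partial>P))" .
qed

text \<open>Three errors of a third of \<open>\<epsilon>\<close> each: replacing increments of
  \<open>M\<close> by \<open>root\<close> times increments of \<open>L\<close>, replacing weighted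
  squares by weighted bracket increments (the weighted Saks--Henstock estimate), and replacing the
  resulting Riemann-type sum by the integral.\<close>

lemma M_squares_converge_L1:
  assumes "0 < \<epsilon>"
  shows "\<exists>\<delta>>0. \<forall>n p. is_partition b n p \<and> mesh_below \<delta> n p \<longrightarrow>
    integrable P (\<lambda>w. (\<Sum>i<n. (M (p (Suc i)) w - M (p i) w)\<^sup>2) - weighted_bracket w) \<and>
    (\<integral>w. \<bar>(\<Sum>i<n. (M (p (Suc i)) w - M (p i) w)\<^sup>2) - weighted_bracket w\<bar> \<partial>P) \<le> \<epsilon>"
proof -
  define q where "q = (\<integral>w. Q b w \<partial>P)"
  have Qi: "integrable P (Q b)" using Q_integrable_expectation b by auto
  have q: "0 \<le> q" unfolding q_def using Q_nonneg b by (intro integral_nonneg_AE AE_I2) auto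
  define c where "c = (1 + 2 * kernel_bound\<^sup>2) * q"
  have c: "0 \<le> c" using q by (simp add: c_def)
  define \<eta> where "\<eta> = \<epsilon> / (3 * (q + 1))"
  have \<eta>: "0 < \<eta>" using assms q by (simp add: \<eta>_def)
  have "\<eta> * q \<le> \<epsilon> / 3" using assms q by (simp add: \<eta>_def field_simps)
  note \<eta>q = this
  have e3: "0 < \<epsilon> / 3" using assms by simp
  obtain \<delta>1 where \<delta>1: "0 < \<delta>1" "\<And>n p c. is_partition b n p \<Longrightarrow> mesh_below \<delta>1 n p \<Longrightarrow>
      (\<forall>i<n. c i \<in> {0..1}) \<Longrightarrow> (\<integral>w. \<bar>\<Sum>i<n. c i * compensated (p i) (p (Suc i)) w\<bar> \<partial>P) \<le> \<epsilon> / 3"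
    using saks_henstock_weighted[OF b e3] by blast
  have "uniformly_continuous_on {0..b} (weight T \<theta>)"
    using weight_continuous[OF T_pos b(2)] by (intro compact_uniformly_continuous) auto
  then obtain \<delta>2 where \<delta>2: "0 < \<delta>2" "\<And>u v. u \<in> {0..b} \<Longrightarrow> v \<in> {0..b} \<Longrightarrow> dist u v < \<delta>2 \<Longrightarrow>
      dist (weight T \<theta> u) (weight T \<theta> v) < \<eta>"
    using \<eta> unfolding uniformly_continuous_on_def by blast
  \<comment> \<open>\<open>\<delta>1\<close> serves the compensated squares,
    \<open>\<delta>2\<close> the oscillation of the weight, and 1 together with the last term the
    perturbation; \<open>c + 1\<close> is used because \<open>c\<close> may be 0.\<close>
  define \<delta> where "\<delta> = min (min \<delta>1 \<delta>2) (min 1 (\<epsilon> / 3 / (c + 1)))"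
  have \<delta>: "0 < \<delta>" "\<delta> \<le> \<delta>1" "\<delta> \<le> \<delta>2" "\<delta> \<le> 1" "\<delta> \<le> \<epsilon> / 3 / (c + 1)"
    using \<delta>1(1) \<delta>2(1) assms c by (auto simp: \<delta>_def)
  have "\<delta> * c \<le> \<epsilon> / 3 / (c + 1) * (c + 1)" using \<delta> c by (intro mult_mono) auto
  also have "\<dots> = \<epsilon> / 3"
    using c nonzero_eq_divide_eq[of "c + 1" "\<epsilon> / 3 / (c + 1)" "\<epsilon> / 3"] by argo
  finally have \<delta>c: "\<delta> * c \<le> \<epsilon> / 3" .
  have "integrable P (\<lambda>w. (\<Sum>i<n. (M (p (Suc i)) w - M (p i) w)\<^sup>2) - weighted_bracket w) \<and>
    (\<integral>w. \<bar>(\<Sum>i<n. (M (p (Suc i)) w - M (p i) w)\<^sup>2) - weighted_bracket w\<bar> \<partial>P) \<le> \<epsilon>"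
    if p: "is_partition b n p" "mesh_below \<delta> n p" for n p
  proof -
    have bd: "0 \<le> p i" "p i \<le> p (Suc i)" "p (Suc i) \<le> b" if "i < n" for i
      using partition_bounds[OF p(1), of i] partition_bounds[OF p(1), of "Suc i"] p(1) that
      by (auto simp: is_partition_def)
    define wt where "wt i = weight T \<theta> (p (Suc i))" for i
    have wt: "0 \<le> wt i" "wt i \<le> 1" if "i < n" for i
      using weight_bounds[OF T_pos theta(2), of "p (Suc i)"] bd[OF that] b by (auto simp: wt_def)
    define X where "X w = (\<Sum>i<n. \<delta> * (L (p (Suc i)) w - L (p i) w)\<^sup>2
      + (1 + 1 / \<delta>) * (remainder (p i) (p (Suc i)) w)\<^sup>2)" for w
    define Y where "Y w = (\<Sum>i<n. wt i * compensated (p i) (p (Suc i)) w)" for w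
    define S where "S w = (\<Sum>i<n. (M (p (Suc i)) w - M (p i) w)\<^sup>2)" for w
    have X: "integrable P X" "(\<integral>w. X w \<partial>P) \<le> \<epsilon> / 3"
      using perturbation_expectation[OF p \<delta>(1,4)] \<delta>c by (simp_all add: X_def[abs_def] c_def q_def)
    have "integrable P (compensated (p i) (p (Suc i)))" if "i < n" for i
      using bd[OF that] b by (intro compensated_integrable) auto
    then have Y: "integrable P Y"
      unfolding Y_def[abs_def] by (intro Bochner_Integration.integrable_sum integrable_mult_right) simp_all
    have "mesh_below \<delta>1 n p" using p(2) \<delta>(2) less_le_trans by blast
    then have EY: "(\<integral>w. \<bar>Y w\<bar> \<partial>P) \<le> \<epsilon> / 3" unfolding Y_def using wt by (intro \<delta>1(2)[OF p(1)]) auto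
    have bound: "\<bar>S w - weighted_bracket w\<bar> \<le> X w + \<bar>Y w\<bar> + \<eta> * Q b w" if w: "w \<in> space P" for w
    proof -
      let ?l = "\<lambda>i. L (p (Suc i)) w - L (p i) w"
      let ?q = "\<lambda>i. Q (p (Suc i)) w - Q (p i) w"
      have 1: "\<bar>S w - (\<Sum>i<n. wt i * (?l i)\<^sup>2)\<bar> \<le> X w"
        unfolding S_def X_def sum_subtractf[symmetric]
      proof (rule order_trans[OF sum_abs sum_mono])
        fix i assume "i \<in> {..<n}"
        then have i: "i < n" by simp
        let ?a = "root (p (Suc i)) * ?l i" and ?r = "remainder (p i) (p (Suc i)) w"
        have a: "?a\<^sup>2 = wt i * (?l i)\<^sup>2" by (simp add: power_mult_distrib root_square wt_def)
        have "\<bar>(M (p (Suc i)) w - M (p i) w)\<^sup>2 - wt i * (?l i)\<^sup>2\<bar> = \<bar>(?a + ?r)\<^sup>2 - ?a\<^sup>2\<bar>"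
          unfolding a by (simp add: remainder_def)
        also have "\<dots> \<le> \<delta> * ?a\<^sup>2 + (1 + 1 / \<delta>) * ?r\<^sup>2" by (rule square_perturbation[OF \<delta>(1)])
        also have "\<delta> * ?a\<^sup>2 \<le> \<delta> * (?l i)\<^sup>2"
          unfolding a using wt[OF i] \<delta>(1) by (intro mult_left_mono mult_left_le_one_le) auto
        finally show "\<bar>(M (p (Suc i)) w - M (p i) w)\<^sup>2 - wt i * (?l i)\<^sup>2\<bar> \<le> \<delta> * (?l i)\<^sup>2 + (1 + 1 / \<delta>) * ?r\<^sup>2"
          by simp
      qed
      have 2: "(\<Sum>i<n. wt i * (?l i)\<^sup>2) = Y w + (\<Sum>i<n. wt i * ?q i)"
        unfolding Y_def sum.distrib[symmetric] by (intro sum.cong refl) (simp add: compensated_def algebra_simps)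
      \<comment> \<open>No interval is cut here, so the boundary layer of
        \<open>weighted_increments\<close> has width 0 and its contribution vanishes.\<close>
      have "\<bar>(\<Sum>i<n. wt i * ?q i) - integral {0..b} (\<lambda>u. weight T \<theta> u * D u w)\<bar>
        \<le> \<eta> * (Q b w - Q 0 w) + (Q b w - Q (b - 0) w)"
      proof (rule weighted_increments[OF p(1)])
        show "(\<lambda>u. D u w) integrable_on {0..b}" using Q_eq_integral[of b w] b w by auto
        show "(\<lambda>u. weight T \<theta> u * D u w) integrable_on {0..b}" by (rule weighted_bracket_integral(2)[OF w])
        show "0 \<le> D u w" if "u \<in> {0..b}" for u using that b w by (intro D_nonneg) auto
        show "Q t w - Q s w = integral {s..t} (\<lambda>u. D u w)" if "0 \<le> s" "s \<le> t" "t \<le> b" for s t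
          using that b w by (intro Q_diff) auto
        fix i u assume i: "i < n" and u: "u \<in> {p i..p (Suc i)}"
        have "dist (p (Suc i)) u < \<delta>2" using p(2)[rule_format, OF i] u \<delta>(3) by (simp add: dist_real_def)
        then have "dist (weight T \<theta> (p (Suc i))) (weight T \<theta> u) < \<eta>"
          using bd[OF i] u by (intro \<delta>2(2)) auto
        then show "\<bar>wt i - weight T \<theta> u\<bar> \<le> \<eta> + (if b - 0 \<le> u then 1 else 0)"
          by (simp add: wt_def dist_real_def)
      qed (use \<eta> b in auto)
      then have 3: "\<bar>(\<Sum>i<n. wt i * ?q i) - weighted_bracket w\<bar> \<le> \<eta> * Q b w"
        unfolding weighted_bracket_integral(1)[OF w] using Q_zero[OF w] by simp
      show ?thesis using 1 3 unfolding 2 by linarith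
    qed
    have Mm: "M (p i) \<in> borel_measurable P" if "i \<le> n" for i
      using partition_bounds[OF p(1) that] by (rule M_measurable)
    have Sm: "S \<in> borel_measurable P"
      unfolding S_def[abs_def] using Mm
      by (intro borel_measurable_sum borel_measurable_power borel_measurable_diff) auto
    have Z: "integrable P (\<lambda>w. X w + \<bar>Y w\<bar> + \<eta> * Q b w)" using X(1) Y Qi by simp
    have Si: "integrable P (\<lambda>w. S w - weighted_bracket w)"
    proof (rule Bochner_Integration.integrable_bound[OF Z])
      show "(\<lambda>w. S w - weighted_bracket w) \<in> borel_measurable P"
        using Sm weighted_bracket_integrable by simp
      show "AE w in P. norm (S w - weighted_bracket w) \<le> norm (X w + \<bar>Y w\<bar> + \<eta> * Q b w)"
        unfolding real_norm_def by (rule AE_I2) (rule order_trans[OF bound abs_ge_self])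
    qed
    have "(\<integral>w. \<bar>S w - weighted_bracket w\<bar> \<partial>P) \<le> (\<integral>w. X w + \<bar>Y w\<bar> + \<eta> * Q b w \<partial>P)"
      using Si Z bound by (intro integral_mono) auto
    also have "\<dots> = (\<integral>w. X w \<partial>P) + (\<integral>w. \<bar>Y w\<bar> \<partial>P) + \<eta> * q" using X(1) Y Qi by (simp add: q_def)
    also have "\<dots> \<le> \<epsilon>" using X(2) EY \<eta>q by simp
    finally show ?thesis using Si by (simp add: S_def)
  qed
  then show ?thesis using \<delta>(1) by blast
qed

end

text \<open>Each time \<open>t\<close> is taken as the right end of its own
  \<open>theta_setting\<close>, and Markov's inequality turns the L_1 convergence there into
  convergence in probability. The path properties hold everywhere because the candidate is a
  primitive of a nonnegative function.\<close>

lemma (in bracketed_martingale) RL_quadratic_variation: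
  assumes theta: "0 < \<theta>" "\<theta> \<le> 1"
  shows "quadratic_variation P F T (RL_operator T ((1 - \<theta>) / 2) L)
    (\<lambda>t w. LBINT u:{0..t}. weight T \<theta> u * D u w)"
proof -
  let ?M = "RL_operator T ((1 - \<theta>) / 2) L"
  let ?W = "\<lambda>t w. LBINT u:{0..t}. weight T \<theta> u * D u w"
  have setting: "theta_setting P F T L D \<theta> t" if "t \<in> {0..<T}" for t
    using theta that by unfold_locales auto
  have W: "?W t = theta_setting.weighted_bracket T D \<theta> t" if "t \<in> {0..<T}" for t
    using theta_setting.weighted_bracket_def[OF setting[OF that]] by auto
  have WI: "?W t w = integral {0..t} (\<lambda>u. weight T \<theta> u * D u w)"
    "(\<lambda>u. weight T \<theta> u * D u w) integrable_on {0..t}" if "t \<in> {0..<T}" "w \<in> space P" for t w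
    using theta_setting.weighted_bracket_integral[OF setting[OF that(1)] that(2)]
      fun_cong[OF W[OF that(1)], of w] by simp_all
  have zero: "0 \<in> {0..<T}" using T_pos by simp
  show ?thesis unfolding quadratic_variation_def
  proof (intro conjI)
    show "adapted_process F T ?W"
      unfolding adapted_process_def
    proof
      fix t assume t: "t \<in> {0..<T}"
      show "?W t \<in> borel_measurable (F t)"
        unfolding W[OF t] by (rule theta_setting.weighted_bracket_measurable[OF setting[OF t]])
    qed
    show "AE w in P. ?W 0 w = 0 \<and> mono_on {0..<T} (\<lambda>t. ?W t w) \<and> continuous_on {0..<T} (\<lambda>t. ?W t w)"
    proof (rule AE_I2, intro conjI)
      fix w assume w: "w \<in> space P"
      show "?W 0 w = 0" unfolding WI(1)[OF zero w] by simp
      show "mono_on {0..<T} (\<lambda>t. ?W t w)"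
      proof (rule mono_onI)
        fix s t assume st: "s \<in> {0..<T}" "t \<in> {0..<T}" "s \<le> t"
        show "?W s w \<le> ?W t w"
          unfolding WI(1)[OF st(1) w] WI(1)[OF st(2) w]
        proof (rule integral_subset_le)
          show "\<forall>u\<in>{0..t}. 0 \<le> weight T \<theta> u * D u w"
          proof
            fix u assume "u \<in> {0..t}"
            then show "0 \<le> weight T \<theta> u * D u w"
              using st weight_bounds[OF T_pos theta(2), of u] D_nonneg[of u w] w by auto
          qed
        qed (use st WI(2)[OF st(1) w] WI(2)[OF st(2) w] in auto)
      qed
      show "continuous_on {0..<T} (\<lambda>t. ?W t w)"
      proof (rule continuous_on_right_open_interval)
        fix t assume t: "t < T"
        show "continuous_on {0..t} (\<lambda>t. ?W t w)"
        proof (cases "0 \<le> t")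
          case True
          then have "continuous_on {0..t} (\<lambda>v. integral {0..v} (\<lambda>u. weight T \<theta> u * D u w))"
            using WI(2)[of t w] t w by (intro indefinite_integral_continuous_1) auto
          moreover have "integral {0..v} (\<lambda>u. weight T \<theta> u * D u w) = ?W v w" if "v \<in> {0..t}" for v
            using WI(1)[of v w] that t w by auto
          ultimately show ?thesis by (rule continuous_on_eq)
        qed auto
      qed
    qed
    show "\<forall>t\<in>{0..<T}. \<forall>\<epsilon>>0. \<forall>\<eta>>0. \<exists>\<delta>>0. \<forall>n p.
        is_partition t n p \<and> mesh_below \<delta> n p \<longrightarrow>
        prob {w \<in> space P. \<bar>(\<Sum>i<n. (?M (p (Suc i)) w
          - ?M (p i) w)\<^sup>2) - ?W t w\<bar> > \<epsilon>} < \<eta>"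
    proof (intro ballI allI impI)
      fix t \<epsilon> \<eta> :: real assume t: "t \<in> {0..<T}" and pos: "0 < \<epsilon>" "0 < \<eta>"
      interpret t: theta_setting P F T L D \<theta> t by (rule setting[OF t])
      have M: "?M = t.M" by (simp add: t.M_def t.\<alpha>_def)
      \<comment> \<open>Markov's inequality divides by \<open>\<epsilon>\<close>; the half makes the
        resulting bound strictly smaller than \<open>\<eta>\<close>.\<close>
      have "0 < \<epsilon> * \<eta> / 2" using pos by simp
      from t.M_squares_converge_L1[OF this] obtain \<delta> where \<delta>: "0 < \<delta>"
        "\<And>n p. is_partition t n p \<Longrightarrow> mesh_below \<delta> n p \<Longrightarrow>
          integrable P (\<lambda>w. (\<Sum>i<n. (t.M (p (Suc i)) w - t.M (p i) w)\<^sup>2) - t.weighted_bracket w) \<and>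
          (\<integral>w. \<bar>(\<Sum>i<n. (t.M (p (Suc i)) w - t.M (p i) w)\<^sup>2) - t.weighted_bracket w\<bar> \<partial>P) \<le> \<epsilon> * \<eta> / 2"
        by blast
      have "prob {w \<in> space P. \<bar>(\<Sum>i<n. (t.M (p (Suc i)) w - t.M (p i) w)\<^sup>2) - t.weighted_bracket w\<bar> > \<epsilon>} < \<eta>"
        if p: "is_partition t n p" "mesh_below \<delta> n p" for n p
      proof -
        define Z where "Z w = \<bar>(\<Sum>i<n. (t.M (p (Suc i)) w - t.M (p i) w)\<^sup>2) - t.weighted_bracket w\<bar>" for w
        have Z: "integrable P Z" "(\<integral>w. Z w \<partial>P) \<le> \<epsilon> * \<eta> / 2"
          using \<delta>(2)[OF p] by (simp_all add: Z_def[abs_def])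
        then have [measurable]: "Z \<in> borel_measurable P" by auto
        have "prob {w \<in> space P. Z w > \<epsilon>} \<le> prob {w \<in> space P. Z w \<ge> \<epsilon>}"
          by (rule finite_measure_mono) auto
        also have "\<dots> \<le> (\<integral>w. Z w \<partial>P) / \<epsilon>"
          by (rule integral_Markov_inequality_measure[OF Z(1) sets.empty_sets]) (use pos in \<open>simp_all add: Z_def\<close>)
        also have "\<dots> \<le> (\<epsilon> * \<eta> / 2) / \<epsilon>" using Z(2) pos by (intro divide_right_mono) auto
        also have "\<dots> < \<eta>" using pos by simp
        finally show ?thesis by (simp add: Z_def)
      qed
      then show "\<exists>\<delta>>0. \<forall>n p. is_partition t n p \<and> mesh_below \<delta> n p \<longrightarrow>
        prob {w \<in> space P. \<bar>(\<Sum>i<n. (?M (p (Suc i)) w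
          - ?M (p i) w)\<^sup>2) - ?W t w\<bar> > \<epsilon>} < \<eta>"
        using \<delta>(1) unfolding M t.weighted_bracket_def by blast
    qed
  qed
qed

text \<open>The bracket of the transform enters as a predicate, so the limit is claimed for every
  version of it; the existence part ensures that this claim is not vacuous.\<close>

theorem theorem4p1:
  fixes P :: "'a measure" and F :: "real \<Rightarrow> 'a measure" and T \<theta> :: real
    and L D :: "real \<Rightarrow> 'a \<Rightarrow> real"
  assumes basis: "stochastic_basis P F T"
    and L_martingale: "martingale_process P F T L"
    and L_continuous: "\<And>\<omega>. \<omega> \<in> space P \<Longrightarrow> continuous_on {0..<T} (\<lambda>t. L t \<omega>)"
    and L_square_integrable: "\<And>t. t \<in> {0..<T} \<Longrightarrow> integrable P (\<lambda>\<omega>. (L t \<omega>)\<^sup>2)"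
    and L_zero: "\<And>\<omega>. \<omega> \<in> space P \<Longrightarrow> L 0 \<omega> = 0"
    and D_progressive: "progressively_measurable F T D"
    and D_nonneg: "\<And>u \<omega>. u \<in> {0..<T} \<Longrightarrow> \<omega> \<in> space P \<Longrightarrow> 0 \<le> D u \<omega>"
    and D_integrable: "\<And>b \<omega>. b \<in> {0..<T} \<Longrightarrow> \<omega> \<in> space P \<Longrightarrow>
          set_integrable lborel {0..b} (\<lambda>u. D u \<omega>)"
    and L_bracket: "quadratic_variation P F T L (\<lambda>b \<omega>. LBINT u:{0..b}. D u \<omega>)"
    and theta: "0 < \<theta>" "\<theta> \<le> 1"
  shows "(\<exists>Q. quadratic_variation P F T (RL_operator T ((1 - \<theta>) / 2) L) Q) \<and>
    (\<forall>Q. quadratic_variation P F T (RL_operator T ((1 - \<theta>) / 2) L) Q \<longrightarrow>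
      (\<forall>b\<in>{0..<T}.
        (\<lambda>n. L1_norm P (\<lambda>\<omega>. 2 * \<theta> * real n / T * net_error L n (theta_net T \<theta> n) b \<omega> - Q b \<omega>))
          \<longlonglongrightarrow> 0))"
proof -
  interpret stochastic_basis P F T by (rule basis)
  interpret bracketed_martingale P F T L D
    using assms by unfold_locales auto
  note W = RL_quadratic_variation[OF theta]
  have setting: "theta_setting P F T L D \<theta> b" if "b \<in> {0..<T}" for b
    using theta that by unfold_locales auto
  have M: "RL_operator T ((1 - \<theta>) / 2) L b \<in> borel_measurable P" if "b \<in> {0..<T}" for b
  proof -
    interpret b: theta_setting P F T L D \<theta> b by (rule setting[OF that])
    show ?thesis using b.M_measurable[of b] that by (simp add: b.M_def b.\<alpha>_def)
  qed
  have "(\<lambda>n. L1_norm P (\<lambda>w. 2 * \<theta> * real n / T * net_error L n (theta_net T \<theta> n) b w - Q b w)) \<longlonglongrightarrow> 0"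
    if Q: "quadratic_variation P F T (RL_operator T ((1 - \<theta>) / 2) L) Q" and b: "b \<in> {0..<T}" for Q b
  proof -
    interpret b: theta_setting P F T L D \<theta> b by (rule setting[OF b])
    \<comment> \<open>The norm concerns the single time \<open>b\<close> and ignores null sets, so
      almost sure equality at that time suffices.\<close>
    have "AE w in P. Q b w = b.weighted_bracket w"
      using quadratic_variation_unique[OF Q W M b] by (simp add: b.weighted_bracket_def)
    then have "L1_norm P (\<lambda>w. 2 * \<theta> * real n / T * net_error L n (theta_net T \<theta> n) b w - Q b w) =
      (\<integral>\<^sup>+w. ennreal \<bar>2 * \<theta> * real n / T * net_error L n (theta_net T \<theta> n) b w - b.weighted_bracket w\<bar> \<partial>P)" for n
      unfolding L1_norm_def by (intro nn_integral_cong_AE) (auto elim!: eventually_mono)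
    then show ?thesis using b.scaled_net_error_converges by simp
  qed
  then show ?thesis using W by blast
qed

end
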